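(* Let $H$ be a finite dimensional Hopf algebra over $\mathbb{C}$, let $V$ be a simple vertex operator algebra which is an $H$-module VOA, and let $K=\{h\in H\mid hV=0\}$ be the kernel of the action of $H$ on $V$. Then: (a) If $K=0$, then $H$ is a group algebra (i.e. isomorphic as a Hopf algebra to $\mathbb{C}[G]$ for some finite group $G$). (b) If $K\neq0$ and $V$ is a semisimple $H$-module, then $K$ is a Hopf ideal of $H$ and $H/K$ is a group algebra.
   Context: Everything is over $\mathbb{C}$. A Hopf algebra $H$ has comultiplication $\Delta(h)=\sum h_1\otimes h_2$ (Sweedler notation), counit $\epsilon$ and antipode $S$. The group algebra $\mathbb{C}[G]$ carries the Hopf structure $\Delta(g)=g\otimes g$, $\epsilon(g)=1$, $S(g)=g^{-1}$ for $g\in G$. A vertex operator algebra (VOA) is $(V,Y,\mathbf 1,\omega)$ with $V=\bigoplus_{n\in\mathbb{Z}}V_n$, $\dim V_n<\infty$, $V_n=0$ for $n\ll 0$, $\mathbf 1\in V_0$, $\omega\in V_2$, and a linear map $u\mapsto Y(u,z)=\sum_{n\in\mathbb{Z}}u_nz^{-n-1}\in \mathrm{End}(V)[[z,z^{-1}]]$ such that: $u_nv=0$ for $n\gg0$; $Y(\mathbf 1,z)v=v$ and $\lim_{z\to0}Y(v,z)\mathbf 1=v$; writing $Y(\omega,z)=\sum_n L(n)z^{-n-2}$, one has $V_n=\{v\mid L(0)v=nv\}$, $Y(L(-1)v,z)=\frac{d}{dz}Y(v,z)$ and $[L(n),L(m)]=(n-m)L(n+m)+\delta_{n+m,0}\frac{n^3-n}{12}c$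 for some $c\in\mathbb{C}$; and the Jacobi identity holds: $$z_0^{-1}\delta\!\left(\tfrac{z_1-z_2}{z_0}\right)Y(u,z_1)Y(v,z_2)-z_0^{-1}\delta\!\left(\tfrac{-z_2+z_1}{z_0}\right)Y(v,z_2)Y(u,z_1)=z_1^{-1}\delta\!\left(\tfrac{z_2+z_0}{z_1}\right)Y(Y(u,z_0)v,z_2),$$ where $\delta(z)=\sum_{n\in\mathbb{Z}}z^n$ and $(z_1+z_2)^n=\sum_{i\ge0}\binom{n}{i}z_1^iz_2^{n-i}$. $V$ is simple if it is nonzero and has no nontrivial ideals. $V$ is an $H$-module VOA if: (i) $V$ is an $H$-module; (ii) $h\omega=\epsilon(h)\omega$ for all $h\in H$; (iii) $hY(u,z)v=\sum Y(h_1u,z)h_2v$ for all $h\in H$, $u,v\in V$. A Hopf ideal of $H$ is a subspace $I\subseteq H$ which is a two-sided ideal ($IH\subseteq I$, $HI\subseteq I$), a coideal ($\Delta(I)\subseteq H\otimes I+I\otimes H$ and $\epsilon(I)=0$), and satisfies $S(I)\subseteq I$; then $H/I$ is the quotient Hopf algebra.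
   Formalization: In the Jacobi identity defining a vertex operator algebra, binomials are expanded in nonnegative powers of the second summand (the standard convention); the printed convention has the two exponents interchanged, which makes the coefficients undefined infinite sums. *)

theory Defs
  imports Complex_Main "HOL-Algebra.QuotRing" "HOL-Algebra.Module" "HOL-Library.Poly_Mapping"
begin

text \<open>
  Hopf algebras are records in the style of HOL-Algebra, so that a quotient by a Hopf ideal is
  again such a record (with cosets as elements). The vertex operator algebra lives on a type and
  uses the locale \<open>vector_space\<close> of HOL.
\<close>

section \<open>Vector spaces and algebras over the complex numbers\<close>

definition complex_field :: "complex ring" where
  "complex_field = \<lparr>carrier = UNIV, monoid.mult = (*), one = 1, zero = 0, add = (+)\<rparr>"

definition finite_dimensional :: "(complex, 'a, 'm) module_scheme \<Rightarrow> bool" where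
  "finite_dimensional M \<longleftrightarrow>
    (\<exists>B. finite B \<and> B \<subseteq> carrier M \<and>
      (\<forall>x\<in>carrier M. \<exists>c :: 'a \<Rightarrow> complex. x = (\<Oplus>\<^bsub>M\<^esub>b\<in>B. c b \<odot>\<^bsub>M\<^esub> b)))"

definition linear_maps ::
  "(complex, 'a, 'm) module_scheme \<Rightarrow> (complex, 'b, 'n) module_scheme \<Rightarrow> ('a \<Rightarrow> 'b) set" where
  "linear_maps M N = {f \<in> carrier M \<rightarrow> carrier N.
    (\<forall>x\<in>carrier M. \<forall>y\<in>carrier M. f (x \<oplus>\<^bsub>M\<^esub> y) = f x \<oplus>\<^bsub>N\<^esub> f y) \<and>
    (\<forall>c. \<forall>x\<in>carrier M. f (c \<odot>\<^bsub>M\<^esub> x) = c \<odot>\<^bsub>N\<^esub> f x)}"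

text \<open>Unital and associative, not necessarily commutative (unlike the locale \<open>algebra\<close>
  of HOL-Algebra).\<close>

locale complex_algebra = Module.module complex_field A + ring A for A (structure) +
  assumes mult_smult_left:
      "\<lbrakk>x \<in> carrier A; y \<in> carrier A\<rbrakk> \<Longrightarrow> (c \<odot> x) \<otimes> y = c \<odot> (x \<otimes> y)"
    and mult_smult_right:
      "\<lbrakk>x \<in> carrier A; y \<in> carrier A\<rbrakk> \<Longrightarrow> x \<otimes> (c \<odot> y) = c \<odot> (x \<otimes> y)"

section \<open>Tensor products\<close>

text \<open>
  The free vector space on a set \<open>X\<close> consists of the finitely supported functions
  \<open>f\<close> with \<open>keys f \<subseteq> X\<close>; the function \<open>f\<close> stands for the formal sum of the
  \<open>lookup f x\<close> times \<open>x\<close>. The tensor product of \<open>M\<close> and \<open>N\<close> is the free vector space on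
  \<open>carrier M \<times> carrier N\<close> modulo the span of the bilinearity relations. Its elements are the
  cosets themselves, so \<open>f \<in> t\<close> says that \<open>t\<close> is the sum of the elements
  \<open>lookup f (a, b)\<close> times \<open>a \<otimes> b\<close>.
\<close>

definition free_scale :: "complex \<Rightarrow> ('x \<Rightarrow>\<^sub>0 complex) \<Rightarrow> ('x \<Rightarrow>\<^sub>0 complex)" where
  "free_scale c f = Poly_Mapping.map ((*) c) f"

lemma lookup_free_scale [simp]: "Poly_Mapping.lookup (free_scale c f) x = c * Poly_Mapping.lookup f x"
  by (simp add: free_scale_def map.rep_eq when_def)

global_interpretation free_vector_space: vector_space free_scale
  by unfold_locales (auto intro!: poly_mapping_eqI simp: lookup_add algebra_simps)

definition bilinearity_relations ::
  "(complex, 'a, 'm) module_scheme \<Rightarrow> (complex, 'b, 'n) module_scheme \<Rightarrow> ('a \<times> 'b \<Rightarrow>\<^sub>0 complex) set"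
where
  "bilinearity_relations M N =
    {Poly_Mapping.single (a \<oplus>\<^bsub>M\<^esub> a', b) 1 - Poly_Mapping.single (a, b) 1
        - Poly_Mapping.single (a', b) 1 | a a' b.
      a \<in> carrier M \<and> a' \<in> carrier M \<and> b \<in> carrier N} \<union>
    {Poly_Mapping.single (a, b \<oplus>\<^bsub>N\<^esub> b') 1 - Poly_Mapping.single (a, b) 1
        - Poly_Mapping.single (a, b') 1 | a b b'.
      a \<in> carrier M \<and> b \<in> carrier N \<and> b' \<in> carrier N} \<union>
    {Poly_Mapping.single (c \<odot>\<^bsub>M\<^esub> a, b) 1 - Poly_Mapping.single (a, b) c | c a b.
      a \<in> carrier M \<and> b \<in> carrier N} \<union>
    {Poly_Mapping.single (a, c \<odot>\<^bsub>N\<^esub> b) 1 - Poly_Mapping.single (a, b) c | c a b.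
      a \<in> carrier M \<and> b \<in> carrier N}"

definition formal_sums ::
  "(complex, 'a, 'm) module_scheme \<Rightarrow> (complex, 'b, 'n) module_scheme \<Rightarrow> ('a \<times> 'b \<Rightarrow>\<^sub>0 complex) set"
where
  "formal_sums M N = {f. Poly_Mapping.keys f \<subseteq> carrier M \<times> carrier N}"

definition tensor_class ::
  "(complex, 'a, 'm) module_scheme \<Rightarrow> (complex, 'b, 'n) module_scheme \<Rightarrow>
    ('a \<times> 'b \<Rightarrow>\<^sub>0 complex) \<Rightarrow> ('a \<times> 'b \<Rightarrow>\<^sub>0 complex) set" where
  "tensor_class M N f =
    {g \<in> formal_sums M N. g - f \<in> free_vector_space.span (bilinearity_relations M N)}"

text \<open>The pure tensor \<open>a \<otimes> b\<close>.\<close>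

definition tensor ::
  "(complex, 'a, 'm) module_scheme \<Rightarrow> (complex, 'b, 'n) module_scheme \<Rightarrow>
    'a \<Rightarrow> 'b \<Rightarrow> ('a \<times> 'b \<Rightarrow>\<^sub>0 complex) set" where
  "tensor M N a b = tensor_class M N (Poly_Mapping.single (a, b) 1)"

text \<open>
  The fields \<open>mult\<close> and \<open>one\<close> give the usual algebra structure
  \<open>(a \<otimes> b) (a' \<otimes> b') = a a' \<otimes> b b'\<close>; they are meaningful when \<open>M\<close> and \<open>N\<close> are algebras.
\<close>

definition tensor_product ::
  "(complex, 'a, 'm) module_scheme \<Rightarrow> (complex, 'b, 'n) module_scheme \<Rightarrow>
    (complex, ('a \<times> 'b \<Rightarrow>\<^sub>0 complex) set) module" where
  "tensor_product M N =
    \<lparr>carrier = tensor_class M N ` formal_sums M N,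
     monoid.mult = (\<lambda>s t. \<Union>f\<in>s. \<Union>g\<in>t. tensor_class M N
       (\<Sum>p\<in>Poly_Mapping.keys f. \<Sum>q\<in>Poly_Mapping.keys g.
         Poly_Mapping.single (fst p \<otimes>\<^bsub>M\<^esub> fst q, snd p \<otimes>\<^bsub>N\<^esub> snd q) (Poly_Mapping.lookup f p * Poly_Mapping.lookup g q))),
     one = tensor M N \<one>\<^bsub>M\<^esub> \<one>\<^bsub>N\<^esub>,
     zero = tensor_class M N 0,
     add = (\<lambda>s t. \<Union>f\<in>s. \<Union>g\<in>t. tensor_class M N (f + g)),
     smult = (\<lambda>c s. \<Union>f\<in>s. tensor_class M N (free_scale c f))\<rparr>"

text \<open>
  For bilinear \<open>\<phi>\<close> with values in \<open>P\<close>, the value below does not depend on the chosen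
  representative: \<open>tensor_lift P \<phi>\<close> is the linear map with \<open>a \<otimes> b \<mapsto> \<phi> a b\<close>.
\<close>

definition tensor_lift ::
  "(complex, 'p, 'm) module_scheme \<Rightarrow> ('a \<Rightarrow> 'b \<Rightarrow> 'p) \<Rightarrow> ('a \<times> 'b \<Rightarrow>\<^sub>0 complex) set \<Rightarrow> 'p" where
  "tensor_lift P \<phi> t =
    (let f = (SOME f. f \<in> t)
     in \<Oplus>\<^bsub>P\<^esub>p\<in>Poly_Mapping.keys f. Poly_Mapping.lookup f p \<odot>\<^bsub>P\<^esub> \<phi> (fst p) (snd p))"

text \<open>The map \<open>\<phi> \<otimes> \<psi>\<close> into the tensor product of \<open>M\<close> and \<open>N\<close>.\<close>

definition tensor_map ::
  "(complex, 'c, 'm) module_scheme \<Rightarrow> (complex, 'd, 'n) module_scheme \<Rightarrow>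
    ('a \<Rightarrow> 'c) \<Rightarrow> ('b \<Rightarrow> 'd) \<Rightarrow> ('a \<times> 'b \<Rightarrow>\<^sub>0 complex) set \<Rightarrow> ('c \<times> 'd \<Rightarrow>\<^sub>0 complex) set" where
  "tensor_map M N \<phi> \<psi> =
    tensor_lift (tensor_product M N) (\<lambda>a b. tensor M N (\<phi> a) (\<psi> b))"

text \<open>The associator \<open>(a \<otimes> b) \<otimes> c \<mapsto> a \<otimes> (b \<otimes> c)\<close>.\<close>

definition tensor_assoc ::
  "(complex, 'a, 'm) module_scheme \<Rightarrow> (complex, 'b, 'n) module_scheme \<Rightarrow>
    (complex, 'c, 'k) module_scheme \<Rightarrow>
    (('a \<times> 'b \<Rightarrow>\<^sub>0 complex) set \<times> 'c \<Rightarrow>\<^sub>0 complex) set \<Rightarrow>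
    ('a \<times> ('b \<times> 'c \<Rightarrow>\<^sub>0 complex) set \<Rightarrow>\<^sub>0 complex) set" where
  "tensor_assoc M N L =
    (let P = tensor_product M (tensor_product N L)
     in tensor_lift P (\<lambda>s c. tensor_lift P (\<lambda>a b.
          tensor M (tensor_product N L) a (tensor N L b c)) s))"

text \<open>The image of \<open>A \<otimes> B\<close> in the tensor product of \<open>M\<close> and \<open>N\<close>, for subspaces \<open>A\<close> and
  \<open>B\<close> of \<open>M\<close> and \<open>N\<close>.\<close>

definition tensor_subspace ::
  "(complex, 'a, 'm) module_scheme \<Rightarrow> (complex, 'b, 'n) module_scheme \<Rightarrow>
    'a set \<Rightarrow> 'b set \<Rightarrow> ('a \<times> 'b \<Rightarrow>\<^sub>0 complex) set set" where
  "tensor_subspace M N A B = tensor_class M N ` {f. Poly_Mapping.keys f \<subseteq> A \<times> B}"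

section \<open>Hopf algebras\<close>

record 'h hopf = "(complex, 'h) module" +
  comult :: "'h \<Rightarrow> ('h \<times> 'h \<Rightarrow>\<^sub>0 complex) set"
  counit :: "'h \<Rightarrow> complex"
  antipode :: "'h \<Rightarrow> 'h"

locale hopf_algebra = complex_algebra H for H :: "('h, 'm) hopf_scheme" (structure) +
  assumes comult_linear: "comult H \<in> linear_maps H (tensor_product H H)"
    and counit_add:
      "\<lbrakk>x \<in> carrier H; y \<in> carrier H\<rbrakk> \<Longrightarrow> counit H (x \<oplus> y) = counit H x + counit H y"
    and counit_smult: "x \<in> carrier H \<Longrightarrow> counit H (c \<odot> x) = c * counit H x"
    and antipode_linear: "antipode H \<in> linear_maps H H"
    and coassoc:
      "x \<in> carrier H \<Longrightarrow>
        tensor_assoc H H H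
          (tensor_map (tensor_product H H) H (comult H) (\<lambda>a. a) (comult H x)) =
        tensor_map H (tensor_product H H) (\<lambda>a. a) (comult H) (comult H x)"
    and counit_left: "x \<in> carrier H \<Longrightarrow> tensor_lift H (\<lambda>a b. counit H a \<odot> b) (comult H x) = x"
    and counit_right: "x \<in> carrier H \<Longrightarrow> tensor_lift H (\<lambda>a b. counit H b \<odot> a) (comult H x) = x"
    and comult_mult:
      "\<lbrakk>x \<in> carrier H; y \<in> carrier H\<rbrakk> \<Longrightarrow>
        comult H (x \<otimes> y) = comult H x \<otimes>\<^bsub>tensor_product H H\<^esub> comult H y"
    and comult_one: "comult H \<one> = \<one>\<^bsub>tensor_product H H\<^esub>"
    and counit_mult:
      "\<lbrakk>x \<in> carrier H; y \<in> carrier H\<rbrakk> \<Longrightarrow> counit H (x \<otimes> y) = counit H x * counit H y"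
    and counit_one: "counit H \<one> = 1"
    and antipode_left:
      "x \<in> carrier H \<Longrightarrow>
        tensor_lift H (\<lambda>a b. antipode H a \<otimes> b) (comult H x) = counit H x \<odot> \<one>"
    and antipode_right:
      "x \<in> carrier H \<Longrightarrow>
        tensor_lift H (\<lambda>a b. a \<otimes> antipode H b) (comult H x) = counit H x \<odot> \<one>"

definition hopf_iso :: "('h, 'm) hopf_scheme \<Rightarrow> ('l, 'n) hopf_scheme \<Rightarrow> ('h \<Rightarrow> 'l) set" where
  "hopf_iso H L = {\<phi> \<in> ring_iso H L \<inter> linear_maps H L. \<forall>x\<in>carrier H.
    comult L (\<phi> x) = tensor_map L L \<phi> \<phi> (comult H x) \<and>
    counit L (\<phi> x) = counit H x \<and>
    antipode L (\<phi> x) = \<phi> (antipode H x)}"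

definition hopf_ideal :: "'h set \<Rightarrow> ('h, 'm) hopf_scheme \<Rightarrow> bool" where
  "hopf_ideal I H \<longleftrightarrow>
    ideal I H \<and>
    (\<forall>c. \<forall>x\<in>I. c \<odot>\<^bsub>H\<^esub> x \<in> I) \<and>
    comult H ` I \<subseteq> tensor_subspace H H (carrier H) I
                     <+>\<^bsub>tensor_product H H\<^esub> tensor_subspace H H I (carrier H) \<and>
    counit H ` I \<subseteq> {0} \<and>
    antipode H ` I \<subseteq> I"

definition quotient_algebra ::
  "(complex, 'h, 'm) module_scheme \<Rightarrow> 'h set \<Rightarrow> (complex, 'h set) module" where
  "quotient_algebra A I =
    ring.extend (A Quot I) (module.fields (\<lambda>c X. \<Union>x\<in>X. I +>\<^bsub>A\<^esub> (c \<odot>\<^bsub>A\<^esub> x)))"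

text \<open>For a Hopf ideal \<open>I\<close> the structure maps below do not depend on the representative chosen
  in the coset \<open>X\<close>.\<close>

definition quotient_hopf :: "('h, 'm) hopf_scheme \<Rightarrow> 'h set \<Rightarrow> 'h set hopf" where
  "quotient_hopf H I =
    module.extend (quotient_algebra H I) (hopf.fields
      (\<lambda>X. tensor_map (quotient_algebra H I) (quotient_algebra H I)
             (\<lambda>a. I +>\<^bsub>H\<^esub> a) (\<lambda>a. I +>\<^bsub>H\<^esub> a) (comult H (SOME x. x \<in> X)))
      (\<lambda>X. counit H (SOME x. x \<in> X))
      (\<lambda>X. I +>\<^bsub>H\<^esub> antipode H (SOME x. x \<in> X)))"

text \<open>The group algebra is the free vector space on the group.\<close>

definition group_ring :: "('g, 'm) monoid_scheme \<Rightarrow> (complex, 'g \<Rightarrow>\<^sub>0 complex) module" where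
  "group_ring G =
    \<lparr>carrier = {f. Poly_Mapping.keys f \<subseteq> carrier G},
     monoid.mult = (\<lambda>f g. \<Sum>x\<in>Poly_Mapping.keys f. \<Sum>y\<in>Poly_Mapping.keys g.
       Poly_Mapping.single (x \<otimes>\<^bsub>G\<^esub> y) (Poly_Mapping.lookup f x * Poly_Mapping.lookup g y)),
     one = Poly_Mapping.single \<one>\<^bsub>G\<^esub> 1,
     zero = 0,
     add = (+),
     smult = free_scale\<rparr>"

definition group_algebra :: "('g, 'm) monoid_scheme \<Rightarrow> ('g \<Rightarrow>\<^sub>0 complex) hopf" where
  "group_algebra G =
    module.extend (group_ring G) (hopf.fields
      (\<lambda>f. tensor_class (group_ring G) (group_ring G)
        (\<Sum>x\<in>Poly_Mapping.keys f.
          Poly_Mapping.single (Poly_Mapping.single x 1, Poly_Mapping.single x 1) (Poly_Mapping.lookup f x)))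
      (\<lambda>f. \<Sum>x\<in>Poly_Mapping.keys f. Poly_Mapping.lookup f x)
      (\<lambda>f. \<Sum>x\<in>Poly_Mapping.keys f. Poly_Mapping.single (inv\<^bsub>G\<^esub> x) (Poly_Mapping.lookup f x)))"

text \<open>Every finite group has a copy with carrier a set of natural numbers, so the type of
  \<open>G\<close> is no restriction.\<close>

definition is_group_algebra :: "('h, 'm) hopf_scheme \<Rightarrow> bool" where
  "is_group_algebra H \<longleftrightarrow>
    (\<exists>G :: nat monoid. group G \<and> finite (carrier G) \<and> hopf_iso H (group_algebra G) \<noteq> {})"

section \<open>Representations\<close>

locale algebra_rep = A: complex_algebra A + vector_space scale
  for A :: "(complex, 'h, 'm) module_scheme" (structure)
    and scale :: "complex \<Rightarrow> 'v :: ab_group_add \<Rightarrow> 'v" +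
  fixes act :: "'h \<Rightarrow> 'v \<Rightarrow> 'v"
  assumes act_linear: "h \<in> carrier A \<Longrightarrow> Vector_Spaces.linear scale scale (act h)"
    and act_add: "\<lbrakk>h \<in> carrier A; k \<in> carrier A\<rbrakk> \<Longrightarrow> act (h \<oplus> k) v = act h v + act k v"
    and act_smult: "h \<in> carrier A \<Longrightarrow> act (c \<odot> h) v = scale c (act h v)"
    and act_mult: "\<lbrakk>h \<in> carrier A; k \<in> carrier A\<rbrakk> \<Longrightarrow> act (h \<otimes> k) v = act h (act k v)"
    and act_one: "act \<one> v = v"
begin

definition kernel :: "'h set" where
  "kernel = {h \<in> carrier A. \<forall>v. act h v = 0}"

definition invariant_subspace :: "'v set \<Rightarrow> bool" where
  "invariant_subspace W \<longleftrightarrow> subspace W \<and> (\<forall>h\<in>carrier A. \<forall>w\<in>W. act h w \<in> W)"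

definition simple_submodule :: "'v set \<Rightarrow> bool" where
  "simple_submodule W \<longleftrightarrow> invariant_subspace W \<and> W \<noteq> {0} \<and>
    (\<forall>U. invariant_subspace U \<and> U \<subseteq> W \<longrightarrow> U = {0} \<or> U = W)"

text \<open>The module is the sum of its simple submodules.\<close>

definition semisimple :: bool where
  "semisimple \<longleftrightarrow> span (\<Union>{W. simple_submodule W}) = UNIV"

end

section \<open>Vertex operator algebras\<close>

text \<open>
  \<open>Y u n v\<close> is \<open>u\<^sub>n v\<close>, \<open>V n\<close> is the homogeneous subspace of weight \<open>n\<close>, and
  \<open>L(n) = \<omega>\<^sub>n\<^sub>+\<^sub>1\<close>.

  The assumption \<open>jacobi\<close> is the coefficient of
  \<open>z\<^sub>0^(-l-1) z\<^sub>1^(-m-1) z\<^sub>2^(-n-1)\<close> in the Jacobi identity applied to \<open>w\<close>. Binomials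
  are expanded in nonnegative powers of the second summand: \<open>(z\<^sub>1 - z\<^sub>2)^l\<close> in powers of
  \<open>z\<^sub>2\<close>, \<open>(-z\<^sub>2 + z\<^sub>1)^l\<close> in powers of \<open>z\<^sub>1\<close>, and \<open>(z\<^sub>2 + z\<^sub>0)^m\<close> in powers
  of \<open>z\<^sub>0\<close>. By \<open>truncation\<close> only finitely many terms of each sum are nonzero, so
  \<open>Sum_any\<close> is the actual sum.
\<close>

locale vertex_operator_algebra = vector_space scale
  for scale :: "complex \<Rightarrow> 'v :: ab_group_add \<Rightarrow> 'v" +
  fixes Y :: "'v \<Rightarrow> int \<Rightarrow> 'v \<Rightarrow> 'v"
    and vac :: 'v
    and \<omega> :: 'v
    and V :: "int \<Rightarrow> 'v set"
  assumes Y_linear: "Vector_Spaces.linear scale scale (Y u n)"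
    and Y_linear_left: "Vector_Spaces.linear scale scale (\<lambda>u. Y u n v)"
    and weight_space: "V n = {v. Y \<omega> 1 v = scale (of_int n) v}"
    and grading: "\<exists>!f. (\<forall>n. f n \<in> V n) \<and> finite {n. f n \<noteq> 0} \<and> v = (\<Sum>n | f n \<noteq> 0. f n)"
    and weight_space_finite_dim: "\<exists>B. finite B \<and> span B = V n"
    and weight_space_bounded: "\<exists>N. \<forall>n<N. V n = {0}"
    and vac_weight: "vac \<in> V 0"
    and omega_weight: "\<omega> \<in> V 2"
    and truncation: "\<exists>N. \<forall>n\<ge>N. Y u n v = 0"
    and vacuum: "Y vac n v = (if n = -1 then v else 0)"
    and creation: "Y v (-1) vac = v" "n \<ge> 0 \<Longrightarrow> Y v n vac = 0"
    and translation: "Y (Y \<omega> 0 v) n w = scale (- of_int n) (Y v (n - 1) w)"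
    and virasoro:
      "\<exists>c. \<forall>m n v. Y \<omega> (n + 1) (Y \<omega> (m + 1) v) - Y \<omega> (m + 1) (Y \<omega> (n + 1) v) =
        scale (of_int (n - m)) (Y \<omega> (n + m + 1) v) +
        (if n + m = 0 then scale ((of_int n ^ 3 - of_int n) / 12 * c) v else 0)"
    and jacobi:
      "Sum_any (\<lambda>i. scale ((-1) ^ i * (of_int l gchoose i)) (Y u (m + l - int i) (Y v (n + int i) w)))
       - Sum_any (\<lambda>i. scale ((-1) powi (l - int i) * (of_int l gchoose i))
           (Y v (n + l - int i) (Y u (m + int i) w)))
       = Sum_any (\<lambda>i. scale (of_int m gchoose i) (Y (Y u (l + int i) v) (m + n - int i) w))"
begin

definition voa_ideal :: "'v set \<Rightarrow> bool" where
  "voa_ideal I \<longleftrightarrow> subspace I \<and> (\<forall>v n. \<forall>u\<in>I. Y v n u \<in> I \<and> Y u n v \<in> I)"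

definition simple :: bool where
  "simple \<longleftrightarrow> (UNIV :: 'v set) \<noteq> {0} \<and> (\<forall>I. voa_ideal I \<longrightarrow> I = {0} \<or> I = UNIV)"

end

text \<open>In \<open>act_Y\<close>, \<open>f\<close> runs over the ways of writing \<open>comult H h\<close> as a finite sum of pure
  tensors \<open>h\<^sub>1 \<otimes> h\<^sub>2\<close> (Sweedler notation).\<close>

locale hopf_module_voa =
  algebra_rep H scale act + H: hopf_algebra H + vertex_operator_algebra scale Y vac \<omega> V
  for H :: "('h, 'm) hopf_scheme"
    and scale :: "complex \<Rightarrow> 'v :: ab_group_add \<Rightarrow> 'v" and act Y vac \<omega> V +
  assumes act_omega: "h \<in> carrier H \<Longrightarrow> act h \<omega> = scale (counit H h) \<omega>"
    and act_Y:
      "\<lbrakk>h \<in> carrier H; f \<in> comult H h\<rbrakk> \<Longrightarrow>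
        act h (Y u n v) =
        (\<Sum>p\<in>Poly_Mapping.keys f. scale (Poly_Mapping.lookup f p) (Y (act (fst p) u) n (act (snd p) v)))"

end

theory Submission
  imports Defs "HOL-Library.Function_Algebras" "HOL-Computational_Algebra.Fundamental_Theorem_Algebra"
begin

text \<open>
  In a simple vertex operator algebra the map \<open>u \<otimes> v \<mapsto> Y(u, z) v\<close> is injective on \<open>V \<otimes> V\<close>. So every
  property of the operators \<open>Y(u, z) v\<close> is reflected in the comultiplication of \<open>H\<close> modulo the kernel
  \<open>K\<close>: since \<open>h \<in> K\<close> acts as zero, \<open>\<Delta>(K)\<close> vanishes in \<open>H/K \<otimes> H/K\<close>, and skew symmetry makes \<open>H/K\<close>
  cocommutative. A finite dimensional cocommutative bialgebra over the complex numbers whose grouplike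
  elements are cancellable (here they act as endomorphisms of \<open>V\<close>, injective since \<open>V\<close> is simple) is
  spanned by these: otherwise the dual algebra, which acts by commuting
  operators, has a common eigenvector modulo the span of the grouplikes; translated by a grouplike
  and corrected by a combination of grouplikes it becomes primitive, and the powers of a nonzero
  primitive element are linearly independent in characteristic 0. Finally \<open>g \<mapsto> g\<inverse>\<close> and the antipode
  are convolution inverses of the same map, so \<open>S(K) \<subseteq> K\<close>.

  The quotient \<open>H/K\<close> is handled as the space of operators \<open>act h\<close>.
\<close>

section \<open>Linear algebra\<close>

text \<open>A priori \<open>K\<close> is only an ideal, so neither a comultiplication nor an
  antipode on \<open>H/K\<close> may be presupposed. The comultiplication therefore enters only
  through the sums of \<open>l(h\<^sub>1) k(h\<^sub>2)\<close> for functionals \<open>l\<close>,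
  \<open>k\<close> on the operators; the injectivity shows that these numbers depend on the operator
  of \<open>h\<close> alone. Two usual consequences of a Hopf structure have to be obtained
  differently. The counit descends because the vacuum satisfies
  \<open>h vac = \<epsilon>(h) vac\<close>; this is not an axiom but follows from the injectivity
  together with the antipode of \<open>H\<close> itself. Grouplikes become invertible because they
  form a finite cancellative monoid. The injectivity rests on Schur's lemma, whose eigenvalue is
  found in the finite dimensional weight space of the vacuum. Characteristic 0 is used through a
  functional \<open>f\<close> with \<open>f(p) = 1\<close> and \<open>f(1) = 0\<close> for a
  primitive \<open>p\<close>: it acts like differentiation with respect to \<open>p\<close>, sending
  the power \<open>n + 1\<close> to \<open>n + 1\<close> times the power \<open>n\<close>, up to
  lower powers.\<close>

abbreviation "single \<equiv> Poly_Mapping.single"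
abbreviation "keys \<equiv> Poly_Mapping.keys"
abbreviation "lookup \<equiv> Poly_Mapping.lookup"

lemma vector_space_mult: "vector_space ((*) :: 'a :: field \<Rightarrow> 'a \<Rightarrow> 'a)"
  by unfold_locales (auto simp: algebra_simps)

locale complex_vector_space = vector_space scale for scale :: "complex \<Rightarrow> 'b :: ab_group_add \<Rightarrow> 'b"
begin

abbreviation functional :: "('b \<Rightarrow> complex) \<Rightarrow> bool" where "functional \<equiv> Vector_Spaces.linear scale (*)"

lemma exists_functional:
  assumes "subspace W" "v \<notin> W"
  shows "\<exists>\<phi>. functional \<phi> \<and> \<phi> v = 1 \<and> (\<forall>w\<in>W. \<phi> w = 0)"
proof -
  interpret p: vector_space_pair scale "(*) :: complex \<Rightarrow> complex \<Rightarrow> complex"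
    by (intro vector_space_pair.intro vector_space_axioms vector_space_mult)
  obtain C where C: "C \<subseteq> W" "independent C" "W \<subseteq> span C"
    by (rule basis_exists[of W])
  have "span C = W"
    using C assms(1) by (metis span_minimal subset_antisym)
  then have "independent (insert v C)"
    using C assms(2) by (intro independent_insertI) auto
  then obtain g where g: "functional g" "\<forall>x\<in>insert v C. g x = (if x = v then 1 else 0)"
    using p.linear_independent_extend[of "insert v C" "\<lambda>x. if x = v then 1 else 0"] by blast
  interpret g: Vector_Spaces.linear scale "(*)" g by (fact g(1))
  have "g w = 0" if "w \<in> W" for w
  proof -
    have "g x = 0" if "x \<in> C" for x using g(2) that C(1) assms(2) by (metis insertCI subsetD)
    moreover have "w \<in> span C" using that C(3) by blast
    ultimately show ?thesis using p.linear_eq_0_on_span[OF g(1)] by blast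
  qed
  with g show ?thesis by (intro exI[of _ g]) auto
qed

lemma exists_dual_basis:
  assumes "independent C" "finite C"
  shows "\<exists>\<kappa>. (\<forall>x. functional (\<kappa> x)) \<and> (\<forall>x. \<forall>y\<in>C. \<kappa> x y = (if y = x then 1 else 0)) \<and>
    (\<forall>b\<in>span C. b = (\<Sum>x\<in>C. scale (\<kappa> x b) x))"
proof -
  interpret p: vector_space_pair scale "(*) :: complex \<Rightarrow> complex \<Rightarrow> complex"
    by (intro vector_space_pair.intro vector_space_axioms vector_space_mult)
  have "\<forall>x. \<exists>g. functional g \<and> (\<forall>y\<in>C. g y = (if y = x then 1 else 0))"
    using p.linear_independent_extend[OF assms(1), of "\<lambda>y. if y = x then 1 else 0" for x] by blast
  then obtain \<kappa> where \<kappa>: "\<And>x. functional (\<kappa> x)" "\<And>x y. y \<in> C \<Longrightarrow> \<kappa> x y = (if y = x then 1 else 0)"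
    by metis
  have "b = (\<Sum>x\<in>C. scale (\<kappa> x b) x)" if "b \<in> span C" for b
  proof -
    obtain c where c: "b = (\<Sum>x\<in>C. scale (c x) x)"
      using \<open>b \<in> span C\<close> assms(2) by (auto simp: span_finite)
    have "\<kappa> x b = c x" if "x \<in> C" for x
    proof -
      interpret k: Vector_Spaces.linear scale "(*)" "\<kappa> x" by (rule \<kappa>)
      show ?thesis using that assms(2) \<kappa>(2)
        by (simp add: c k.sum k.scale if_distrib[of "\<lambda>x. _ * x"] cong: if_cong)
    qed
    then show ?thesis using c by simp
  qed
  then show ?thesis using \<kappa> by blast
qed

lemma eq_0_if_functionals_0:
  assumes "\<And>\<phi>. functional \<phi> \<Longrightarrow> \<phi> v = 0"
  shows "v = 0"
  using exists_functional[of "{0}" v] assms subspace_single_0 by fastforce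

lemma finite_independent_in_span:
  assumes "finite S" "A \<subseteq> span S" "independent C" "C \<subseteq> A"
  shows "finite C"
  using assms independent_span_bound[of S C] by auto

lemma dim_less_if_psubset:
  assumes "subspace U'" "U' \<subset> U" "finite S" "U \<subseteq> span S"
  shows "dim U' < dim U"
proof -
  obtain C' where C': "C' \<subseteq> U'" "independent C'" "U' \<subseteq> span C'" "card C' = dim U'"
    by (rule basis_exists[of U'])
  obtain C where C: "C \<subseteq> U" "independent C" "U \<subseteq> span C" "card C = dim U"
    by (rule basis_exists[of U])
  obtain u where u: "u \<in> U" "u \<notin> U'" using assms(2) by blast
  have "span C' \<subseteq> U'" using C'(1) assms(1) by (rule span_minimal)
  then have nin: "u \<notin> span C'" using u by blast
  then have "independent (insert u C')" using C' by (intro independent_insertI)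
  moreover have "insert u C' \<subseteq> span C" using C' C u assms by blast
  moreover have fin: "finite C" "finite C'"
    using finite_independent_in_span[OF assms(3,4)] C C' assms(2) by auto
  ultimately have "card (insert u C') \<le> card C"
    using independent_span_bound by blast
  moreover have "u \<notin> C'" using nin span_superset by blast
  ultimately show ?thesis using C C' fin by simp
qed

text \<open>The least degree of a polynomial \<open>p\<close> with \<open>p(T) u \<in> W\<close> is positive; dividing \<open>p\<close> by one of
  its linear factors gives an eigenvector modulo \<open>W\<close>.\<close>

lemma eigenvector_mod:
  assumes U: "subspace U" "finite S" "U \<subseteq> span S" and W: "subspace W"
    and u0: "u0 \<in> U" "u0 \<notin> W"
    and T: "\<And>x. x \<in> U \<Longrightarrow> T x \<in> U" "\<And>x y. x \<in> U \<Longrightarrow> y \<in> U \<Longrightarrow> T (x + y) = T x + T y"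
      "\<And>c x. x \<in> U \<Longrightarrow> T (scale c x) = scale c (T x)"
  shows "\<exists>c. \<exists>u\<in>U. u \<notin> W \<and> T u - scale c u \<in> W"
proof -
  \<comment> \<open>Horner's scheme for \<open>p(T) u0\<close>. Polynomials in \<open>T\<close> are
    not formed as operators, since \<open>T\<close> is linear on \<open>U\<close> only.\<close>
  define P where "P p = fold_coeffs (\<lambda>a r. scale a u0 + T r) p 0" for p :: "complex poly"
  have T0: "T 0 = 0" using T(3)[of u0 0] u0 by simp
  have P0 [simp]: "P 0 = 0" by (simp add: P_def)
  have P_pCons: "P (pCons a p) = scale a u0 + T (P p)" for a p
    by (cases "p = 0 \<and> a = 0") (auto simp: P_def T0)
  have PU: "P p \<in> U" for p
    by (induction p) (use U u0 T in \<open>auto simp: P_pCons subspace_0 subspace_add subspace_scale\<close>)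
  have P_add: "P (p + q) = P p + P q" for p q
  proof (induction p arbitrary: q)
    case (pCons a p)
    then show ?case
      by (cases q) (auto simp: P_pCons T PU scale_left_distrib)
  qed simp
  have P_smult: "P (smult c p) = scale c (P p)" for c p
    by (induction p) (auto simp: P_pCons T PU scale_right_distrib)
  have P_sum: "P (sum f A) = (\<Sum>i\<in>A. P (f i))" for f :: "nat \<Rightarrow> _" and A
    by (induction A rule: infinite_finite_induct) (auto simp: P_add)
  have ex: "\<exists>p. p \<noteq> 0 \<and> P p \<in> W"
  \<comment> \<open>If two of the iterates of \<open>u0\<close> under \<open>T\<close> coincide, the
    difference of the two monomials will do. Otherwise the iterates form an infinite subset of a
    finite dimensional space, and a linear dependence gives the polynomial.\<close>
  proof (cases "inj (\<lambda>i. P (monom 1 i))")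
    case False
    then obtain i j where "i \<noteq> j" "P (monom 1 i) = P (monom 1 j)" by (auto simp: inj_def)
    then have "P (monom 1 i + smult (-1) (monom 1 j)) = 0"
      unfolding P_add P_smult by simp
    moreover have "monom 1 i + smult (-1) (monom 1 j) \<noteq> (0 :: complex poly)"
      using \<open>i \<noteq> j\<close> by (auto simp: poly_eq_iff intro!: exI[of _ i])
    ultimately show ?thesis using W subspace_0 by metis
  next
    case True
    then have "infinite (range (\<lambda>i. P (monom 1 i)))"
      using finite_imageD infinite_UNIV_nat by blast
    then have "dependent (range (\<lambda>i. P (monom 1 i)))"
      using finite_independent_in_span[OF U(2,3)] PU by blast
    then obtain t c where t: "finite t" "t \<subseteq> range (\<lambda>i. P (monom 1 i))"
      "(\<Sum>v\<in>t. scale (c v) v) = 0" "\<exists>v\<in>t. c v \<noteq> 0"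
      unfolding dependent_explicit by blast
    define I where "I = (\<lambda>i. P (monom 1 i)) -` t"
    have tI: "t = (\<lambda>i. P (monom 1 i)) ` I" using t(2) by (auto simp: I_def)
    have finI: "finite I" unfolding I_def using t(1) True by (rule finite_vimageI)
    let ?p = "\<Sum>i\<in>I. smult (c (P (monom 1 i))) (monom 1 i)"
    have "P ?p = (\<Sum>v\<in>t. scale (c v) v)"
      unfolding P_sum tI using True by (subst sum.reindex) (auto simp: P_smult inj_on_def inj_def)
    moreover obtain i where "i \<in> I" "c (P (monom 1 i)) \<noteq> 0"
      using t(4) tI by auto
    then have "coeff ?p i \<noteq> 0" using finI by (simp add: coeff_sum if_distrib[of "\<lambda>x. _ * x"] cong: if_cong)
    then have "?p \<noteq> 0" by (metis coeff_0)
    ultimately show ?thesis using t(3) W subspace_0 by metis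
  qed
  define p where "p = arg_min degree (\<lambda>p. p \<noteq> 0 \<and> P p \<in> W)"
  have p: "p \<noteq> 0" "P p \<in> W" and min: "\<And>q. q \<noteq> 0 \<Longrightarrow> P q \<in> W \<Longrightarrow> degree p \<le> degree q"
    using arg_min_nat_lemma[of "\<lambda>p. p \<noteq> 0 \<and> P p \<in> W" _ degree] ex unfolding p_def by blast+
  have "degree p \<noteq> 0"
  proof
    assume "degree p = 0"
    then obtain a where a: "p = [:a:]" by (metis degree_eq_zeroE)
    then have "scale a u0 \<in> W" "a \<noteq> 0" using p by (auto simp: P_pCons T0)
    then have "scale (1/a) (scale a u0) \<in> W" using W subspace_scale by blast
    then show False using u0 \<open>a \<noteq> 0\<close> by simp
  qed
  then have "\<not> constant (poly p)" by (simp add: constant_degree)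
  then obtain z where "poly p z = 0" using fundamental_theorem_of_algebra by blast
  then obtain q where q: "p = [:-z, 1:] * q" using poly_eq_0_iff_dvd by (metis dvdE)
  then have "q \<noteq> 0" using p by auto
  then have "degree p = Suc (degree q)" unfolding q by (subst degree_mult_eq) auto
  then have "P q \<notin> W" using min[of q] \<open>q \<noteq> 0\<close> by auto
  moreover have "P p = T (P q) - scale z (P q)"
  proof -
    have "p = pCons 0 q + smult (-z) q" unfolding q by simp
    then show ?thesis by (simp only: P_add P_smult P_pCons) simp
  qed
  ultimately show ?thesis using p PU by metis
qed

text \<open>By induction on \<open>dim U\<close>: if every \<open>T f\<close> is scalar modulo
  \<open>W\<close> on all of \<open>U\<close>, any vector outside \<open>W\<close> will do.
  Otherwise some \<open>T f\<close> is not, and its eigenspace modulo \<open>W\<close> for one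
  eigenvalue is a smaller subspace, which still properly contains \<open>W\<close> and is stable
  under the whole family by commutativity.\<close>

lemma common_eigenvector_mod:
  assumes U: "subspace U" "finite S" "U \<subseteq> span S" and W: "subspace W" "W \<subset> U"
    and T: "\<And>f x. f \<in> F \<Longrightarrow> x \<in> U \<Longrightarrow> T f x \<in> U"
      "\<And>f x. f \<in> F \<Longrightarrow> x \<in> W \<Longrightarrow> T f x \<in> W"
      "\<And>f x y. f \<in> F \<Longrightarrow> x \<in> U \<Longrightarrow> y \<in> U \<Longrightarrow> T f (x + y) = T f x + T f y"
      "\<And>f c x. f \<in> F \<Longrightarrow> x \<in> U \<Longrightarrow> T f (scale c x) = scale c (T f x)"
      "\<And>f g x. f \<in> F \<Longrightarrow> g \<in> F \<Longrightarrow> x \<in> U \<Longrightarrow> T f (T g x) = T g (T f x)"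
  shows "\<exists>u\<in>U. u \<notin> W \<and> (\<forall>f\<in>F. \<exists>c. T f u - scale c u \<in> W)"
  using U(1,3) W(2) T
proof (induction "dim U" arbitrary: U rule: less_induct)
  case less
  note T = less.prems(4-8)
  have T_diff: "T f (x - y) = T f x - T f y" if "f \<in> F" "x \<in> U" "y \<in> U" for f x y
    using T(3)[of f x "scale (-1) y"] T(4)[of f y "-1"] that less.prems(1)
    by (simp add: subspace_neg)
  show ?case
  proof (cases "\<forall>f\<in>F. \<exists>c. \<forall>u\<in>U. T f u - scale c u \<in> W")
    case True
    then show ?thesis using less.prems(3) by blast
  next
    case False
    then obtain f where f: "f \<in> F" "\<And>c. \<exists>u\<in>U. T f u - scale c u \<notin> W" by blast
    obtain u0 where u0: "u0 \<in> U" "u0 \<notin> W" using less.prems(3) by blast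
    have "\<exists>c. \<exists>u\<in>U. u \<notin> W \<and> T f u - scale c u \<in> W"
      by (rule eigenvector_mod[OF less.prems(1) U(2) less.prems(2) W(1) u0]) (use f T in auto)
    then obtain c u where u: "u \<in> U" "u \<notin> W" "T f u - scale c u \<in> W" by blast
    define U' where "U' = {u \<in> U. T f u - scale c u \<in> W}"
    have WU: "x \<in> U" if "x \<in> W" for x using that less.prems(3) by blast
    have T0: "T f 0 = 0" using T(4)[of f u 0] f u by simp
    have sub: "subspace U'"
    proof (rule subspaceI)
      show "0 \<in> U'" using less.prems(1) W(1) by (simp add: U'_def subspace_0 T0)
      show "x + y \<in> U'" if "x \<in> U'" "y \<in> U'" for x y
      proof -
        have "T f (x + y) - scale c (x + y) = (T f x - scale c x) + (T f y - scale c y)"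
          using that f T(3) by (simp add: U'_def scale_right_distrib)
        then show ?thesis using that less.prems(1) W(1) by (simp add: U'_def subspace_add)
      qed
      show "scale a x \<in> U'" if "x \<in> U'" for a x
      proof -
        have "T f (scale a x) - scale c (scale a x) = scale a (T f x - scale c x)"
          using that f T(4) by (simp add: U'_def scale_right_diff_distrib mult.commute)
        then show ?thesis using that less.prems(1) W(1) by (simp add: U'_def subspace_scale)
      qed
    qed
    have psub: "U' \<subset> U" using f(2)[of c] unfolding U'_def by blast
    have stab: "T g x \<in> U'" if g: "g \<in> F" and x: "x \<in> U'" for g x
    proof -
      have xU: "x \<in> U" using x by (simp add: U'_def)
      have "T f (T g x) - scale c (T g x) = T g (T f x - scale c x)"
        using f g xU T less.prems(1) by (simp add: T_diff subspace_scale)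
      then show ?thesis using x g xU T(1,2) by (simp add: U'_def)
    qed
    have WU': "W \<subset> U'"
    proof -
      have "x \<in> U'" if "x \<in> W" for x
        using that WU T(2)[OF f(1) that] W(1) by (simp add: U'_def subspace_diff subspace_scale)
      moreover have "u \<in> U'" using u by (simp add: U'_def)
      ultimately show ?thesis using u by blast
    qed
    have U'U: "x \<in> U" if "x \<in> U'" for x using that psub by blast
    have "U' \<subseteq> span S" using psub less.prems(2) by blast
    then have "\<exists>u\<in>U'. u \<notin> W \<and> (\<forall>f\<in>F. \<exists>c. T f u - scale c u \<in> W)"
      using U'U stab T
      by (intro less.hyps dim_less_if_psubset[OF sub psub U(2) less.prems(2)] sub WU') simp_all
    then show ?thesis using psub by blast
  qed
qed

end

section \<open>Finite dimensional cocommutative bialgebras\<close>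

text \<open>Linearity is demanded on \<open>B\<close> only: functionals such as
  \<open>z \<mapsto> f (a \<bullet> z)\<close> or \<open>b \<mapsto> l (R f b)\<close> are not known
  to be linear elsewhere.\<close>

definition functionals_on :: "(complex \<Rightarrow> 'b \<Rightarrow> 'b) \<Rightarrow> 'b set \<Rightarrow> ('b :: ab_group_add \<Rightarrow> complex) set" where
  "functionals_on scale B =
    {f. (\<forall>x\<in>B. \<forall>y\<in>B. f (x + y) = f x + f y) \<and> (\<forall>c. \<forall>x\<in>B. f (scale c x) = c * f x)}"

lemma functionals_on_linear:
  assumes "Vector_Spaces.linear scale (*) f"
  shows "f \<in> functionals_on scale B"
proof -
  interpret Vector_Spaces.linear scale "(*)" f by fact
  show ?thesis by (simp add: functionals_on_def add scale)
qed

lemma functionals_on_add: "\<lbrakk>f \<in> functionals_on scale B; x \<in> B; y \<in> B\<rbrakk> \<Longrightarrow> f (x + y) = f x + f y"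
  and functionals_on_scale: "\<lbrakk>f \<in> functionals_on scale B; x \<in> B\<rbrakk> \<Longrightarrow> f (scale c x) = c * f x"
  by (auto simp: functionals_on_def)

context complex_vector_space begin

lemma functionals_on_0: "\<lbrakk>subspace B; f \<in> functionals_on scale B\<rbrakk> \<Longrightarrow> f 0 = 0"
  using functionals_on_scale[of f scale B 0 0] subspace_0 by simp

lemma functionals_on_sum:
  assumes B: "subspace B" and f: "f \<in> functionals_on scale B" and x: "\<And>i. i \<in> I \<Longrightarrow> x i \<in> B"
  shows "f (\<Sum>i\<in>I. scale (c i) (x i)) = (\<Sum>i\<in>I. c i * f (x i))"
  using x
proof (induction I rule: infinite_finite_induct)
  case (insert i I)
  then have "(\<Sum>i\<in>I. scale (c i) (x i)) \<in> B" "scale (c i) (x i) \<in> B"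
    using B by (auto intro!: subspace_sum subspace_scale)
  then show ?case using insert f by (simp add: functionals_on_def)
qed (simp_all add: functionals_on_0[OF B f])

lemma eq_if_functionals_on_eq:
  assumes "\<And>f. f \<in> functionals_on scale B \<Longrightarrow> f x = f y"
  shows "x = y"
proof -
  have "x - y = 0"
  proof (rule eq_0_if_functionals_0)
    fix f assume f: "functional f"
    then interpret f: Vector_Spaces.linear scale "(*)" f .
    show "f (x - y) = 0" using assms[OF functionals_on_linear[OF f]] by (simp add: f.diff)
  qed
  then show ?thesis by simp
qed

end

text \<open>\<open>R f b\<close> stands for \<open>\<Sum> f (b\<^sub>2) b\<^sub>1\<close>, the action of the dual algebra on \<open>B\<close>.\<close>

locale cocommutative_bialgebra = complex_vector_space scale
  for scale :: "complex \<Rightarrow> 'b :: ab_group_add \<Rightarrow> 'b" +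
  fixes B :: "'b set" and mul :: "'b \<Rightarrow> 'b \<Rightarrow> 'b" (infixl \<open>\<bullet>\<close> 70) and one :: 'b
    and R :: "('b \<Rightarrow> complex) \<Rightarrow> 'b \<Rightarrow> 'b" and e :: "'b \<Rightarrow> complex"
  assumes subspace_B: "subspace B"
    and finite_dim_B: "\<exists>S. finite S \<and> B \<subseteq> span S"
    and one_in: "one \<in> B"
    and one_neq_0: "one \<noteq> 0"
    and mul_in: "\<lbrakk>x \<in> B; y \<in> B\<rbrakk> \<Longrightarrow> x \<bullet> y \<in> B"
    and mul_assoc: "\<lbrakk>x \<in> B; y \<in> B; z \<in> B\<rbrakk> \<Longrightarrow> x \<bullet> y \<bullet> z = x \<bullet> (y \<bullet> z)"
    and mul_one_left: "x \<in> B \<Longrightarrow> one \<bullet> x = x"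
    and mul_one_right: "x \<in> B \<Longrightarrow> x \<bullet> one = x"
    and mul_add_right: "\<lbrakk>x \<in> B; y \<in> B; z \<in> B\<rbrakk> \<Longrightarrow> x \<bullet> (y + z) = x \<bullet> y + x \<bullet> z"
    and mul_scale_left: "\<lbrakk>x \<in> B; y \<in> B\<rbrakk> \<Longrightarrow> scale c x \<bullet> y = scale c (x \<bullet> y)"
    and mul_scale_right: "\<lbrakk>x \<in> B; y \<in> B\<rbrakk> \<Longrightarrow> x \<bullet> scale c y = scale c (x \<bullet> y)"
    and R_in: "\<lbrakk>f \<in> functionals_on scale B; x \<in> B\<rbrakk> \<Longrightarrow> R f x \<in> B"
    and R_add: "\<lbrakk>f \<in> functionals_on scale B; x \<in> B; y \<in> B\<rbrakk> \<Longrightarrow> R f (x + y) = R f x + R f y"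
    and R_scale: "\<lbrakk>f \<in> functionals_on scale B; x \<in> B\<rbrakk> \<Longrightarrow> R f (scale c x) = scale c (R f x)"
    \<comment> \<open>\<open>f (R g x)\<close> is the sum of
      \<open>f(x\<^sub>1) g(x\<^sub>2)\<close>, so this is cocommutativity; combined with
      coassociativity it gives \<open>R_comm\<close>.\<close>
    and R_swap: "\<lbrakk>f \<in> functionals_on scale B; g \<in> functionals_on scale B; x \<in> B\<rbrakk> \<Longrightarrow>
      f (R g x) = g (R f x)"
    and R_comm: "\<lbrakk>f \<in> functionals_on scale B; g \<in> functionals_on scale B; x \<in> B\<rbrakk> \<Longrightarrow>
      R f (R g x) = R g (R f x)"
    and e_functional: "e \<in> functionals_on scale B"
    and e_one: "e one = 1"
    and R_e: "x \<in> B \<Longrightarrow> R e x = x"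
    and R_one: "f \<in> functionals_on scale B \<Longrightarrow> R f one = scale (f one) one"
    \<comment> \<open>The premise says that
      \<open>\<Delta>(x) = x \<otimes> a + b \<otimes> x\<close>, and the conclusion reads off
      \<open>\<Delta>(x) \<Delta>(y)\<close>. This instance of multiplicativity can be stated
      without tensor products and covers both grouplike and primitive \<open>x\<close>.\<close>
    and R_mul_skew_primitive: "\<lbrakk>a \<in> B; b \<in> B; x \<in> B; y \<in> B; f \<in> functionals_on scale B;
      \<And>k. k \<in> functionals_on scale B \<Longrightarrow> R k x = scale (k a) x + scale (k x) b\<rbrakk> \<Longrightarrow>
      R f (x \<bullet> y) = x \<bullet> R (\<lambda>z. f (a \<bullet> z)) y + b \<bullet> R (\<lambda>z. f (x \<bullet> z)) y"
    \<comment> \<open>Takes the place of an antipode, which would make grouplikes invertible at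
      once.\<close>
    and grouplike_cancel: "\<lbrakk>a \<in> B; a \<noteq> 0; \<And>k. k \<in> functionals_on scale B \<Longrightarrow> R k a = scale (k a) a;
      x \<in> B; y \<in> B; a \<bullet> x = a \<bullet> y\<rbrakk> \<Longrightarrow> x = y"
begin

abbreviation "dual \<equiv> functionals_on scale B"

lemmas dual_add = functionals_on_add[of _ scale B]
  and dual_scale = functionals_on_scale[of _ scale B]
  and dual_zero = functionals_on_0[OF subspace_B]
  and dual_sum = functionals_on_sum[OF subspace_B]
  and dual_separates = eq_if_functionals_on_eq[of B]

lemma dual_mul: "\<lbrakk>f \<in> dual; a \<in> B\<rbrakk> \<Longrightarrow> (\<lambda>z. f (a \<bullet> z)) \<in> dual"
  by (auto simp: functionals_on_def mul_add_right mul_scale_right mul_in)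

lemma zero_in: "0 \<in> B"
  and diff_in: "\<lbrakk>x \<in> B; y \<in> B\<rbrakk> \<Longrightarrow> x - y \<in> B" and scale_in: "x \<in> B \<Longrightarrow> scale c x \<in> B"
  using subspace_B by (auto simp: subspace_0 subspace_add subspace_diff subspace_scale)

lemma sum_in: "(\<And>i. i \<in> I \<Longrightarrow> x i \<in> B) \<Longrightarrow> (\<Sum>i\<in>I. x i) \<in> B"
  using subspace_B by (rule subspace_sum)

lemma R_diff: "\<lbrakk>f \<in> dual; x \<in> B; y \<in> B\<rbrakk> \<Longrightarrow> R f (x - y) = R f x - R f y"
  using R_add[of f x "scale (-1) y"] R_scale[of f y "-1"] scale_in[of y "-1"] by simp

lemma dual_diff: "\<lbrakk>f \<in> dual; x \<in> B; y \<in> B\<rbrakk> \<Longrightarrow> f (x - y) = f x - f y"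
  using dual_add[of f x "scale (-1) y"] dual_scale[of f y "-1"] scale_in[of y "-1"] by simp

lemma R_zero: "f \<in> dual \<Longrightarrow> R f 0 = 0"
  using R_scale[of f one 0] one_in by auto

lemma R_sum: "\<lbrakk>f \<in> dual; \<And>i. i \<in> I \<Longrightarrow> x i \<in> B\<rbrakk> \<Longrightarrow> R f (\<Sum>i\<in>I. scale (c i) (x i)) = (\<Sum>i\<in>I. scale (c i) (R f (x i)))"
  by (induction I rule: infinite_finite_induct) (auto simp: R_zero R_add R_scale scale_in sum_in)

lemma mul_sum_right: "\<lbrakk>y \<in> B; \<And>i. i \<in> I \<Longrightarrow> x i \<in> B\<rbrakk> \<Longrightarrow> y \<bullet> (\<Sum>i\<in>I. scale (c i) (x i)) = (\<Sum>i\<in>I. scale (c i) (y \<bullet> x i))"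
proof -
  assume y: "y \<in> B" and x: "\<And>i. i \<in> I \<Longrightarrow> x i \<in> B"
  have "y \<bullet> 0 = 0" using mul_scale_right[OF y one_in, of 0] by simp
  with x show ?thesis
    by (induction I rule: infinite_finite_induct) (auto simp: mul_add_right mul_scale_right scale_in sum_in y)
qed

lemma e_R: "\<lbrakk>f \<in> dual; x \<in> B\<rbrakk> \<Longrightarrow> e (R f x) = f x"
  using R_swap[OF e_functional] R_e by simp

section \<open>Grouplike elements\<close>

definition grouplikes :: "'b set" where
  "grouplikes = {g \<in> B. g \<noteq> 0 \<and> (\<forall>f\<in>dual. R f g = scale (f g) g)}"

lemma grouplike_in: "g \<in> grouplikes \<Longrightarrow> g \<in> B" by (simp add: grouplikes_def)

lemma grouplike_R: "\<lbrakk>g \<in> grouplikes; f \<in> dual\<rbrakk> \<Longrightarrow> R f g = scale (f g) g"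
  by (simp add: grouplikes_def)

lemma grouplike_e: "g \<in> grouplikes \<Longrightarrow> e g = 1"
  using grouplike_R[OF _ e_functional, of g] R_e[of g] scale_cancel_right[of "e g" g 1]
  by (simp add: grouplikes_def)

lemma one_grouplike: "one \<in> grouplikes"
  by (simp add: grouplikes_def one_in one_neq_0 R_one)

text \<open>The skew primitive rule with \<open>a = x = g\<close> and \<open>b = 0\<close>.\<close>

lemma R_grouplike_mul:
  assumes "g \<in> grouplikes" "y \<in> B" "f \<in> dual"
  shows "R f (g \<bullet> y) = g \<bullet> R (\<lambda>z. f (g \<bullet> z)) y"
proof -
  have "0 \<bullet> z = 0" if "z \<in> B" for z using mul_scale_left[of one z 0] that one_in by simp
  then show ?thesis
    using R_mul_skew_primitive[of g 0 g y f] assms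
    by (simp add: grouplike_in zero_in grouplike_R R_in dual_mul)
qed

lemma grouplike_mul:
  assumes g: "g \<in> grouplikes" and h: "h \<in> grouplikes"
  shows "g \<bullet> h \<in> grouplikes"
proof -
  have "R f (g \<bullet> h) = scale (f (g \<bullet> h)) (g \<bullet> h)" if "f \<in> dual" for f
    using R_grouplike_mul[OF g grouplike_in[OF h] that] grouplike_R[OF h dual_mul[OF that grouplike_in[OF g]]]
    by (simp add: mul_scale_right grouplike_in g h)
  moreover have "g \<bullet> h \<noteq> 0"
  proof
    assume "g \<bullet> h = 0"
    then have "g \<bullet> h = g \<bullet> 0" using mul_scale_right[of g one 0] g by (simp add: one_in grouplike_in)
    then have "h = 0" using g h grouplike_cancel[of g h 0] by (auto simp: grouplikes_def zero_in)
    then show False using h by (simp add: grouplikes_def)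
  qed
  ultimately show ?thesis using g h by (simp add: grouplikes_def mul_in)
qed

text \<open>A maximal independent set \<open>C\<close> of grouplikes contains every grouplike
  \<open>g\<close>: write \<open>g\<close> as the sum of the \<open>c s\<close> times
  \<open>s\<close> and apply \<open>R f\<close>. Comparing coefficients gives
  \<open>c s * (f s - f g) = 0\<close> for all \<open>f\<close>, so an \<open>s\<close> with
  \<open>c s \<noteq> 0\<close> is not separated from \<open>g\<close> by functionals.\<close>

lemma finite_independent_grouplikes: "finite grouplikes \<and> independent grouplikes"
proof -
  obtain C where C: "C \<subseteq> grouplikes" "independent C" "grouplikes \<subseteq> span C"
    by (rule maximal_independent_subset[of grouplikes])
  have finC: "finite C"
  proof -
    obtain S where "finite S" "B \<subseteq> span S" using finite_dim_B by blast
    moreover have "C \<subseteq> B" using C(1) grouplike_in by blast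
    ultimately show ?thesis using C(2) finite_independent_in_span by blast
  qed
  have CB: "s \<in> B" if "s \<in> C" for s using C(1) that grouplike_in by blast
  have "g \<in> C" if g: "g \<in> grouplikes" for g
  proof -
    have "g \<in> span C" using g C by blast
    then obtain c where c: "g = (\<Sum>s\<in>C. scale (c s) s)" using finC by (auto simp: span_finite)
    have "c s * (f s - f g) = 0" if f: "f \<in> dual" and s: "s \<in> C" for f s
    proof -
      have "R f g = (\<Sum>s\<in>C. scale (c s) (scale (f s) s))"
        unfolding c using C(1) by (subst R_sum[OF f CB]) (auto intro!: sum.cong simp: grouplike_R f)
      moreover have "R f g = (\<Sum>s\<in>C. scale (c s) (scale (f g) s))"
        unfolding grouplike_R[OF g f] by (subst (2) c) (simp add: scale_sum_right mult.commute)
      ultimately have "(\<Sum>s\<in>C. scale (c s * (f s - f g)) s) = 0"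
        by (simp add: right_diff_distrib scale_left_diff_distrib sum_subtractf)
      then show ?thesis using C(2) finC s independentD[of C C "\<lambda>s. c s * (f s - f g)" s] by simp
    qed
    moreover have "\<exists>s\<in>C. c s \<noteq> 0"
      using c g by (force simp: grouplikes_def intro: sum.neutral)
    ultimately obtain s where "s \<in> C" "\<And>f. f \<in> dual \<Longrightarrow> f s = f g" by auto
    then show ?thesis using dual_separates by metis
  qed
  then have "C = grouplikes" using C by blast
  then show ?thesis using C finC by simp
qed

lemma finite_grouplikes: "finite grouplikes" and independent_grouplikes: "independent grouplikes"
  using finite_independent_grouplikes by auto

text \<open>By cancellation, left multiplication by \<open>g\<close> is an injective and hence
  surjective self-map of the finite set of grouplikes. This gives right inverses, and a right
  inverse of a right inverse of \<open>g\<close> is \<open>g\<close> itself.\<close>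

lemma grouplike_inverse:
  assumes g: "g \<in> grouplikes"
  shows "\<exists>h\<in>grouplikes. g \<bullet> h = one \<and> h \<bullet> g = one"
proof -
  have right: "\<exists>h\<in>grouplikes. g \<bullet> h = one" if "g \<in> grouplikes" for g
  proof -
    have "inj_on ((\<bullet>) g) grouplikes"
      using grouplike_cancel[of g] that by (auto simp: inj_on_def grouplikes_def)
    moreover have "(\<bullet>) g ` grouplikes \<subseteq> grouplikes" using grouplike_mul that by auto
    ultimately have "(\<bullet>) g ` grouplikes = grouplikes"
      using endo_inj_surj finite_grouplikes by blast
    then show ?thesis using one_grouplike by (metis imageE)
  qed
  obtain h where h: "h \<in> grouplikes" "g \<bullet> h = one" using right g by blast
  moreover obtain k where k: "k \<in> grouplikes" "h \<bullet> k = one" using right h by blast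
  ultimately have "g = k"
    by (metis g grouplike_in mul_assoc mul_one_left mul_one_right)
  then show ?thesis using h k by blast
qed

section \<open>Primitive elements\<close>

context
  fixes p
  assumes p: "p \<in> B" and prim: "\<And>f. f \<in> dual \<Longrightarrow> R f p = scale (f one) p + scale (f p) one"
begin

private definition pow :: "nat \<Rightarrow> 'b" where "pow n = (((\<bullet>) p) ^^ n) one"
private definition pows :: "nat \<Rightarrow> 'b set" where "pows n = span (pow ` {..<n})"

private lemma pow_Suc: "pow (Suc n) = p \<bullet> pow n" by (simp add: pow_def)

private lemma pow_in: "pow n \<in> B"
  by (induction n) (auto simp: pow_def one_in p mul_in)

private lemma pows_subset: "pows n \<subseteq> B"
  unfolding pows_def using subspace_B pow_in by (intro span_minimal) auto

private lemma pows_mono: "m \<le> n \<Longrightarrow> pows m \<subseteq> pows n"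
  unfolding pows_def by (intro span_mono) auto

private lemma pow_in_pows: "i < n \<Longrightarrow> pow i \<in> pows n"
  unfolding pows_def by (intro span_base) auto

private lemma mul_pows:
  assumes "x \<in> pows n" shows "p \<bullet> x \<in> pows (Suc n)"
proof -
  obtain c where "x = (\<Sum>v\<in>pow ` {..<n}. scale (c v) v)"
    using assms by (auto simp: pows_def span_finite)
  moreover have "v \<in> B" if "v \<in> pow ` {..<n}" for v using that pow_in by auto
  ultimately have "p \<bullet> x = (\<Sum>v\<in>pow ` {..<n}. scale (c v) (p \<bullet> v))"
    by (simp add: mul_sum_right p)
  also have "\<dots> \<in> pows (Suc n)"
    unfolding pows_def by (intro span_sum span_scale span_base) (auto simp: pow_Suc[symmetric])
  finally show ?thesis .
qed

text \<open>A Leibniz rule, the skew primitive rule for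
  \<open>\<Delta>(p) = p \<otimes> 1 + 1 \<otimes> p\<close>.\<close>

private lemma R_prim_mul: "\<lbrakk>y \<in> B; f \<in> dual\<rbrakk> \<Longrightarrow> R f (p \<bullet> y) = p \<bullet> R f y + R (\<lambda>z. f (p \<bullet> z)) y"
proof -
  assume y: "y \<in> B" and f: "f \<in> dual"
  have "R (\<lambda>z. f (one \<bullet> z)) y = R f y"
  proof (rule dual_separates)
    fix k assume k: "k \<in> dual"
    have "(\<lambda>z. f (one \<bullet> z)) \<in> dual" by (rule dual_mul[OF f one_in])
    then show "k (R (\<lambda>z. f (one \<bullet> z)) y) = k (R f y)"
      using R_swap[OF k _ y] f mul_one_left[OF R_in[OF k y]] by simp
  qed
  then show ?thesis
    using R_mul_skew_primitive[OF one_in one_in p y f prim] y f p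
    by (simp add: mul_one_left R_in dual_mul)
qed

private lemma pows_subspace: "subspace (pows n)" by (simp add: pows_def)

text \<open>In \<open>\<Delta>\<close> of the power \<open>n\<close> of \<open>p\<close>, the only
  term whose first factor is not a lower power is that power tensored with \<open>1\<close>.\<close>

private lemma R_pow: "k \<in> dual \<Longrightarrow> R k (pow n) - scale (k one) (pow n) \<in> pows n"
proof (induction n arbitrary: k)
  case 0
  then show ?case by (simp add: pow_def pows_def R_one)
next
  case (Suc n)
  let ?k = "\<lambda>z. k (p \<bullet> z)"
  let ?d = "R k (pow n) - scale (k one) (pow n)"
  have k': "?k \<in> dual" using Suc.prems p by (rule dual_mul)
  have d: "?d \<in> pows n" using Suc by blast
  then have "p \<bullet> ?d \<in> pows (Suc n)" by (rule mul_pows)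
  moreover have "R ?k (pow n) \<in> pows (Suc n)"
  proof -
    have "(R ?k (pow n) - scale (?k one) (pow n)) + scale (?k one) (pow n) \<in> pows (Suc n)"
      using Suc.IH[OF k'] pows_mono[of n "Suc n"]
      by (intro subspace_add subspace_scale pows_subspace pow_in_pows) auto
    then show ?thesis by simp
  qed
  moreover have "R k (pow (Suc n)) - scale (k one) (pow (Suc n)) = p \<bullet> ?d + R ?k (pow n)"
  proof -
    have "p \<bullet> R k (pow n) = p \<bullet> (?d + scale (k one) (pow n))" by simp
    also have "\<dots> = p \<bullet> ?d + scale (k one) (pow (Suc n))"
      using d pows_subset p pow_in by (subst mul_add_right) (auto simp: mul_scale_right scale_in pow_Suc)
    finally show ?thesis using R_prim_mul[OF pow_in Suc.prems] by (simp add: pow_Suc)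
  qed
  ultimately show ?case by (simp add: subspace_add pows_subspace)
qed

text \<open>If \<open>p \<noteq> 0\<close>, a suitable \<open>R f\<close> lowers the filtration
  \<open>pows\<close> like a derivative. As \<open>n + 1\<close> is invertible, a power lying in the
  span of the lower ones would force the same for the preceding power, down to
  \<open>one = 0\<close>. So all powers are independent, against finite dimension.\<close>

lemma primitive_eq_0: "p = 0"
proof (rule ccontr)
  assume "p \<noteq> 0"
  have "scale (e p) one = 0" using prim[OF e_functional] R_e[OF p] by (simp add: e_one)
  then have ep: "e p = 0" using one_neq_0 by simp
  \<comment> \<open>The counit separates the two: \<open>e p = 0\<close> but
    \<open>e one = 1\<close>. Hence \<open>f\<close> below may take the value 1 at \<open>p\<close>
    and 0 at \<open>one\<close>.\<close>
  have "p \<notin> span {one}"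
  proof
    assume "p \<in> span {one}"
    then obtain c where "p = scale c one" by (auto simp: span_singleton)
    then show False using ep \<open>p \<noteq> 0\<close> dual_scale[OF e_functional one_in] e_one by simp
  qed
  then obtain f where f: "functional f" "f p = 1" "\<forall>w\<in>span {one}. f w = 0"
    using exists_functional[OF subspace_span] by blast
  have fd: "f \<in> dual" using f(1) by (rule functionals_on_linear)
  have f1: "f one = 0" using f(3) span_base by blast
  let ?k = "\<lambda>z. f (p \<bullet> z)"
  have k: "?k \<in> dual" by (rule dual_mul[OF fd p])
  have k1: "?k one = 1" by (simp add: mul_one_right p f)
  \<comment> \<open>The factor grows by one at each step because the Leibniz rule adds
    \<open>R ?k (pow (Suc n))\<close>, which is \<open>pow (Suc n)\<close> modulo lower powers since
    \<open>?k one = f p = 1\<close>.\<close>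
  have D: "R f (pow (Suc n)) - scale (of_nat (Suc n)) (pow n) \<in> pows n" for n
  proof (induction n)
    case 0
    show ?case using R_prim_mul[OF one_in fd] R_one[OF fd] R_one[OF k] k1 f1 mul_scale_right[OF p one_in, of 0]
      by (simp add: pow_def pows_def)
  next
    case (Suc n)
    let ?d = "R f (pow (Suc n)) - scale (of_nat (Suc n)) (pow n)"
    have d: "?d \<in> pows n" by (rule Suc)
    have "p \<bullet> R f (pow (Suc n)) = p \<bullet> (?d + scale (of_nat (Suc n)) (pow n))" by simp
    also have "\<dots> = p \<bullet> ?d + scale (of_nat (Suc n)) (pow (Suc n))"
      using d pows_subset p pow_in by (subst mul_add_right) (auto simp: mul_scale_right scale_in pow_Suc)
    finally have "R f (pow (Suc (Suc n))) - scale (of_nat (Suc (Suc n))) (pow (Suc n)) =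
       p \<bullet> ?d + (R ?k (pow (Suc n)) - scale (?k one) (pow (Suc n)))"
      using R_prim_mul[OF pow_in fd, of "Suc n"] k1
      by (simp add: pow_Suc[of "Suc n"] of_nat_Suc[of "Suc n"] scale_left_distrib del: of_nat_Suc)
    then show ?case
      using mul_pows[OF d] R_pow[OF k, of "Suc n"] by (simp add: subspace_add pows_subspace)
  qed
  have D_pows: "R f x \<in> pows n" if x: "x \<in> pows (Suc n)" for n x
  proof -
    obtain c where "x = (\<Sum>v\<in>pow ` {..<Suc n}. scale (c v) v)"
      using x unfolding pows_def span_finite[OF finite_imageI[OF finite_lessThan]] by blast
    moreover have "v \<in> B" if "v \<in> pow ` {..<Suc n}" for v using that pow_in by auto
    ultimately have "R f x = (\<Sum>v\<in>pow ` {..<Suc n}. scale (c v) (R f v))"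
      by (simp add: R_sum fd)
    also have "\<dots> \<in> pows n"
    proof (intro subspace_sum subspace_scale pows_subspace)
      fix v assume "v \<in> pow ` {..<Suc n}"
      then obtain i where i: "v = pow i" "i \<le> n" by auto
      show "R f v \<in> pows n"
      proof (cases i)
        case 0
        then have "R f v = 0" using R_one[OF fd] f1 i by (simp add: pow_def)
        then show ?thesis using subspace_0 pows_subspace by simp
      next
        case (Suc j)
        have "(R f v - scale (of_nat (Suc j)) (pow j)) + scale (of_nat (Suc j)) (pow j) \<in> pows n"
          using D[of j] i Suc pows_mono[of j n]
          by (intro subspace_add subspace_scale pows_subspace pow_in_pows) auto
        then show ?thesis by simp
      qed
    qed
    finally show ?thesis .
  qed
  have notin: "pow n \<notin> pows n" for n
  proof (induction n)
    case 0
    show ?case using one_neq_0 by (simp add: pow_def pows_def)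
  next
    case (Suc n)
    show ?case
    proof
      assume "pow (Suc n) \<in> pows (Suc n)"
      then have "R f (pow (Suc n)) - (R f (pow (Suc n)) - scale (of_nat (Suc n)) (pow n)) \<in> pows n"
        by (intro subspace_diff pows_subspace D_pows D)
      then have "scale (1 / of_nat (Suc n)) (scale (of_nat (Suc n)) (pow n)) \<in> pows n"
        by (intro subspace_scale[OF pows_subspace, where c = "1 / of_nat (Suc n)"]) simp
      then show False using Suc of_nat_neq_0[of n, where 'a = complex] unfolding scale_scale
        by (simp del: of_nat_Suc)
    qed
  qed
  have indep: "independent (pow ` {..<n}) \<and> card (pow ` {..<n}) = n" for n
  proof (induction n)
    case (Suc n)
    have n: "pow n \<notin> span (pow ` {..<n})" using notin[of n] unfolding pows_def .
    then have "pow n \<notin> pow ` {..<n}" using span_base[of "pow n" "pow ` {..<n}"] by argo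
    moreover have "independent (insert (pow n) (pow ` {..<n}))"
      using n conjunct1[OF Suc] by (rule independent_insertI)
    ultimately show ?case using Suc by (simp add: lessThan_Suc)
  qed (simp add: independent_empty)
  obtain S where S: "finite S" "B \<subseteq> span S" using finite_dim_B by blast
  have "pow ` {..<Suc (card S)} \<subseteq> span S" using pow_in S by auto
  then show False using independent_span_bound[OF S(1)] indep[of "Suc (card S)"] by fastforce
qed

end

section \<open>The span of the grouplike elements\<close>

lemma R_span_grouplikes:
  assumes "f \<in> dual" "x \<in> span grouplikes"
  shows "R f x \<in> span grouplikes"
proof -
  obtain c where "x = (\<Sum>v\<in>grouplikes. scale (c v) v)"
    using assms(2) finite_grouplikes by (auto simp: span_finite)
  then have "R f x = (\<Sum>v\<in>grouplikes. scale (c v) (scale (f v) v))"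
    using assms(1) by (simp add: R_sum grouplike_in grouplike_R)
  also have "\<dots> \<in> span grouplikes" by (intro span_sum span_scale span_base)
  finally show ?thesis .
qed

lemma mul_span_grouplikes:
  assumes "g \<in> grouplikes" "x \<in> span grouplikes"
  shows "g \<bullet> x \<in> span grouplikes"
proof -
  obtain c where "x = (\<Sum>v\<in>grouplikes. scale (c v) v)"
    using assms(2) finite_grouplikes by (auto simp: span_finite)
  then have "g \<bullet> x = (\<Sum>v\<in>grouplikes. scale (c v) (g \<bullet> v))"
    using assms(1) by (simp add: mul_sum_right grouplike_in)
  also have "\<dots> \<in> span grouplikes"
    using grouplike_mul assms(1) by (intro span_sum span_scale span_base)
  finally show ?thesis .
qed

lemma span_grouplikes_subset: "span grouplikes \<subseteq> B"
  using grouplike_in subspace_B by (intro span_minimal) auto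

definition coef :: "'b \<Rightarrow> 'b \<Rightarrow> complex" where
  "coef = (SOME \<kappa>. (\<forall>g. functional (\<kappa> g)) \<and>
    (\<forall>g. \<forall>x\<in>grouplikes. \<kappa> g x = (if x = g then 1 else 0)) \<and>
    (\<forall>x\<in>span grouplikes. x = (\<Sum>g\<in>grouplikes. scale (\<kappa> g x) g)))"

lemma coef: "functional (coef g)"
    "x \<in> grouplikes \<Longrightarrow> coef g x = (if x = g then 1 else 0)"
  and span_grouplikes_expansion: "y \<in> span grouplikes \<Longrightarrow> y = (\<Sum>g\<in>grouplikes. scale (coef g y) g)"
  using someI_ex[OF exists_dual_basis[OF independent_grouplikes finite_grouplikes], folded coef_def]
  by blast+

lemma coef_dual: "coef g \<in> dual" using coef(1) by (rule functionals_on_linear)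

text \<open>The commuting operators \<open>R f\<close> have a common eigenvector modulo the span,
  with eigenvalues \<open>\<chi> f\<close>. These are the values \<open>f g\<close> at one element
  \<open>g\<close> of \<open>B\<close>, which proves to be grouplike; multiplying by its inverse
  moves the eigenvalues to \<open>f one\<close>.\<close>

lemma exists_translated_eigenvector:
  assumes "span grouplikes \<noteq> B"
  shows "\<exists>h\<in>B. h \<notin> span grouplikes \<and> (\<forall>f\<in>dual. R f h - scale (f one) h \<in> span grouplikes)"
proof -
  let ?W = "span grouplikes"
  obtain S where S: "finite S" "B \<subseteq> span S" using finite_dim_B by blast
  have "\<exists>u\<in>B. u \<notin> ?W \<and> (\<forall>f\<in>dual. \<exists>c. R f u - scale c u \<in> ?W)"
    by (rule common_eigenvector_mod[OF subspace_B S subspace_span])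
      (use assms span_grouplikes_subset in \<open>auto simp: R_in R_add R_scale R_comm R_span_grouplikes\<close>)
  then obtain h \<chi> where h: "h \<in> B" "h \<notin> ?W" and \<chi>: "\<And>f. f \<in> dual \<Longrightarrow> R f h - scale (\<chi> f) h \<in> ?W"
    by metis
  obtain \<phi> where \<phi>: "functional \<phi>" "\<phi> h = 1" "\<forall>w\<in>?W. \<phi> w = 0"
    using exists_functional[OF subspace_span h(2)] by blast
  have \<phi>d: "\<phi> \<in> dual" using \<phi>(1) by (rule functionals_on_linear)
  \<comment> \<open>Since \<open>\<phi>\<close> kills the span and \<open>\<phi> h = 1\<close>, the
    eigenvalue is \<open>\<phi> (R f h)\<close>, and cocommutativity turns this into
    \<open>f (R \<phi> h)\<close>.\<close>
  define g where "g = R \<phi> h"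
  have gB: "g \<in> B" unfolding g_def by (rule R_in[OF \<phi>d h(1)])
  have \<chi>_eq: "\<chi> f = f g" if f: "f \<in> dual" for f
  proof -
    have "\<phi> (R f h - scale (\<chi> f) h) = 0" using \<phi> \<chi> f by blast
    then have "\<phi> (R f h) = \<chi> f"
      using dual_diff[OF \<phi>d R_in[OF f h(1)] scale_in[OF h(1)]] dual_scale[OF \<phi>d h(1)] \<phi>(2) by simp
    then show ?thesis using R_swap[OF f \<phi>d h(1)] by (simp add: g_def)
  qed
  have "R f g = scale (f g) g" if f: "f \<in> dual" for f
  proof (rule dual_separates)
    fix k assume k: "k \<in> dual"
    define w where "w = R f h - scale (f g) h"
    have w: "w \<in> ?W" using \<chi>[OF f] \<chi>_eq[OF f] by (simp add: w_def)
    then have wB: "w \<in> B" using span_grouplikes_subset by blast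
    have "k (R f g) = k (R \<phi> (R f h))" unfolding g_def by (simp add: R_comm f \<phi>d h)
    also have "\<dots> = \<phi> (R k (R f h))" using R_swap[OF k \<phi>d R_in[OF f h(1)]] .
    also have "R f h = scale (f g) h + w" by (simp add: w_def)
    also have "\<phi> (R k (scale (f g) h + w)) = f g * \<phi> (R k h) + \<phi> (R k w)"
      using h wB by (simp add: R_add R_scale scale_in dual_add dual_scale \<phi>d k R_in)
    also have "\<phi> (R k w) = 0" using \<phi>(3) R_span_grouplikes[OF k w] by blast
    also have "\<phi> (R k h) = k g" using R_swap[OF k \<phi>d h(1)] by (simp add: g_def)
    finally show "k (R f g) = k (scale (f g) g)" using gB k by (simp add: dual_scale)
  qed
  moreover have "g \<noteq> 0"
  proof
    assume "g = 0"
    moreover have "e g = 1" unfolding g_def using e_R[OF \<phi>d h(1)] \<phi>(2) by simp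
    ultimately show False using dual_zero[OF e_functional] by simp
  qed
  ultimately have g: "g \<in> grouplikes" using gB by (simp add: grouplikes_def)
  then obtain g' where g': "g' \<in> grouplikes" "g \<bullet> g' = one" "g' \<bullet> g = one"
    using grouplike_inverse by blast
  have h1: "g' \<bullet> h \<in> B" using g' h mul_in grouplike_in by blast
  moreover have "g' \<bullet> h \<notin> ?W"
  proof
    assume "g' \<bullet> h \<in> ?W"
    then have "g \<bullet> (g' \<bullet> h) \<in> ?W" by (rule mul_span_grouplikes[OF g])
    then show False using h g' g by (simp add: grouplike_in mul_one_left flip: mul_assoc)
  qed
  moreover have "R f (g' \<bullet> h) - scale (f one) (g' \<bullet> h) \<in> ?W" if f: "f \<in> dual" for f
  proof -
    let ?f = "\<lambda>z. f (g' \<bullet> z)"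
    have f': "?f \<in> dual" by (rule dual_mul[OF f grouplike_in[OF g'(1)]])
    define w where "w = R ?f h - scale (f one) h"
    have w: "w \<in> ?W" using \<chi>[OF f'] \<chi>_eq[OF f'] g' by (simp add: w_def)
    have "R f (g' \<bullet> h) = g' \<bullet> (scale (f one) h + w)"
      using R_grouplike_mul[OF g'(1) h(1) f] by (simp add: w_def)
    also have "\<dots> = scale (f one) (g' \<bullet> h) + g' \<bullet> w"
      using h w span_grouplikes_subset grouplike_in[OF g'(1)]
      by (subst mul_add_right) (auto simp: mul_scale_right scale_in)
    finally show ?thesis using mul_span_grouplikes[OF g'(1) w] by simp
  qed
  ultimately show ?thesis by blast
qed

text \<open>Commutativity of the operators \<open>R f\<close> forces the coefficients \<open>coef x (R f h)\<close> to be multiples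
  of \<open>f x - f one\<close> for \<open>x \<noteq> one\<close>; subtracting a combination of grouplikes makes \<open>h\<close> primitive.\<close>

theorem span_grouplikes: "span grouplikes = B"
proof (rule ccontr)
  let ?W = "span grouplikes"
  assume "?W \<noteq> B"
  then obtain h where h: "h \<in> B" "h \<notin> ?W" and w: "\<And>f. f \<in> dual \<Longrightarrow> R f h - scale (f one) h \<in> ?W"
    using exists_translated_eigenvector by blast
  define c where "c x f = coef x (R f h - scale (f one) h)" for x f
  have R_h: "R f h = scale (f one) h + (\<Sum>x\<in>grouplikes. scale (c x f) x)" if "f \<in> dual" for f
    using span_grouplikes_expansion[OF w[OF that]] by (simp add: c_def algebra_simps)
  have RR: "R k (R f h) = scale (f one * k one) h + (\<Sum>x\<in>grouplikes. scale (f one * c x k + c x f * k x) x)"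
    if f: "f \<in> dual" and k: "k \<in> dual" for f k
  proof -
    have "R k (R f h) = scale (f one) (R k h) + (\<Sum>x\<in>grouplikes. scale (c x f) (scale (k x) x))"
      unfolding R_h[OF f] using h k
      by (subst R_add) (auto simp: R_scale scale_in sum_in grouplike_in R_sum grouplike_R)
    also have "\<dots> = scale (f one * k one) h + (\<Sum>x\<in>grouplikes. scale (f one * c x k + c x f * k x) x)"
      unfolding R_h[OF k] by (simp add: scale_right_distrib scale_sum_right scale_left_distrib sum.distrib)
    finally show ?thesis .
  qed
  have cx: "c x f * (k x - k one) = c x k * (f x - f one)"
    if f: "f \<in> dual" and k: "k \<in> dual" and x: "x \<in> grouplikes" for x f k
  proof -
    have "(\<Sum>x\<in>grouplikes. scale (f one * c x k + c x f * k x) x) = (\<Sum>x\<in>grouplikes. scale (k one * c x f + c x k * f x) x)"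
      using R_comm[OF k f h(1)] unfolding RR[OF f k] RR[OF k f] by (simp add: mult.commute)
    then have "(\<Sum>x\<in>grouplikes. scale ((f one * c x k + c x f * k x) - (k one * c x f + c x k * f x)) x) = 0"
      by (simp only: scale_left_diff_distrib sum_subtractf) simp
    then have "(f one * c x k + c x f * k x) - (k one * c x f + c x k * f x) = 0"
      by (intro independentD[OF independent_grouplikes finite_grouplikes subset_refl _ x])
    then show ?thesis by (simp add: algebra_simps)
  qed
  have "\<exists>d. \<forall>f\<in>dual. c x f = d * (f x - f one)" if x: "x \<in> grouplikes" "x \<noteq> one" for x
  proof -
    \<comment> \<open>A single functional \<open>k\<close> separating \<open>x\<close> from
      \<open>one\<close> fixes the factor: \<open>d = c x k / (k x - k one)\<close> works for every
      \<open>f\<close>.\<close>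
    obtain k where k: "k \<in> dual" "k x \<noteq> k one" using dual_separates x by blast
    then have "c x f = c x k / (k x - k one) * (f x - f one)" if "f \<in> dual" for f
      using cx[OF that k(1) x(1)] by (simp add: field_simps)
    then show ?thesis by blast
  qed
  then obtain d where d: "\<And>x f. x \<in> grouplikes \<Longrightarrow> x \<noteq> one \<Longrightarrow> f \<in> dual \<Longrightarrow> c x f = d x * (f x - f one)"
    by metis
  define G1 where "G1 = grouplikes - {one}"
  define s where "s = (\<Sum>x\<in>G1. scale (d x) x)"
  have sW: "s \<in> ?W" unfolding s_def G1_def by (intro span_sum span_scale span_base) auto
  then have sB: "s \<in> B" using span_grouplikes_subset by blast
  have R_s: "R f s = (\<Sum>x\<in>G1. scale (d x * f x) x)" if "f \<in> dual" for f
    unfolding s_def using that by (subst R_sum) (auto simp: G1_def grouplike_in grouplike_R)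
  define q where "q = h - s"
  have qB: "q \<in> B" unfolding q_def using h sB diff_in by blast
  have R_q: "R f q = scale (f one) q + scale (c one f) one" if f: "f \<in> dual" for f
  proof -
    have "R f h = scale (f one) h + scale (c one f) one + (\<Sum>x\<in>G1. scale (c x f) x)"
      unfolding R_h[OF f] G1_def using finite_grouplikes one_grouplike by (simp add: sum.remove add.assoc)
    also have "(\<Sum>x\<in>G1. scale (c x f) x) = (\<Sum>x\<in>G1. scale (d x * f x) x) - scale (f one) s"
      unfolding s_def scale_sum_right sum_subtractf[symmetric] using d[OF _ _ f]
      by (intro sum.cong) (auto simp: G1_def right_diff_distrib scale_left_diff_distrib mult.commute)
    finally show ?thesis
      by (simp add: q_def R_diff f h sB R_s scale_right_diff_distrib)
  qed
  \<comment> \<open>Normalised to \<open>e p = 0\<close>, so that the counit identifies the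
    remaining coefficient \<open>c one f\<close> as \<open>f p\<close>.\<close>
  define p where "p = q - scale (e q) one"
  have pB: "p \<in> B" unfolding p_def using qB one_in diff_in scale_in by blast
  have R_p: "R f p = scale (f one) p + scale (c one f) one" if f: "f \<in> dual" for f
    using R_q[OF f] R_one[OF f] qB one_in f
    by (simp add: p_def R_diff R_scale scale_in scale_right_diff_distrib mult.commute)
  have ep: "e p = 0"
    using dual_diff[OF e_functional qB scale_in[OF one_in]] dual_scale[OF e_functional one_in] e_one
    by (simp add: p_def)
  \<comment> \<open>Apply \<open>e\<close> to \<open>R_p\<close>: the left side is
    \<open>f p\<close> by the counit law, and on the right \<open>e p = 0\<close> and
    \<open>e one = 1\<close>.\<close>
  have "c one f = f p" if f: "f \<in> dual" for f
  proof -
    have "f p = e (R f p)" using e_R[OF f pB] by simp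
    also have "\<dots> = c one f"
      unfolding R_p[OF f] using ep pB one_in
      by (simp add: dual_add dual_scale e_functional scale_in e_one)
    finally show ?thesis by simp
  qed
  then have "p = 0" using R_p by (intro primitive_eq_0 pB) simp
  then have "h = s + scale (e q) one" by (simp add: p_def q_def algebra_simps)
  also have "\<dots> \<in> ?W" using sW span_scale[OF span_base[OF one_grouplike]] by (rule span_add)
  finally show False using h by simp
qed

lemma expansion: "x \<in> B \<Longrightarrow> x = (\<Sum>g\<in>grouplikes. scale (coef g x) g)"
  using span_grouplikes_expansion span_grouplikes by blast

lemma R_coef: "\<lbrakk>x \<in> B\<rbrakk> \<Longrightarrow> g \<in> grouplikes \<Longrightarrow> R (coef g) x = scale (coef g x) g"
proof -
  assume x: "x \<in> B" and g: "g \<in> grouplikes"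
  have "R (coef g) (\<Sum>h\<in>grouplikes. scale (coef h x) h) = (\<Sum>h\<in>grouplikes. scale (coef h x) (scale (coef g h) h))"
    by (subst R_sum[OF coef_dual grouplike_in]) (auto simp: grouplike_R coef_dual)
  also have "\<dots> = scale (coef g x) g"
    using g finite_grouplikes by (subst sum.mono_neutral_right[of _ "{g}"]) (auto simp: coef)
  finally show ?thesis using expansion[OF x] by simp
qed

end

section \<open>Simple vertex operator algebras\<close>

context vertex_operator_algebra begin

sublocale complex_vector_space scale ..

sublocale Y_right: Vector_Spaces.linear scale scale "Y u n" for u n
  by (rule Y_linear)

lemma Y_add_left: "Y (u + u') n v = Y u n v + Y u' n v"
  and Y_scale_left: "Y (scale c u) n v = scale c (Y u n v)"
  and Y_zero_left: "Y 0 n v = 0"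
proof -
  interpret Vector_Spaces.linear scale scale "\<lambda>u. Y u n v" by (rule Y_linear_left)
  show "Y (u + u') n v = Y u n v + Y u' n v" "Y (scale c u) n v = scale c (Y u n v)" "Y 0 n v = 0"
    using add scale zero by auto
qed

lemma Y_sum_left: "Y (\<Sum>i\<in>I. u i) n v = (\<Sum>i\<in>I. Y (u i) n v)"
  by (induction I rule: infinite_finite_induct) (auto simp: Y_add_left Y_zero_left)

lemma finite_truncation: "finite {i :: nat. Y u (n + int i) v \<noteq> 0}"
proof -
  obtain N where "\<forall>n\<ge>N. Y u n v = 0" using truncation by blast
  then have "{i :: nat. Y u (n + int i) v \<noteq> 0} \<subseteq> {..<nat (N - n)}"
    by (auto simp: not_less) (metis diff_le_eq nat_int nat_mono not_le add.commute zle_int linorder_not_less nat_le_iff)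
  then show ?thesis by (rule finite_subset) simp
qed

lemma Sum_any_eq_first:
  fixes f :: "nat \<Rightarrow> 'v"
  assumes "\<And>i. i > 0 \<Longrightarrow> f i = 0"
  shows "Sum_any f = f 0"
  using assms by (subst Sum_any.expand_superset[of "{0}"]) auto

lemma uminus_one_powi_diff:
  "(-1 :: complex) powi (l - int i) = (-1) powi l * (-1) ^ i"
  by (simp add: power_int_diff divide_inverse flip: power_inverse)

text \<open>The left-hand side of the Jacobi identity changes by a sign under exchange of the two
  vectors, so its right-hand side does as well.\<close>

lemma jacobi_swap:
  "Sum_any (\<lambda>i. scale (of_int m gchoose i) (Y (Y u (l + int i) v) (m + n - int i) w)) =
   scale (- ((-1) powi l))
     (Sum_any (\<lambda>i. scale (of_int n gchoose i) (Y (Y v (l + int i) u) (n + m - int i) w)))"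
proof -
  define A where "A i = scale ((-1) ^ i * (of_int l gchoose i)) (Y u (m + l - int i) (Y v (n + int i) w))" for i :: nat
  define B where "B i = scale ((-1) ^ i * (of_int l gchoose i)) (Y v (n + l - int i) (Y u (m + int i) w))" for i :: nat
  have finA: "finite {i. A i \<noteq> 0}"
    by (rule finite_subset[OF _ finite_truncation[of v n w]]) (auto simp: A_def)
  have finB: "finite {i. B i \<noteq> 0}"
    by (rule finite_subset[OF _ finite_truncation[of u m w]]) (auto simp: B_def)
  let ?s = "(-1 :: complex) powi l"
  have S: "Sum_any (\<lambda>i. scale c (f i)) = scale c (Sum_any f)" if "finite {i. f i \<noteq> 0}" for c and f :: "nat \<Rightarrow> 'v"
    using that by (subst (1 2) Sum_any.expand_superset[of "{i. f i \<noteq> 0}"]) (auto simp: scale_sum_right)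
  have "Sum_any A - scale ?s (Sum_any B) =
     Sum_any (\<lambda>i. scale (of_int m gchoose i) (Y (Y u (l + int i) v) (m + n - int i) w))"
    using jacobi[of l u m v n w] S[OF finB, of ?s]
    unfolding A_def B_def by (simp add: uminus_one_powi_diff mult.assoc)
  moreover have "Sum_any B - scale ?s (Sum_any A) =
     Sum_any (\<lambda>i. scale (of_int n gchoose i) (Y (Y v (l + int i) u) (n + m - int i) w))"
    using jacobi[of l v n u m w] S[OF finA, of ?s]
    unfolding A_def B_def by (simp add: uminus_one_powi_diff mult.assoc)
  moreover have "scale (- ?s) (Sum_any B - scale ?s (Sum_any A)) = Sum_any A - scale ?s (Sum_any B)"
  proof -
    have "?s * ?s = 1" by (simp add: power_int_def flip: power_mult_distrib)
    then show ?thesis by (simp add: scale_right_diff_distrib)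
  qed
  ultimately show ?thesis by metis
qed

text \<open>The exchanged Jacobi identity on the vacuum with \<open>m = 0\<close> and
  \<open>n = -1\<close>: on the left only \<open>i = 0\<close> survives and creation removes the
  vacuum, on the right the binomials are signs. By \<open>Y_vac_eq_translate\<close> this is the
  usual \<open>Y(u, z) v = e^(z L(-1)) Y(v, -z) u\<close>.\<close>

lemma skew_symmetry:
  "Y u l v = Sum_any (\<lambda>i. scale (- ((-1) powi l) * (-1) ^ i) (Y (Y v (l + int i) u) (-1 - int i) vac))"
proof -
  have g0: "(0 :: complex) gchoose i = (if i = 0 then 1 else 0)" for i by (cases i) auto
  have g1: "(-1 :: complex) gchoose i = (-1) ^ i" for i
    using gbinomial_minus[of "1 :: complex" i] binomial_gbinomial[of i i, where 'a = complex] by simp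
  have "Y u l v = Sum_any (\<lambda>i. scale (of_int 0 gchoose i) (Y (Y u (l + int i) v) (0 + -1 - int i) vac))"
    by (subst Sum_any_eq_first) (auto simp: g0 creation)
  also have "\<dots> = scale (- ((-1) powi l)) (Sum_any (\<lambda>i. scale ((-1) ^ i) (Y (Y v (l + int i) u) (-1 - int i) vac)))"
    by (subst jacobi_swap) (simp add: g1)
  also have "\<dots> = Sum_any (\<lambda>i. scale (- ((-1) powi l) * (-1) ^ i) (Y (Y v (l + int i) u) (-1 - int i) vac))"
  proof -
    have fin: "finite {i. Y v (l + int i) u \<noteq> 0}" by (rule finite_truncation)
    show ?thesis
      by (subst (1 2) Sum_any.expand_superset[OF fin]) (auto simp: scale_sum_right Y_zero_left)
  qed
  finally show ?thesis .
qed

text \<open>The coefficients of \<open>Y(a, z) vac = e^(z L(-1)) a\<close>, where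
  \<open>Y \<omega> 0\<close> is \<open>L(-1)\<close>; each step is the translation axiom.\<close>

lemma Y_vac_eq_translate: "Y a (-1 - int i) vac = scale (1 / fact i) ((Y \<omega> 0 ^^ i) a)"
proof (induction i arbitrary: a)
  case 0
  then show ?case by (simp add: creation)
next
  case (Suc i)
  have "Y (Y \<omega> 0 a) (-1 - int i) vac = scale (of_nat (Suc i)) (Y a (-1 - int (Suc i)) vac)"
    unfolding translation by (simp add: algebra_simps)
  then have "scale (1 / of_nat (Suc i)) (Y (Y \<omega> 0 a) (-1 - int i) vac) = Y a (-1 - int (Suc i)) vac"
    using of_nat_neq_0[of i, where 'a = complex] by (simp del: of_nat_Suc)
  then show ?case unfolding Suc by (simp add: funpow_swap1 field_simps)
qed

definition mode_invariant :: "'v set \<Rightarrow> bool" where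
  "mode_invariant I \<longleftrightarrow> subspace I \<and> (\<forall>v n. \<forall>u\<in>I. Y v n u \<in> I)"

text \<open>Skew symmetry expresses \<open>Y u n v\<close> by modes of \<open>v\<close> applied to
  \<open>u\<close>, followed by powers of \<open>L(-1)\<close>. As \<open>L(-1)\<close> is itself a
  mode, invariance on one side is enough.\<close>

lemma voa_ideal_if_mode_invariant:
  assumes "mode_invariant I"
  shows "voa_ideal I"
proof -
  have sub: "subspace I" and Y: "\<And>v n u. u \<in> I \<Longrightarrow> Y v n u \<in> I"
    using assms by (auto simp: mode_invariant_def)
  have L: "(Y \<omega> 0 ^^ i) a \<in> I" if "a \<in> I" for i a
    by (induction i) (use that Y in auto)
  have "Y u n v \<in> I" if "u \<in> I" for u v n
    unfolding skew_symmetry[of u n v] Sum_any.expand_set Y_vac_eq_translate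
    using that sub by (intro subspace_sum subspace_scale L Y)
  then show ?thesis using sub Y by (simp add: voa_ideal_def)
qed

end

locale simple_voa = vertex_operator_algebra scale Y vac \<omega> V
  for scale :: "complex \<Rightarrow> 'v :: ab_group_add \<Rightarrow> 'v" and Y vac \<omega> V +
  assumes simple: "simple"
begin

lemma simple_mode_invariant: "mode_invariant I \<Longrightarrow> I = {0} \<or> I = UNIV"
  using simple voa_ideal_if_mode_invariant by (auto simp: simple_def)

lemma vac_neq_0: "vac \<noteq> 0"
proof
  assume "vac = 0"
  then have "v = 0" for v :: 'v using vacuum[of "-1" v] Y_zero_left by simp
  then show False using simple by (auto simp: simple_def)
qed

text \<open>Commuting with \<open>L(0)\<close>, which is \<open>Y \<omega> 1\<close>, the map
  \<open>\<theta>\<close> preserves the finite dimensional space \<open>V 0\<close>, which is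
  nonzero because it contains the vacuum. So an eigenvalue exists, and its full eigenspace is mode
  invariant.\<close>

lemma schur:
  assumes \<theta>: "Vector_Spaces.linear scale scale \<theta>" and comm: "\<And>a n v. \<theta> (Y a n v) = Y a n (\<theta> v)"
  shows "\<exists>c. \<forall>v. \<theta> v = scale c v"
proof -
  interpret \<theta>: Vector_Spaces.linear scale scale \<theta> by fact
  obtain S where S: "finite S" "span S = V 0" using weight_space_finite_dim by blast
  have "\<exists>c. \<exists>u\<in>V 0. u \<notin> {0} \<and> \<theta> u - scale c u \<in> {0}"
  proof (rule eigenvector_mod[where S = S])
    show "subspace (V 0)" using S(2) subspace_span by metis
    show "\<theta> x \<in> V 0" if "x \<in> V 0" for x
      using that comm[of \<omega> 1 x] by (simp add: weight_space \<theta>.zero)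
  qed (use S vac_weight vac_neq_0 in \<open>auto simp: \<theta>.add \<theta>.scale\<close>)
  then obtain c u where u: "u \<noteq> 0" "\<theta> u = scale c u" by auto
  define I where "I = {v. \<theta> v = scale c v}"
  have "subspace I"
    by (rule subspaceI) (auto simp: I_def \<theta>.add \<theta>.zero \<theta>.scale scale_right_distrib mult.commute)
  then have "mode_invariant I"
    by (auto simp: mode_invariant_def I_def comm Y_right.scale)
  then have "I = UNIV" using simple_mode_invariant[of I] u by (auto simp: I_def)
  then show ?thesis by (auto simp: I_def)
qed

text \<open>For large \<open>l\<close> the Jacobi identity expresses commutativity of \<open>Y a\<close> and \<open>Y (u i)\<close> up to the
  factor \<open>(z\<^sub>1 - z\<^sub>2)^l\<close>, which can be cancelled by downward induction on the mode of \<open>a\<close>.\<close>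

lemma relation_mode_invariant:
  assumes fin: "finite I" and rel: "\<And>n. (\<Sum>i\<in>I. Y (u i) n (w i)) = 0"
  shows "(\<Sum>i\<in>I. Y (u i) n (Y a m (w i))) = 0"
proof -
  define X where "X p q = (\<Sum>i\<in>I. Y (u i) p (Y a q (w i)))" for p q
  have ex: "\<exists>N. \<forall>n\<ge>N. \<forall>i\<in>I. Y a n (x i) = 0" for x
    using fin
  proof (induction I rule: finite_induct)
    case (insert i I)
    then obtain N where "\<forall>n\<ge>N. \<forall>i\<in>I. Y a n (x i) = 0" by blast
    moreover obtain M where "\<forall>n\<ge>M. Y a n (x i) = 0" using truncation by blast
    ultimately show ?case by (intro exI[of _ "max N M"]) auto
  qed auto
  \<comment> \<open>The exponent \<open>l = N\<close> makes the right-hand side of the Jacobi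
    identity vanish for all the \<open>u i\<close> at once; \<open>Q\<close> below provides the
    start of the downward induction.\<close>
  obtain N where N: "\<And>n i. n \<ge> N \<Longrightarrow> i \<in> I \<Longrightarrow> Y a n (u i) = 0" using ex[of u] by blast
  obtain Q where Q: "\<And>n i. n \<ge> Q \<Longrightarrow> i \<in> I \<Longrightarrow> Y a n (w i) = 0" using ex[of w] by blast
  have X0: "X p q = 0" if "q \<ge> Q" for p q using that Q by (simp add: X_def)
  \<comment> \<open>The products with \<open>Y a\<close> on the outside cancel when summed over
    \<open>i\<close>, by the relation \<open>rel\<close>. The other half of the Jacobi identity is
    left as a recurrence for \<open>X\<close>.\<close>
  have rec: "Sum_any (\<lambda>j. scale ((-1) powi (N - int j) * (of_int N gchoose j)) (X (p + N - int j) (q + int j))) = 0" for p q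
  proof -
    define J where "J = (\<Union>i\<in>I. {j :: nat. Y (u i) (p + int j) (w i) \<noteq> 0} \<union> {j. Y a (q + int j) (w i) \<noteq> 0})"
    have finJ: "finite J" unfolding J_def using fin finite_truncation by auto
    have one: "(\<Sum>j\<in>J. scale ((-1) ^ j * (of_int N gchoose j)) (Y a (q + N - int j) (Y (u i) (p + int j) (w i)))) =
      (\<Sum>j\<in>J. scale ((-1) powi (N - int j) * (of_int N gchoose j)) (Y (u i) (p + N - int j) (Y a (q + int j) (w i))))"
      if i: "i \<in> I" for i
    proof -
      have "Sum_any (\<lambda>j. scale ((-1) ^ j * (of_int N gchoose j)) (Y a (q + N - int j) (Y (u i) (p + int j) (w i))))
        - Sum_any (\<lambda>j. scale ((-1) powi (N - int j) * (of_int N gchoose j)) (Y (u i) (p + N - int j) (Y a (q + int j) (w i)))) = 0"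
        unfolding jacobi using N i by (simp add: Y_zero_left)
      moreover have "Sum_any (\<lambda>j. scale ((-1) ^ j * (of_int N gchoose j)) (Y a (q + N - int j) (Y (u i) (p + int j) (w i)))) =
        (\<Sum>j\<in>J. scale ((-1) ^ j * (of_int N gchoose j)) (Y a (q + N - int j) (Y (u i) (p + int j) (w i))))"
        using i by (intro Sum_any.expand_superset finJ) (auto simp: J_def)
      moreover have "Sum_any (\<lambda>j. scale ((-1) powi (N - int j) * (of_int N gchoose j)) (Y (u i) (p + N - int j) (Y a (q + int j) (w i)))) =
        (\<Sum>j\<in>J. scale ((-1) powi (N - int j) * (of_int N gchoose j)) (Y (u i) (p + N - int j) (Y a (q + int j) (w i))))"
        using i by (intro Sum_any.expand_superset finJ) (auto simp: J_def)
      ultimately show ?thesis by simp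
    qed
    have "(\<Sum>j\<in>J. scale ((-1) powi (N - int j) * (of_int N gchoose j)) (X (p + N - int j) (q + int j))) =
      (\<Sum>i\<in>I. \<Sum>j\<in>J. scale ((-1) powi (N - int j) * (of_int N gchoose j)) (Y (u i) (p + N - int j) (Y a (q + int j) (w i))))"
      unfolding X_def scale_sum_right by (rule sum.swap)
    also have "\<dots> = (\<Sum>i\<in>I. \<Sum>j\<in>J. scale ((-1) ^ j * (of_int N gchoose j)) (Y a (q + N - int j) (Y (u i) (p + int j) (w i))))"
      by (intro sum.cong refl one[symmetric])
    also have "\<dots> = (\<Sum>j\<in>J. scale ((-1) ^ j * (of_int N gchoose j)) (Y a (q + N - int j) (\<Sum>i\<in>I. Y (u i) (p + int j) (w i))))"
      unfolding Y_right.sum scale_sum_right by (rule sum.swap)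
    also have "\<dots> = 0" by (simp add: rel)
    finally show ?thesis
      by (subst Sum_any.expand_superset[OF finJ]) (auto simp: J_def X_def intro!: sum.neutral)
  qed
  \<comment> \<open>In the recurrence at \<open>q = Q - k\<close> all terms with
    \<open>j > 0\<close> vanish by induction; the coefficient at \<open>j = 0\<close> is a
    sign.\<close>
  have "X p (Q - int k) = 0" for p k
  proof (induction k arbitrary: p rule: less_induct)
    case (less k)
    have above: "X p (Q - int k + int j) = 0" if "j > 0" for p j
    proof (cases "j \<ge> k")
      case False
      then show ?thesis using less[of "k - j" p] that by (simp add: of_nat_diff algebra_simps)
    qed (use X0 in auto)
    have "scale ((-1) powi N) (X p (Q - int k)) = 0"
      using rec[of "p - N" "Q - int k"] above by (subst (asm) Sum_any_eq_first) auto
    then show ?case by simp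
  qed
  from this[of n "nat (Q - m)"] have "X n m = 0" if "m \<le> Q" using that by simp
  with X0 show ?thesis unfolding X_def by force
qed

text \<open>A relation of minimal length is the graph of a mode homomorphism, hence by Schur's lemma it
  comes from a linear relation between the \<open>u i\<close>.\<close>

lemma Y_independent:
  assumes "finite I" and indep: "\<And>c. (\<Sum>i\<in>I. scale (c i) (u i)) = 0 \<Longrightarrow> \<forall>i\<in>I. c i = 0"
    and rel: "\<And>n. (\<Sum>i\<in>I. Y (u i) n (w i)) = 0"
  shows "\<forall>i\<in>I. w i = 0"
  using assms
proof (induction I arbitrary: w rule: finite_induct)
  case (insert k I)
  note fin = insert.hyps(1) and k = insert.hyps(2)
  have indep_I: "\<forall>i\<in>I. c i = 0" if "(\<Sum>i\<in>I. scale (c i) (u i)) = 0" for c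
  proof -
    have "(\<Sum>i\<in>I. scale ((c(k := 0)) i) (u i)) = (\<Sum>i\<in>I. scale (c i) (u i))"
      using k by (intro sum.cong) auto
    then have "(\<Sum>i\<in>insert k I. scale ((c(k := 0)) i) (u i)) = 0"
      using that by (simp only: sum.insert[OF fin k] fun_upd_same scale_zero_left add_0)
    then have "\<forall>i\<in>insert k I. (c(k := 0)) i = 0" by (rule insert.prems(1))
    then show ?thesis using k by (metis fun_upd_other insertCI)
  qed
  define rels where "rels = {w. (\<forall>n. (\<Sum>i\<in>insert k I. Y (u i) n (w i)) = 0)}"
  have rels_unique: "\<forall>i\<in>I. w i = 0" if "w \<in> rels" "w k = 0" for w
  proof (rule insert.IH[OF indep_I])
    show "(\<Sum>i\<in>I. Y (u i) n (w i)) = 0" for n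
      using that fin k by (simp add: rels_def)
  qed
  have rels_add: "(\<lambda>i. w i + w' i) \<in> rels" if "w \<in> rels" "w' \<in> rels" for w w'
    using that by (simp add: rels_def Y_right.add sum.distrib)
  have rels_scale: "(\<lambda>i. scale c (w i)) \<in> rels" if "w \<in> rels" for c w
    using that by (simp only: rels_def Y_right.scale mem_Collect_eq flip: scale_sum_right) simp
  have rels_diff: "(\<lambda>i. w i - w' i) \<in> rels" if "w \<in> rels" "w' \<in> rels" for w w'
    using that by (simp add: rels_def Y_right.diff sum_subtractf)
  have rels_Y: "(\<lambda>i. Y a n (w i)) \<in> rels" if "w \<in> rels" for a n w
    using that relation_mode_invariant[of "insert k I" u w] fin by (simp only: rels_def mem_Collect_eq) blast
  have w: "w \<in> rels" using insert.prems(2) by (simp add: rels_def)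
  show ?case
  proof (cases "w k = 0")
    case True
    then show ?thesis using rels_unique w by simp
  next
    case False
    \<comment> \<open>The possible \<open>k\<close>-th components of relations. They form a nonzero
      mode invariant subspace, hence everything; and a relation is determined by its
      \<open>k\<close>-th component, because the induction hypothesis applies to the difference of
      two. So the other components are functions \<open>r v i\<close> of the \<open>k\<close>-th
      one.\<close>
    define P where "P = (\<lambda>w. w k) ` rels"
    have "mode_invariant P"
      unfolding mode_invariant_def
    proof (intro conjI allI ballI subspaceI)
      have "(\<lambda>i. 0) \<in> rels" by (simp add: rels_def)
      then show "0 \<in> P" by (force simp: P_def)
      show "x + y \<in> P" if "x \<in> P" "y \<in> P" for x y
        using that rels_add by (force simp: P_def)
      show "scale c x \<in> P" if "x \<in> P" for c x
        using that rels_scale by (force simp: P_def)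
      show "Y v n x \<in> P" if "x \<in> P" for v n x
        using that rels_Y by (force simp: P_def)
    qed
    moreover have "w k \<in> P" using w by (auto simp: P_def)
    ultimately have "P = UNIV" using simple_mode_invariant False by blast
    then have "\<forall>v. \<exists>w\<in>rels. w k = v" unfolding P_def by (metis UNIV_I imageE)
    then obtain r where r: "\<And>v. r v \<in> rels" "\<And>v. r v k = v" by metis
    have r_eq: "r v i = w i" if "w \<in> rels" "w k = v" "i \<in> insert k I" for v w i
      using rels_unique[OF rels_diff[OF r(1)[of v] that(1)]] r(2)[of v] that(2,3) by auto
    have "\<exists>c. \<forall>v. r v i = scale c v" if i: "i \<in> insert k I" for i
    proof (rule schur)
      have "r (x + y) i = r x i + r y i" for x y
        using r_eq[OF rels_add[OF r(1)[of x] r(1)[of y]], of "x + y" i] r i by simp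
      moreover have "r (scale c x) i = scale c (r x i)" for c x
        using r_eq[OF rels_scale[OF r(1)[of x], of c], of "scale c x" i] r i by simp
      ultimately show "Vector_Spaces.linear scale scale (\<lambda>v. r v i)"
        by (simp add: Vector_Spaces.linear_iff vector_space_axioms)
      show "r (Y a n v) i = Y a n (r v i)" for a n v
        using r_eq[OF rels_Y[OF r(1)[of v], of a n], of "Y a n v" i] r i by simp
    qed
    then obtain c where c: "\<And>i v. i \<in> insert k I \<Longrightarrow> r v i = scale (c i) v" by metis
    \<comment> \<open>The relation with components \<open>c i\<close> times the vacuum, taken at
      mode \<open>-1\<close>, is a linear relation between the \<open>u i\<close>. It forces
      \<open>c k = 0\<close>, although \<open>r v k = v\<close>.\<close>
    have "(\<Sum>i\<in>insert k I. scale (c i) (u i)) = Y (\<Sum>i\<in>insert k I. scale (c i) (u i)) (-1) vac"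
      by (simp only: creation)
    also have "\<dots> = (\<Sum>i\<in>insert k I. Y (u i) (-1) (r vac i))"
      unfolding Y_sum_left by (intro sum.cong refl) (simp only: c Y_scale_left Y_right.scale)
    also have "\<dots> = 0" using r(1)[of vac] unfolding rels_def by blast
    finally have "c k = 0" using insert.prems(1) by blast
    then have "r (w k) k = 0" using c by simp
    then show ?thesis using r(2) False by simp
  qed
qed simp

text \<open>Injectivity on \<open>V \<otimes> V\<close> in coordinates: instead of saying that the
  sum of the \<open>u i \<otimes> w i\<close> is zero, each functional is applied to the first
  factor. Expanding the \<open>u i\<close> in a basis \<open>C\<close> of their span reduces to
  independent first factors.\<close>

lemma Y_injective:
  assumes fin: "finite I" and rel: "\<And>n. (\<Sum>i\<in>I. Y (u i) n (w i)) = 0"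
    and \<xi>: "functional \<xi>"
  shows "(\<Sum>i\<in>I. scale (\<xi> (u i)) (w i)) = 0"
proof -
  interpret \<xi>: Vector_Spaces.linear scale "(*)" \<xi> by fact
  obtain C where C: "C \<subseteq> u ` I" "independent C" "u ` I \<subseteq> span C"
    by (rule maximal_independent_subset[of "u ` I"])
  have finC: "finite C" using C(1) fin finite_subset by blast
  have "\<exists>c. u i = (\<Sum>x\<in>C. scale (c x) x)" if "i \<in> I" for i
    using C(3) that finC by (auto simp: span_finite)
  then obtain c where c: "\<And>i. i \<in> I \<Longrightarrow> u i = (\<Sum>x\<in>C. scale (c i x) x)" by metis
  define w' where "w' x = (\<Sum>i\<in>I. scale (c i x) (w i))" for x
  have "(\<Sum>x\<in>C. Y x n (w' x)) = 0" for n
  proof -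
    have "(\<Sum>x\<in>C. Y x n (w' x)) = (\<Sum>i\<in>I. \<Sum>x\<in>C. Y (scale (c i x) x) n (w i))"
      unfolding w'_def Y_right.sum Y_right.scale Y_scale_left by (rule sum.swap)
    also have "\<dots> = (\<Sum>i\<in>I. Y (u i) n (w i))"
      unfolding Y_sum_left[symmetric] using c by (intro sum.cong) auto
    finally show ?thesis using rel by simp
  qed
  then have w': "\<forall>x\<in>C. w' x = 0"
    using independentD[OF C(2) finC subset_refl] by (intro Y_independent[OF finC]) auto
  have "(\<Sum>i\<in>I. scale (\<xi> (u i)) (w i)) = (\<Sum>i\<in>I. \<Sum>x\<in>C. scale (c i x * \<xi> x) (w i))"
    using c by (intro sum.cong refl) (simp add: \<xi>.sum \<xi>.scale scale_sum_left)
  also have "\<dots> = (\<Sum>x\<in>C. scale (\<xi> x) (w' x))"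
    unfolding w'_def scale_sum_right by (subst sum.swap) (simp add: mult.commute)
  also have "\<dots> = 0" using w' by simp
  finally show ?thesis .
qed

end

section \<open>Tensor products\<close>

text \<open>With \<open>f\<close> a representative of \<open>comult H h\<close>, this is the
  Sweedler sum of \<open>\<beta>(h\<^sub>1, h\<^sub>2)\<close>.\<close>

definition tensor_sum ::
  "(complex \<Rightarrow> 'w \<Rightarrow> 'w) \<Rightarrow> ('a \<Rightarrow> 'b \<Rightarrow> 'w) \<Rightarrow> ('a \<times> 'b \<Rightarrow>\<^sub>0 complex) \<Rightarrow> 'w :: ab_group_add" where
  "tensor_sum sc \<beta> f = (\<Sum>p\<in>keys f. sc (lookup f p) (\<beta> (fst p) (snd p)))"

text \<open>The subspace \<open>W\<close> allows for maps into formal sums, which are bilinear only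
  modulo the span of the relations; \<open>W = {0}\<close> is ordinary bilinearity.\<close>

definition bilinear_mod ::
  "(complex, 'a, 'm) module_scheme \<Rightarrow> (complex, 'b, 'n) module_scheme \<Rightarrow>
    (complex \<Rightarrow> 'w \<Rightarrow> 'w) \<Rightarrow> 'w set \<Rightarrow> ('a \<Rightarrow> 'b \<Rightarrow> 'w :: ab_group_add) \<Rightarrow> bool" where
  "bilinear_mod M N sc W \<beta> \<longleftrightarrow>
    (\<forall>a\<in>carrier M. \<forall>a'\<in>carrier M. \<forall>b\<in>carrier N. \<beta> (a \<oplus>\<^bsub>M\<^esub> a') b - \<beta> a b - \<beta> a' b \<in> W) \<and>
    (\<forall>a\<in>carrier M. \<forall>b\<in>carrier N. \<forall>b'\<in>carrier N. \<beta> a (b \<oplus>\<^bsub>N\<^esub> b') - \<beta> a b - \<beta> a b' \<in> W) \<and>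
    (\<forall>c. \<forall>a\<in>carrier M. \<forall>b\<in>carrier N. \<beta> (c \<odot>\<^bsub>M\<^esub> a) b - sc c (\<beta> a b) \<in> W) \<and>
    (\<forall>c. \<forall>a\<in>carrier M. \<forall>b\<in>carrier N. \<beta> a (c \<odot>\<^bsub>N\<^esub> b) - sc c (\<beta> a b) \<in> W)"

lemma free_scale_single [simp]: "free_scale c (single x d) = single x (c * d)"
  by (rule poly_mapping_eqI) (simp add: lookup_single when_def)

context complex_vector_space begin

lemma tensor_sum_superset:
  "\<lbrakk>finite A; keys f \<subseteq> A\<rbrakk> \<Longrightarrow>
    tensor_sum scale \<beta> f = (\<Sum>p\<in>A. scale (lookup f p) (\<beta> (fst p) (snd p)))"
  unfolding tensor_sum_def by (rule sum.mono_neutral_left) (auto simp: in_keys_iff)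

lemma tensor_sum_add: "tensor_sum scale \<beta> (f + g) = tensor_sum scale \<beta> f + tensor_sum scale \<beta> g"
  using keys_add[of f g]
  by (subst (1 2 3) tensor_sum_superset[of "keys f \<union> keys g"])
    (auto simp: lookup_add scale_left_distrib sum.distrib)

lemma tensor_sum_free_scale: "tensor_sum scale \<beta> (free_scale c f) = scale c (tensor_sum scale \<beta> f)"
  by (subst (1 2) tensor_sum_superset[of "keys f"])
    (auto simp: scale_sum_right in_keys_iff)

lemma tensor_sum_single [simp]: "tensor_sum scale \<beta> (single (a, b) c) = scale c (\<beta> a b)"
  by (subst tensor_sum_superset[of "{(a, b)}"]) auto

lemma tensor_sum_0 [simp]: "tensor_sum scale \<beta> 0 = 0"
  by (simp add: tensor_sum_def)

lemma tensor_sum_diff: "tensor_sum scale \<beta> (f - g) = tensor_sum scale \<beta> f - tensor_sum scale \<beta> g"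
  using tensor_sum_add[of \<beta> "f - g" g] by simp

lemma tensor_sum_sum: "tensor_sum scale \<beta> (\<Sum>i\<in>I. f i) = (\<Sum>i\<in>I. tensor_sum scale \<beta> (f i))"
  by (induction I rule: infinite_finite_induct) (auto simp: tensor_sum_add)

lemma tensor_sum_cong:
  assumes "keys f \<subseteq> A \<times> B" "\<And>a b. a \<in> A \<Longrightarrow> b \<in> B \<Longrightarrow> \<beta> a b = \<beta>' a b"
  shows "tensor_sum scale \<beta> f = tensor_sum scale \<beta>' f"
  unfolding tensor_sum_def using assms by (intro sum.cong) auto

lemma tensor_sum_bilinear_mod:
  assumes W: "subspace W" and \<beta>: "bilinear_mod M N scale W \<beta>"
    and f: "f \<in> free_vector_space.span (bilinearity_relations M N)"
  shows "tensor_sum scale \<beta> f \<in> W"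
  using f
proof (induction rule: free_vector_space.span_induct_alt)
  case base
  then show ?case using W by (simp add: subspace_0)
next
  case (step c x y)
  have "tensor_sum scale \<beta> x \<in> W"
    using step(1) \<beta> unfolding bilinearity_relations_def bilinear_mod_def
    by (auto simp: tensor_sum_diff)
  then show ?case using step W by (simp add: tensor_sum_add tensor_sum_free_scale subspace_add subspace_scale)
qed

lemma tensor_sum_bilinear:
  assumes "bilinear_mod M N scale {0} \<beta>"
    and "f - g \<in> free_vector_space.span (bilinearity_relations M N)"
  shows "tensor_sum scale \<beta> f = tensor_sum scale \<beta> g"
  using tensor_sum_bilinear_mod[OF subspace_single_0 assms] by (simp add: tensor_sum_diff)

lemma tensor_sum_compose:
  "tensor_sum scale \<gamma> (tensor_sum free_scale G f) = tensor_sum scale (\<lambda>a b. tensor_sum scale \<gamma> (G a b)) f"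
  unfolding tensor_sum_def[of free_scale] tensor_sum_sum tensor_sum_free_scale
  by (simp add: tensor_sum_def)

end

interpretation free_space: complex_vector_space "free_scale :: _ \<Rightarrow> ('x \<Rightarrow>\<^sub>0 complex) \<Rightarrow> _" ..

context
  fixes M :: "(complex, 'a, 'm) module_scheme" and N :: "(complex, 'b, 'n) module_scheme"
begin

abbreviation "rel_span \<equiv> free_vector_space.span (bilinearity_relations M N)"

lemma formal_sums_0: "0 \<in> formal_sums M N"
  and formal_sums_add: "\<lbrakk>f \<in> formal_sums M N; g \<in> formal_sums M N\<rbrakk> \<Longrightarrow> f + g \<in> formal_sums M N"
  and formal_sums_scale: "f \<in> formal_sums M N \<Longrightarrow> free_scale c f \<in> formal_sums M N"
  and formal_sums_single: "\<lbrakk>a \<in> carrier M; b \<in> carrier N\<rbrakk> \<Longrightarrow> single (a, b) c \<in> formal_sums M N"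
  using keys_add[of f g] by (auto simp: formal_sums_def in_keys_iff)

lemma formal_sums_sum: "(\<And>i. i \<in> I \<Longrightarrow> f i \<in> formal_sums M N) \<Longrightarrow> (\<Sum>i\<in>I. f i) \<in> formal_sums M N"
  by (induction I rule: infinite_finite_induct) (auto simp: formal_sums_0 formal_sums_add)

lemma formal_sums_tensor_sum:
  assumes "keys f \<subseteq> A \<times> B" "\<And>a b. a \<in> A \<Longrightarrow> b \<in> B \<Longrightarrow> G a b \<in> formal_sums M N"
  shows "tensor_sum free_scale G f \<in> formal_sums M N"
  unfolding tensor_sum_def using assms by (intro formal_sums_sum formal_sums_scale) auto

lemma mem_tensor_class: "f \<in> formal_sums M N \<Longrightarrow> f \<in> tensor_class M N f"
  by (simp add: tensor_class_def free_vector_space.span_zero)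

lemma tensor_class_eq: "f - g \<in> rel_span \<Longrightarrow> tensor_class M N f = tensor_class M N g"
  unfolding tensor_class_def
proof (intro Collect_cong conj_cong refl)
  fix h assume fg: "f - g \<in> rel_span"
  have "h - g = (h - f) + (f - g)" "h - f = (h - g) - (f - g)" by simp_all
  then show "h - f \<in> rel_span \<longleftrightarrow> h - g \<in> rel_span"
    using fg free_vector_space.span_add free_vector_space.span_diff by metis
qed

lemma tensor_class_mem:
  assumes "g \<in> tensor_class M N f"
  shows "g - f \<in> rel_span" "g \<in> formal_sums M N" "tensor_class M N g = tensor_class M N f"
  using assms tensor_class_eq[of g f] by (auto simp: tensor_class_def)

lemma tensor_product_carrier [simp]: "carrier (tensor_product M N) = tensor_class M N ` formal_sums M N"
  and tensor_product_zero: "\<zero>\<^bsub>tensor_product M N\<^esub> = tensor_class M N 0"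
  by (simp_all add: tensor_product_def)

lemma tensor_product_add:
  assumes "f \<in> formal_sums M N" "g \<in> formal_sums M N"
  shows "tensor_class M N f \<oplus>\<^bsub>tensor_product M N\<^esub> tensor_class M N g = tensor_class M N (f + g)"
proof -
  have "tensor_class M N (f' + g') = tensor_class M N (f + g)"
    if "f' \<in> tensor_class M N f" "g' \<in> tensor_class M N g" for f' g'
  proof (rule tensor_class_eq)
    have "(f' - f) + (g' - g) \<in> rel_span"
      using that by (intro free_vector_space.span_add tensor_class_mem)
    then show "f' + g' - (f + g) \<in> rel_span" by (simp add: algebra_simps)
  qed
  then have "tensor_class M N f \<oplus>\<^bsub>tensor_product M N\<^esub> tensor_class M N g =
    (\<Union>f'\<in>tensor_class M N f. \<Union>g'\<in>tensor_class M N g. tensor_class M N (f + g))"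
    unfolding tensor_product_def by (simp cong: SUP_cong_simp)
  then show ?thesis
    using mem_tensor_class[OF assms(1)] mem_tensor_class[OF assms(2)] by (metis SUP_const empty_iff)
qed

lemma tensor_product_smult:
  assumes "f \<in> formal_sums M N"
  shows "c \<odot>\<^bsub>tensor_product M N\<^esub> tensor_class M N f = tensor_class M N (free_scale c f)"
proof -
  have "tensor_class M N (free_scale c f') = tensor_class M N (free_scale c f)"
    if "f' \<in> tensor_class M N f" for f'
    using free_vector_space.span_scale[OF tensor_class_mem(1)[OF that], of c]
    by (intro tensor_class_eq) (simp add: free_vector_space.scale_right_diff_distrib)
  then have "c \<odot>\<^bsub>tensor_product M N\<^esub> tensor_class M N f =
    (\<Union>f'\<in>tensor_class M N f. tensor_class M N (free_scale c f))"
    unfolding tensor_product_def by (simp cong: SUP_cong_simp)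
  then show ?thesis using mem_tensor_class[OF assms] by (metis SUP_const empty_iff)
qed

lemma abelian_group_tensor_product: "abelian_group (tensor_product M N)"
proof (rule abelian_groupI)
  fix x y z
  assume "x \<in> carrier (tensor_product M N)" "y \<in> carrier (tensor_product M N)" "z \<in> carrier (tensor_product M N)"
  then obtain f g h where "f \<in> formal_sums M N" "x = tensor_class M N f" "g \<in> formal_sums M N" "y = tensor_class M N g"
    "h \<in> formal_sums M N" "z = tensor_class M N h"
    by auto
  then show "x \<oplus>\<^bsub>tensor_product M N\<^esub> y \<oplus>\<^bsub>tensor_product M N\<^esub> z =
    x \<oplus>\<^bsub>tensor_product M N\<^esub> (y \<oplus>\<^bsub>tensor_product M N\<^esub> z)"
    by (simp add: tensor_product_add formal_sums_add add.assoc)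
next
  fix x assume "x \<in> carrier (tensor_product M N)"
  then obtain f where f: "f \<in> formal_sums M N" "x = tensor_class M N f" by auto
  have "tensor_class M N (free_scale (-1) f) \<oplus>\<^bsub>tensor_product M N\<^esub> x = \<zero>\<^bsub>tensor_product M N\<^esub>"
    using f formal_sums_scale[OF f(1), of "-1"] by (simp add: tensor_product_add tensor_product_zero)
  then show "\<exists>y\<in>carrier (tensor_product M N). y \<oplus>\<^bsub>tensor_product M N\<^esub> x = \<zero>\<^bsub>tensor_product M N\<^esub>"
    using formal_sums_scale[OF f(1)] by (metis imageI tensor_product_carrier)
qed (auto simp: tensor_product_add tensor_product_zero formal_sums_add formal_sums_0 add.commute)

lemma finsum_tensor_product:
  assumes "finite A" "\<And>p. p \<in> A \<Longrightarrow> F p \<in> formal_sums M N"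
  shows "(\<Oplus>\<^bsub>tensor_product M N\<^esub>p\<in>A. tensor_class M N (F p)) = tensor_class M N (\<Sum>p\<in>A. F p)"
  using assms
proof (induction rule: finite_induct)
  case empty
  interpret abelian_group "tensor_product M N" by (rule abelian_group_tensor_product)
  show ?case by (simp add: tensor_product_zero)
next
  case (insert p A)
  interpret abelian_group "tensor_product M N" by (rule abelian_group_tensor_product)
  show ?case using insert
    by (subst finsum_insert) (auto simp: tensor_product_add formal_sums_sum)
qed

lemma some_rep:
  assumes "t \<in> carrier (tensor_product M N)"
  shows "(SOME f. f \<in> t) \<in> t" "(SOME f. f \<in> t) \<in> formal_sums M N" "tensor_class M N (SOME f. f \<in> t) = t"
proof -
  obtain f where f: "f \<in> formal_sums M N" "t = tensor_class M N f" using assms by auto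
  then show mem: "(SOME f. f \<in> t) \<in> t" using mem_tensor_class by (metis someI_ex)
  then show "(SOME f. f \<in> t) \<in> formal_sums M N" "tensor_class M N (SOME f. f \<in> t) = t"
    using f tensor_class_mem by auto
qed

lemma tensor_class_of_mem: "\<lbrakk>t \<in> carrier (tensor_product M N); f \<in> t\<rbrakk> \<Longrightarrow> tensor_class M N f = t \<and> f \<in> formal_sums M N"
  using tensor_class_mem by auto

lemma mem_rep_diff: "\<lbrakk>t \<in> carrier (tensor_product M N); f \<in> t; g \<in> t\<rbrakk> \<Longrightarrow> f - g \<in> rel_span"
  using mem_tensor_class tensor_class_mem by (metis tensor_class_of_mem)

lemma tensor_in_carrier: "\<lbrakk>a \<in> carrier M; b \<in> carrier N\<rbrakk> \<Longrightarrow> tensor M N a b \<in> carrier (tensor_product M N)"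
  by (simp add: tensor_def formal_sums_single)

lemma single_bilinear:
  "bilinear_mod M N free_scale rel_span (\<lambda>a b. single (a, b) 1)"
  unfolding bilinear_mod_def free_scale_single mult_1_right bilinearity_relations_def
  by (intro conjI ballI allI free_vector_space.span_base) blast+

end

text \<open>\<open>tensor_lift\<close> is followed on the very representative that it chooses, so
  arbitrary formal sums \<open>G a b\<close> representing the values of \<open>\<phi>\<close> give a
  representative of the result.\<close>

lemma tensor_lift_class:
  assumes t: "keys (SOME f. f \<in> t) \<subseteq> A \<times> B"
    and \<phi>: "\<And>a b. a \<in> A \<Longrightarrow> b \<in> B \<Longrightarrow> \<phi> a b = tensor_class M N (G a b)"
    and G: "\<And>a b. a \<in> A \<Longrightarrow> b \<in> B \<Longrightarrow> G a b \<in> formal_sums M N"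
  shows "tensor_lift (tensor_product M N) \<phi> t = tensor_class M N (tensor_sum free_scale G (SOME f. f \<in> t))"
proof -
  interpret P: abelian_group "tensor_product M N" by (rule abelian_group_tensor_product)
  let ?f = "SOME f. f \<in> t"
  have "tensor_lift (tensor_product M N) \<phi> t =
    (\<Oplus>\<^bsub>tensor_product M N\<^esub>p\<in>keys ?f. tensor_class M N (free_scale (lookup ?f p) (G (fst p) (snd p))))"
    unfolding tensor_lift_def Let_def using t \<phi> G
    by (intro P.finsum_cong') (auto simp: tensor_product_smult formal_sums_scale)
  also have "\<dots> = tensor_class M N (tensor_sum free_scale G ?f)"
    unfolding tensor_sum_def using t G by (intro finsum_tensor_product formal_sums_scale) auto
  finally show ?thesis .
qed

lemma formal_sums_keys: "f \<in> formal_sums M N \<Longrightarrow> keys f \<subseteq> carrier M \<times> carrier N"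
  by (simp add: formal_sums_def)

lemma tensor_map_eq:
  assumes t: "t \<in> carrier (tensor_product M N)"
    and "\<And>a. a \<in> carrier M \<Longrightarrow> \<phi> a \<in> carrier M'" "\<And>b. b \<in> carrier N \<Longrightarrow> \<psi> b \<in> carrier N'"
  shows "tensor_map M' N' \<phi> \<psi> t =
    tensor_class M' N' (tensor_sum free_scale (\<lambda>a b. single (\<phi> a, \<psi> b) 1) (SOME f. f \<in> t))"
  unfolding tensor_map_def
  using assms formal_sums_keys[OF some_rep(2)[OF t]]
  by (intro tensor_lift_class) (auto simp: tensor_def formal_sums_single)

lemma linear_maps_bilinear_single:
  assumes "\<phi> \<in> linear_maps M M'" "\<psi> \<in> linear_maps N N'"
  shows "bilinear_mod M N free_scale (rel_span M' N') (\<lambda>a b. single (\<phi> a, \<psi> b) 1)"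
  using assms single_bilinear[of M' N'] unfolding bilinear_mod_def linear_maps_def Pi_iff
  by simp

lemma tensor_map_eq_rep:
  assumes t: "t \<in> carrier (tensor_product M N)" and f: "f \<in> t"
    and "\<phi> \<in> linear_maps M M'" "\<psi> \<in> linear_maps N N'"
  shows "tensor_map M' N' \<phi> \<psi> t =
    tensor_class M' N' (tensor_sum free_scale (\<lambda>a b. single (\<phi> a, \<psi> b) 1) f)"
proof -
  have "tensor_sum free_scale (\<lambda>a b. single (\<phi> a, \<psi> b) 1) ((SOME f. f \<in> t) - f) \<in> rel_span M' N'"
    by (intro free_space.tensor_sum_bilinear_mod[where M = M and N = N] free_vector_space.subspace_span
        linear_maps_bilinear_single assms mem_rep_diff[OF t] some_rep[OF t])
  then have "tensor_class M' N' (tensor_sum free_scale (\<lambda>a b. single (\<phi> a, \<psi> b) 1) (SOME f. f \<in> t)) =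
    tensor_class M' N' (tensor_sum free_scale (\<lambda>a b. single (\<phi> a, \<psi> b) 1) f)"
    by (intro tensor_class_eq) (simp only: free_space.tensor_sum_diff)
  moreover have "\<phi> a \<in> carrier M'" "\<psi> b \<in> carrier N'" if "a \<in> carrier M" "b \<in> carrier N" for a b
    using assms(3,4) that by (auto simp: linear_maps_def)
  ultimately show ?thesis using assms(3,4) by (subst tensor_map_eq[OF t]) (auto simp: linear_maps_def)
qed

section \<open>Evaluating tensors in ordinary vector spaces\<close>

context complex_vector_space begin

definition tensor_eval :: "('x \<Rightarrow> 'y \<Rightarrow> 'b) \<Rightarrow> ('x \<times> 'y \<Rightarrow>\<^sub>0 complex) set \<Rightarrow> 'b" where
  "tensor_eval \<beta> t = tensor_sum scale \<beta> (SOME f. f \<in> t)"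

lemma tensor_eval_rep:
  assumes "bilinear_mod M N scale {0} \<beta>" "t \<in> carrier (tensor_product M N)" "f \<in> t"
  shows "tensor_eval \<beta> t = tensor_sum scale \<beta> f"
  unfolding tensor_eval_def
  using assms some_rep(1)[OF assms(2)] by (intro tensor_sum_bilinear[OF assms(1)] mem_rep_diff[of t])

lemma tensor_eval_class:
  assumes "bilinear_mod M N scale {0} \<beta>" "f \<in> formal_sums M N"
  shows "tensor_eval \<beta> (tensor_class M N f) = tensor_sum scale \<beta> f"
  using assms mem_tensor_class[OF assms(2)] by (intro tensor_eval_rep) auto

lemma tensor_eval_add:
  assumes "bilinear_mod M N scale {0} \<beta>" "s \<in> carrier (tensor_product M N)" "t \<in> carrier (tensor_product M N)"
  shows "tensor_eval \<beta> (s \<oplus>\<^bsub>tensor_product M N\<^esub> t) = tensor_eval \<beta> s + tensor_eval \<beta> t"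
  using assms by (auto simp: tensor_product_add tensor_eval_class formal_sums_add tensor_sum_add)

lemma tensor_eval_smult:
  assumes "bilinear_mod M N scale {0} \<beta>" "s \<in> carrier (tensor_product M N)"
  shows "tensor_eval \<beta> (c \<odot>\<^bsub>tensor_product M N\<^esub> s) = scale c (tensor_eval \<beta> s)"
  using assms by (auto simp: tensor_product_smult tensor_eval_class formal_sums_scale tensor_sum_free_scale)

lemma hom_finsum:
  fixes \<Lambda> :: "'p \<Rightarrow> 'b"
  assumes P: "abelian_group P"
    and add: "\<And>x y. x \<in> carrier P \<Longrightarrow> y \<in> carrier P \<Longrightarrow> \<Lambda> (x \<oplus>\<^bsub>P\<^esub> y) = \<Lambda> x + \<Lambda> y"
    and F: "\<And>i. i \<in> I \<Longrightarrow> F i \<in> carrier P"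
  shows "\<Lambda> (\<Oplus>\<^bsub>P\<^esub>i\<in>I. F i) = (\<Sum>i\<in>I. \<Lambda> (F i))"
proof -
  interpret P: abelian_group P by fact
  have "\<Lambda> \<zero>\<^bsub>P\<^esub> = 0"
    using add[of "\<zero>\<^bsub>P\<^esub>" "\<zero>\<^bsub>P\<^esub>"] unfolding P.l_zero[OF P.zero_closed] by simp
  with F show ?thesis
  proof (induction I rule: infinite_finite_induct)
    case (insert i I)
    then have "F \<in> I \<rightarrow> carrier P" "F i \<in> carrier P" by auto
    then show ?case
      using insert.IH insert.prems insert.hyps add[of "F i" "\<Oplus>\<^bsub>P\<^esub>i\<in>I. F i"] P.finsum_closed[of F I]
      by (simp only: P.finsum_insert sum.insert insert_iff simp_thms)
  qed (simp_all add: P.finsum_infinite)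
qed

text \<open>Carries the counit and antipode axioms, which are finite sums inside \<open>H\<close>,
  over to sums of operators, vectors or scalars. It also replaces the representative chosen by
  \<open>tensor_lift\<close> by any other one.\<close>

lemma hom_tensor_lift:
  assumes P: "Module.module complex_field P"
    and add: "\<And>x y. x \<in> carrier P \<Longrightarrow> y \<in> carrier P \<Longrightarrow> \<Lambda> (x \<oplus>\<^bsub>P\<^esub> y) = \<Lambda> x + \<Lambda> y"
    and smult: "\<And>c x. x \<in> carrier P \<Longrightarrow> \<Lambda> (c \<odot>\<^bsub>P\<^esub> x) = scale c (\<Lambda> x)"
    and t: "t \<in> carrier (tensor_product M N)" "f \<in> t"
    and \<phi>: "\<And>a b. a \<in> carrier M \<Longrightarrow> b \<in> carrier N \<Longrightarrow> \<phi> a b \<in> carrier P"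
    and bil: "bilinear_mod M N scale {0} (\<lambda>a b. \<Lambda> (\<phi> a b))"
  shows "\<Lambda> (tensor_lift P \<phi> t) = tensor_sum scale (\<lambda>a b. \<Lambda> (\<phi> a b)) f"
proof -
  interpret P: Module.module complex_field P by fact
  let ?f = "SOME f. f \<in> t"
  have k: "keys ?f \<subseteq> carrier M \<times> carrier N"
    by (rule formal_sums_keys[OF some_rep(2)[OF t(1)]])
  have "\<Lambda> (tensor_lift P \<phi> t) = (\<Sum>p\<in>keys ?f. \<Lambda> (lookup ?f p \<odot>\<^bsub>P\<^esub> \<phi> (fst p) (snd p)))"
    unfolding tensor_lift_def Let_def using k \<phi>
    by (intro hom_finsum add P.abelian_group_axioms) (auto simp: complex_field_def intro!: P.smult_closed)
  also have "\<dots> = tensor_eval (\<lambda>a b. \<Lambda> (\<phi> a b)) t"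
    unfolding tensor_eval_def tensor_sum_def using k \<phi> by (intro sum.cong refl smult) auto
  also have "\<dots> = tensor_sum scale (\<lambda>a b. \<Lambda> (\<phi> a b)) f"
    by (rule tensor_eval_rep[OF bil t])
  finally show ?thesis .
qed

end

lemma bilinear_mod_0I:
  assumes "\<And>a a' b. \<lbrakk>a \<in> carrier M; a' \<in> carrier M; b \<in> carrier N\<rbrakk> \<Longrightarrow> \<beta> (a \<oplus>\<^bsub>M\<^esub> a') b = \<beta> a b + \<beta> a' b"
    and "\<And>a b b'. \<lbrakk>a \<in> carrier M; b \<in> carrier N; b' \<in> carrier N\<rbrakk> \<Longrightarrow> \<beta> a (b \<oplus>\<^bsub>N\<^esub> b') = \<beta> a b + \<beta> a b'"
    and "\<And>c a b. \<lbrakk>a \<in> carrier M; b \<in> carrier N\<rbrakk> \<Longrightarrow> \<beta> (c \<odot>\<^bsub>M\<^esub> a) b = sc c (\<beta> a b)"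
    and "\<And>c a b. \<lbrakk>a \<in> carrier M; b \<in> carrier N\<rbrakk> \<Longrightarrow> \<beta> a (c \<odot>\<^bsub>N\<^esub> b) = sc c (\<beta> a b)"
  shows "bilinear_mod M N sc {0} \<beta>"
  using assms by (auto simp: bilinear_mod_def)

lemma bilinear_mod_0D:
  assumes "bilinear_mod M N sc {0} \<beta>" "a \<in> carrier M" "b \<in> carrier N"
  shows "a' \<in> carrier M \<Longrightarrow> \<beta> (a \<oplus>\<^bsub>M\<^esub> a') b = \<beta> a b + \<beta> a' b"
    and "b' \<in> carrier N \<Longrightarrow> \<beta> a (b \<oplus>\<^bsub>N\<^esub> b') = \<beta> a b + \<beta> a b'"
    and "\<beta> (c \<odot>\<^bsub>M\<^esub> a) b = sc c (\<beta> a b)" and "\<beta> a (c \<odot>\<^bsub>N\<^esub> b) = sc c (\<beta> a b)"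
  using assms by (auto simp: bilinear_mod_def algebra_simps)

lemma bilinear_mod_flip: "bilinear_mod N M sc W (\<lambda>b a. \<beta> a b) \<Longrightarrow> bilinear_mod M N sc W \<beta>"
  by (auto simp: bilinear_mod_def)

lemma (in complex_vector_space) bilinear_tensor_eval:
  assumes \<theta>: "\<And>z. z \<in> carrier L \<Longrightarrow> bilinear_mod M N scale {0} (\<theta> z)"
    and closed: "\<And>z z'. z \<in> carrier L \<Longrightarrow> z' \<in> carrier L \<Longrightarrow> z \<oplus>\<^bsub>L\<^esub> z' \<in> carrier L"
      "\<And>c z. z \<in> carrier L \<Longrightarrow> c \<odot>\<^bsub>L\<^esub> z \<in> carrier L"
    and add: "\<And>z z' a b. \<lbrakk>z \<in> carrier L; z' \<in> carrier L; a \<in> carrier M; b \<in> carrier N\<rbrakk> \<Longrightarrow>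
      \<theta> (z \<oplus>\<^bsub>L\<^esub> z') a b = \<theta> z a b + \<theta> z' a b"
    and smult: "\<And>c z a b. \<lbrakk>z \<in> carrier L; a \<in> carrier M; b \<in> carrier N\<rbrakk> \<Longrightarrow>
      \<theta> (c \<odot>\<^bsub>L\<^esub> z) a b = scale c (\<theta> z a b)"
  shows "bilinear_mod L (tensor_product M N) scale {0} (\<lambda>z. tensor_eval (\<theta> z))"
proof (rule bilinear_mod_0I)
  fix z z' t assume z: "z \<in> carrier L" "z' \<in> carrier L" and "t \<in> carrier (tensor_product M N)"
  then obtain f where f: "f \<in> formal_sums M N" "t = tensor_class M N f" by auto
  have "tensor_sum scale (\<theta> (z \<oplus>\<^bsub>L\<^esub> z')) f = tensor_sum scale (\<lambda>a b. \<theta> z a b + \<theta> z' a b) f"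
    using add z by (intro tensor_sum_cong[OF formal_sums_keys[OF f(1)]])
  then show "tensor_eval (\<theta> (z \<oplus>\<^bsub>L\<^esub> z')) t = tensor_eval (\<theta> z) t + tensor_eval (\<theta> z') t"
    using z f closed by (simp add: tensor_eval_class[OF \<theta>] tensor_sum_def scale_right_distrib sum.distrib)
next
  fix c z t assume z: "z \<in> carrier L" and "t \<in> carrier (tensor_product M N)"
  then obtain f where f: "f \<in> formal_sums M N" "t = tensor_class M N f" by auto
  have "tensor_sum scale (\<theta> (c \<odot>\<^bsub>L\<^esub> z)) f = tensor_sum scale (\<lambda>a b. scale c (\<theta> z a b)) f"
    using smult z by (intro tensor_sum_cong[OF formal_sums_keys[OF f(1)]])
  then show "tensor_eval (\<theta> (c \<odot>\<^bsub>L\<^esub> z)) t = scale c (tensor_eval (\<theta> z) t)"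
    using z f closed by (simp add: tensor_eval_class[OF \<theta>] tensor_sum_def scale_sum_right mult.commute)
qed (auto simp: tensor_eval_add[OF \<theta>] tensor_eval_smult[OF \<theta>] simp del: tensor_product_carrier)

context hopf_algebra begin

lemma comult_closed: "h \<in> carrier H \<Longrightarrow> comult H h \<in> carrier (tensor_product H H)"
  using comult_linear by (auto simp: linear_maps_def)

definition comult_rep :: "'h \<Rightarrow> ('h \<times> 'h \<Rightarrow>\<^sub>0 complex)" where
  "comult_rep h = (SOME f. f \<in> comult H h)"

lemma comult_rep:
  assumes "h \<in> carrier H"
  shows "comult_rep h \<in> comult H h" "comult_rep h \<in> formal_sums H H"
    "keys (comult_rep h) \<subseteq> carrier H \<times> carrier H"
    "tensor_class H H (comult_rep h) = comult H h"
  using some_rep[OF comult_closed[OF assms]] formal_sums_keys[OF some_rep(2)[OF comult_closed[OF assms]]]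
  unfolding comult_rep_def by simp_all

end

text \<open>Coassociativity in Sweedler form: a map that is linear in each argument factors through
  \<open>H \<otimes> (H \<otimes> H)\<close>, where the coassociativity axiom can be
  evaluated.\<close>

lemma (in complex_vector_space) coassoc_trilinear:
  fixes H :: "('h, 'm) hopf_scheme" (structure)
  assumes H: "hopf_algebra H" and h: "h \<in> carrier H"
    and \<theta>12: "\<And>c. c \<in> carrier H \<Longrightarrow> bilinear_mod H H scale {0} (\<lambda>a b. \<theta> a b c)"
    and \<theta>23: "\<And>a. a \<in> carrier H \<Longrightarrow> bilinear_mod H H scale {0} (\<lambda>b c. \<theta> a b c)"
  shows "tensor_sum scale (\<lambda>x c. tensor_sum scale (\<lambda>a b. \<theta> a b c) (hopf_algebra.comult_rep H x)) (hopf_algebra.comult_rep H h) =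
    tensor_sum scale (\<lambda>a y. tensor_sum scale (\<lambda>b c. \<theta> a b c) (hopf_algebra.comult_rep H y)) (hopf_algebra.comult_rep H h)"
proof -
  interpret H: hopf_algebra H by fact
  let ?HH = "tensor_product H H" and ?P = "tensor_product H (tensor_product H H)"
  let ?F = "H.comult_rep h"
  note F = H.comult_rep[OF h]
  define \<Theta> where "\<Theta> a t = tensor_eval (\<theta> a) t" for a t
  have \<theta>1: "\<theta> (a \<oplus> a') b c = \<theta> a b c + \<theta> a' b c" "\<theta> (k \<odot> a) b c = scale k (\<theta> a b c)"
    if "a \<in> carrier H" "a' \<in> carrier H" "b \<in> carrier H" "c \<in> carrier H" for a a' b c k
    using bilinear_mod_0D[OF \<theta>12] that by auto
  have \<theta>3: "\<theta> a b (c \<oplus> c') = \<theta> a b c + \<theta> a b c'" "\<theta> a b (k \<odot> c) = scale k (\<theta> a b c)"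
    if "a \<in> carrier H" "c' \<in> carrier H" "b \<in> carrier H" "c \<in> carrier H" for a b c c' k
    using bilinear_mod_0D[OF \<theta>23] that by auto
  have \<Theta>_class: "\<Theta> a (tensor_class H H f) = tensor_sum scale (\<theta> a) f" if "a \<in> carrier H" "f \<in> formal_sums H H" for a f
    unfolding \<Theta>_def by (rule tensor_eval_class[OF \<theta>23[OF that(1)] that(2)])
  have bil\<Theta>: "bilinear_mod H ?HH scale {0} \<Theta>"
    unfolding \<Theta>_def using \<theta>1
    by (intro bilinear_tensor_eval[OF \<theta>23]) (auto simp: complex_field_def H.smult_closed)
  define \<Xi> where "\<Xi> t c = tensor_eval (\<lambda>a b. \<theta> a b c) t" for t c
  have bil\<Xi>: "bilinear_mod ?HH H scale {0} \<Xi>"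
    unfolding \<Xi>_def using \<theta>3
    by (intro bilinear_mod_flip[OF bilinear_tensor_eval[OF \<theta>12]]) (auto simp: complex_field_def H.smult_closed)
  let ?t = "tensor_map ?HH H (comult H) (\<lambda>a. a) (comult H h)"
  define g0 where "g0 = tensor_sum free_scale (\<lambda>a b. single (comult H a, b) 1) ?F"
  have g0: "g0 \<in> formal_sums ?HH H"
    unfolding g0_def using H.comult_closed
    by (intro formal_sums_tensor_sum[OF F(3)] formal_sums_single) auto
  have t: "?t = tensor_class ?HH H g0"
    unfolding g0_def H.comult_rep_def using H.comult_closed h by (intro tensor_map_eq) auto
  then have t_carr: "?t \<in> carrier (tensor_product ?HH H)" using g0 by simp
  define g where "g = (SOME f. f \<in> ?t)"
  note g = some_rep[OF t_carr, folded g_def]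
  note g_keys = formal_sums_keys[OF g(2)]
  \<comment> \<open>A formal sum representing the inner lift of \<open>tensor_assoc\<close>; it uses
    the same chosen representative of \<open>s\<close>.\<close>
  define G where "G s c = tensor_sum free_scale (\<lambda>(a :: 'h) b. single (a, tensor H H b c) 1) (SOME f. f \<in> s)" for s c
  have G: "G s c \<in> formal_sums H ?HH" if "s \<in> carrier ?HH" "c \<in> carrier H" for s c
    unfolding G_def using that
    by (intro formal_sums_tensor_sum[OF formal_sums_keys[OF some_rep(2)[OF that(1)]]] formal_sums_single tensor_in_carrier)
  have lift: "tensor_lift ?P (\<lambda>a b. tensor H ?HH a (tensor H H b c)) s = tensor_class H ?HH (G s c)"
    if "s \<in> carrier ?HH" "c \<in> carrier H" for s c
    unfolding G_def
    by (intro tensor_lift_class[OF formal_sums_keys[OF some_rep(2)[OF that(1)]]])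
      (use that in \<open>auto simp: tensor_def[of H "tensor_product H H"] intro!: formal_sums_single tensor_in_carrier simp del: tensor_product_carrier\<close>)
  have "tensor_assoc H H H ?t = tensor_class H ?HH (tensor_sum free_scale G g)"
    unfolding tensor_assoc_def Let_def g_def
    by (intro tensor_lift_class[OF formal_sums_keys[OF some_rep(2)[OF t_carr]]] lift G)
  moreover have Gg: "tensor_sum free_scale G g \<in> formal_sums H ?HH"
    by (intro formal_sums_tensor_sum[OF g_keys] G)
  ultimately have "tensor_eval \<Theta> (tensor_assoc H H H ?t) = tensor_sum scale (\<lambda>s c. tensor_sum scale \<Theta> (G s c)) g"
    using tensor_eval_class[OF bil\<Theta>] tensor_sum_compose by simp
  also have "\<dots> = tensor_sum scale \<Xi> g"
  proof (rule tensor_sum_cong[OF g_keys])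
    fix s c assume s: "s \<in> carrier ?HH" and c: "c \<in> carrier H"
    let ?f = "SOME f. f \<in> s"
    note f = some_rep[OF s]
    have "tensor_sum scale \<Theta> (G s c) = tensor_sum scale (\<lambda>a b. \<Theta> a (tensor H H b c)) ?f"
      unfolding G_def tensor_sum_compose by simp
    also have "\<dots> = tensor_sum scale (\<lambda>a b. \<theta> a b c) ?f"
      using c by (intro tensor_sum_cong[OF formal_sums_keys[OF f(2)]]) (simp add: tensor_def \<Theta>_class formal_sums_single)
    finally show "tensor_sum scale \<Theta> (G s c) = \<Xi> s c" by (simp add: \<Xi>_def tensor_eval_def)
  qed
  \<comment> \<open>The representative chosen by \<open>tensor_assoc\<close> may be exchanged for
    the explicit one, because \<open>\<Xi>\<close> is bilinear on
    \<open>(H \<otimes> H) \<times> H\<close>.\<close>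
  also have "\<dots> = tensor_sum scale \<Xi> g0"
    using g(1) unfolding t by (intro tensor_sum_bilinear[OF bil\<Xi>] tensor_class_mem)
  also have "\<dots> = tensor_sum scale (\<lambda>x c. \<Xi> (comult H x) c) ?F"
    unfolding g0_def tensor_sum_compose by simp
  also have "\<dots> = tensor_sum scale (\<lambda>x c. tensor_sum scale (\<lambda>a b. \<theta> a b c) (H.comult_rep x)) ?F"
    by (intro tensor_sum_cong[OF F(3)]) (simp add: \<Xi>_def tensor_eval_def H.comult_rep_def)
  finally have L: "tensor_eval \<Theta> (tensor_assoc H H H ?t) =
    tensor_sum scale (\<lambda>x c. tensor_sum scale (\<lambda>a b. \<theta> a b c) (H.comult_rep x)) ?F" .

  define r where "r = tensor_sum free_scale (\<lambda>a b. single (a, comult H b) 1) ?F"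
  have r: "r \<in> formal_sums H ?HH"
    unfolding r_def using H.comult_closed
    by (intro formal_sums_tensor_sum[OF F(3)] formal_sums_single) auto
  have "tensor_map H ?HH (\<lambda>a. a) (comult H) (comult H h) = tensor_class H ?HH r"
    unfolding r_def H.comult_rep_def using H.comult_closed h by (intro tensor_map_eq) auto
  then have "tensor_eval \<Theta> (tensor_map H ?HH (\<lambda>a. a) (comult H) (comult H h)) = tensor_sum scale (\<lambda>a y. \<Theta> a (comult H y)) ?F"
    using tensor_eval_class[OF bil\<Theta> r] unfolding r_def tensor_sum_compose by simp
  also have "\<dots> = tensor_sum scale (\<lambda>a y. tensor_sum scale (\<lambda>b c. \<theta> a b c) (H.comult_rep y)) ?F"
    by (intro tensor_sum_cong[OF F(3)]) (simp add: \<Theta>_def tensor_eval_def H.comult_rep_def)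
  finally show ?thesis using L H.coassoc[OF h] by simp
qed

section \<open>Hopf algebra actions on simple vertex operator algebras\<close>

lemma sum_fun_apply: "(\<Sum>i\<in>I. F i) x = (\<Sum>i\<in>I. F i x)" for F :: "_ \<Rightarrow> _ \<Rightarrow> _ :: ab_group_add"
  by (induction I rule: infinite_finite_induct) auto

interpretation complex_plane: complex_vector_space "(*)"
  by (intro complex_vector_space.intro vector_space_mult)

text \<open>Over the scalars themselves \<open>scale_scale\<close> undoes \<open>mult.assoc\<close>, so that simplification loops.\<close>

declare complex_plane.scale_scale [simp del]

locale simple_hopf_module_voa =
  hopf_module_voa H scale act Y vac \<omega> V + simple_voa scale Y vac \<omega> V
  for H :: "('h, 'm) hopf_scheme" (structure)
    and scale :: "complex \<Rightarrow> 'v :: ab_group_add \<Rightarrow> 'v" and act Y vac \<omega> V +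
  assumes finite_dim: "finite_dimensional H"
begin

definition op_scale :: "complex \<Rightarrow> ('v \<Rightarrow> 'v) \<Rightarrow> 'v \<Rightarrow> 'v" where
  "op_scale c F = (\<lambda>v. scale c (F v))"

lemma op_scale_apply [simp]: "op_scale c F v = scale c (F v)"
  by (simp add: op_scale_def)

sublocale ops: complex_vector_space op_scale
  by unfold_locales (auto simp: op_scale_def scale_right_distrib scale_left_distrib)

definition B :: "('v \<Rightarrow> 'v) set" where "B = act ` carrier H"

abbreviation "dual \<equiv> functionals_on op_scale B"

lemma act_in_B: "h \<in> carrier H \<Longrightarrow> act h \<in> B" by (simp add: B_def)

lemma H_abelian_group: "abelian_group H" ..

lemma H_smult_closed [simp]: "h \<in> carrier H \<Longrightarrow> c \<odot> h \<in> carrier H"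
  by (auto simp: complex_field_def intro!: A.smult_closed)

lemma act_add': "\<lbrakk>h \<in> carrier H; k \<in> carrier H\<rbrakk> \<Longrightarrow> act (h \<oplus> k) = act h + act k"
  and act_smult': "h \<in> carrier H \<Longrightarrow> act (c \<odot> h) = op_scale c (act h)"
  and act_mult': "\<lbrakk>h \<in> carrier H; k \<in> carrier H\<rbrakk> \<Longrightarrow> act (h \<otimes> k) = act h \<circ> act k"
  and act_one': "act \<one> = id"
  by (auto simp: fun_eq_iff act_add act_smult act_mult act_one)

lemma act_hom: "h \<in> carrier H \<Longrightarrow> act h (u + v) = act h u + act h v"
  "h \<in> carrier H \<Longrightarrow> act h (scale c v) = scale c (act h v)"
  "h \<in> carrier H \<Longrightarrow> act h 0 = 0"
proof -
  assume h: "h \<in> carrier H"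
  interpret Vector_Spaces.linear scale scale "act h" by (rule act_linear[OF h])
  show "act h (u + v) = act h u + act h v" "act h (scale c v) = scale c (act h v)" "act h 0 = 0"
    by (auto simp: add scale zero)
qed

lemma B_hom: "b \<in> B \<Longrightarrow> b (u + v) = b u + b v" "b \<in> B \<Longrightarrow> b (scale c v) = scale c (b v)" "b \<in> B \<Longrightarrow> b 0 = 0"
  by (auto simp: B_def act_hom)

lemma act_finsum: "(\<And>i. i \<in> I \<Longrightarrow> F i \<in> carrier H) \<Longrightarrow> act (\<Oplus>i\<in>I. F i) = (\<Sum>i\<in>I. act (F i))"
  by (intro ops.hom_finsum H_abelian_group act_add')

lemma act_0: "act \<zero> = 0"
  using act_finsum[of "{}"] by simp

lemma subspace_B: "ops.subspace B"
proof (rule ops.subspaceI)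
  show "0 \<in> B" using act_0 act_in_B[of "\<zero>"] by simp
  show "x + y \<in> B" if "x \<in> B" "y \<in> B" for x y
    using that act_add' by (auto simp: B_def) (metis A.add.m_closed imageI)
  show "op_scale c x \<in> B" if "x \<in> B" for c x
    using that act_smult' by (auto simp: B_def) (metis H_smult_closed imageI)
qed

lemma finite_dim_B: "\<exists>S. finite S \<and> B \<subseteq> ops.span S"
proof -
  obtain S where S: "finite S" "S \<subseteq> carrier H" "\<And>x. x \<in> carrier H \<Longrightarrow> \<exists>c. x = (\<Oplus>b\<in>S. c b \<odot> b)"
    using finite_dim unfolding finite_dimensional_def by blast
  have "act x \<in> ops.span (act ` S)" if x: "x \<in> carrier H" for x
  proof -
    obtain c where c: "x = (\<Oplus>b\<in>S. c b \<odot> b)" using S(3)[OF x] by blast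
    have "act x = (\<Sum>b\<in>S. op_scale (c b) (act b))"
      unfolding c using S(2) by (subst act_finsum) (auto intro!: sum.cong simp: act_smult')
    also have "\<dots> \<in> ops.span (act ` S)"
      by (intro ops.span_sum ops.span_scale ops.span_base) auto
    finally show ?thesis .
  qed
  then show ?thesis using S(1) by (intro exI[of _ "act ` S"]) (auto simp: B_def)
qed

lemmas dual_add = functionals_on_add[of _ op_scale B]
  and dual_scale = functionals_on_scale[of _ op_scale B]
  and dual_0 = ops.functionals_on_0[OF subspace_B]
  and dual_sum = ops.functionals_on_sum[OF subspace_B]
  and dual_separates = ops.eq_if_functionals_on_eq[of B]

lemma sum_in_B: "(\<And>i. i \<in> I \<Longrightarrow> x i \<in> B) \<Longrightarrow> (\<Sum>i\<in>I. op_scale (c i) (x i)) \<in> B"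
  using subspace_B by (intro ops.subspace_sum ops.subspace_scale)

lemma comp_in_B: "\<lbrakk>x \<in> B; y \<in> B\<rbrakk> \<Longrightarrow> x \<circ> y \<in> B"
  by (auto simp: B_def) (metis A.m_closed act_mult' imageI)

lemma dual_comp_left: "\<lbrakk>f \<in> dual; a \<in> B\<rbrakk> \<Longrightarrow> (\<lambda>z. f (a \<circ> z)) \<in> dual"
proof -
  assume f: "f \<in> dual" and a: "a \<in> B"
  have "a \<circ> (x + y) = (a \<circ> x) + (a \<circ> y)" "a \<circ> op_scale c x = op_scale c (a \<circ> x)" for x y c
    using a by (auto simp: fun_eq_iff B_hom)
  then show ?thesis using f a by (simp add: functionals_on_def comp_in_B)
qed

lemma dual_comp_right: "\<lbrakk>f \<in> dual; a \<in> B\<rbrakk> \<Longrightarrow> (\<lambda>z. f (z \<circ> a)) \<in> dual"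
proof -
  assume f: "f \<in> dual" and a: "a \<in> B"
  have "(x + y) \<circ> a = (x \<circ> a) + (y \<circ> a)" "op_scale c x \<circ> a = op_scale c (x \<circ> a)" for x y c
    by (auto simp: fun_eq_iff)
  then show ?thesis using f a by (simp add: functionals_on_def comp_in_B)
qed

lemma dual_matrix_coefficient:
  assumes "functional \<xi>"
  shows "(\<lambda>F. \<xi> (F v)) \<in> dual"
proof -
  interpret Vector_Spaces.linear scale "(*)" \<xi> by fact
  show ?thesis by (simp add: functionals_on_def add scale)
qed

text \<open>Lifts injectivity from \<open>V \<otimes> V\<close> to tensors of operators:
  \<open>Y_injective\<close> tests the first factor with matrix coefficients, letting
  \<open>v\<close> vary turns the second factor into an operator to which \<open>k\<close> applies,
  and letting \<open>\<xi>\<close> and \<open>u\<close> vary does the same for the first factor and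
  \<open>l\<close>.\<close>

lemma Y_tensor_sum_eq_0:
  assumes keys: "keys f \<subseteq> carrier H \<times> carrier H"
    and zero: "\<And>u v n. tensor_sum scale (\<lambda>a b. Y (act a u) n (act b v)) f = 0"
    and l: "l \<in> dual" and k: "k \<in> dual"
  shows "tensor_sum (*) (\<lambda>a b. l (act a) * k (act b)) f = 0"
proof -
  let ?c = "lookup f" and ?K = "keys f"
  have K: "fst p \<in> carrier H" "snd p \<in> carrier H" if "p \<in> ?K" for p using that keys by auto
  have 1: "(\<Sum>p\<in>?K. scale (?c p * \<xi> (act (fst p) u)) (act (snd p) v)) = 0"
    if "functional \<xi>" for \<xi> u v
  proof -
    have "(\<Sum>p\<in>?K. Y (act (fst p) u) n (scale (?c p) (act (snd p) v))) = 0" for n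
      using zero[of u n v] by (simp add: tensor_sum_def Y_right.scale)
    then have "(\<Sum>p\<in>?K. scale (\<xi> (act (fst p) u)) (scale (?c p) (act (snd p) v))) = 0"
      by (intro Y_injective[OF finite_keys _ that])
    then show ?thesis by (simp add: mult.commute)
  qed
  have 2: "(\<Sum>p\<in>?K. ?c p * \<xi> (act (fst p) u) * k (act (snd p))) = 0"
    if "functional \<xi>" for \<xi> u
  proof -
    have "(\<Sum>p\<in>?K. op_scale (?c p * \<xi> (act (fst p) u)) (act (snd p))) = 0"
      using 1[OF that] by (simp add: fun_eq_iff sum_fun_apply)
    then have "k (\<Sum>p\<in>?K. op_scale (?c p * \<xi> (act (fst p) u)) (act (snd p))) = 0"
      using dual_0[OF k] by simp
    then show ?thesis using K by (subst (asm) dual_sum[OF k]) (auto simp: act_in_B)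
  qed
  have "(\<Sum>p\<in>?K. op_scale (?c p * k (act (snd p))) (act (fst p))) = 0"
  proof
    fix u
    have "(\<Sum>p\<in>?K. scale (?c p * k (act (snd p))) (act (fst p) u)) = 0"
    proof (rule eq_0_if_functionals_0)
      fix \<xi> assume \<xi>: "functional \<xi>"
      then interpret \<xi>: Vector_Spaces.linear scale "(*)" \<xi> .
      show "\<xi> (\<Sum>p\<in>?K. scale (?c p * k (act (snd p))) (act (fst p) u)) = 0"
        using 2[OF \<xi>, of u] by (simp add: \<xi>.sum \<xi>.scale mult_ac)
    qed
    then show "(\<Sum>p\<in>?K. op_scale (?c p * k (act (snd p))) (act (fst p))) u = 0 u"
      by (simp add: sum_fun_apply)
  qed
  then have "l (\<Sum>p\<in>?K. op_scale (?c p * k (act (snd p))) (act (fst p))) = 0"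
    using dual_0[OF l] by simp
  then show ?thesis
    using K by (subst (asm) dual_sum[OF l]) (auto simp: act_in_B tensor_sum_def mult_ac)
qed

section \<open>The comultiplication modulo the kernel\<close>

lemma act_Y_rep:
  assumes "h \<in> carrier H"
  shows "act h (Y u n v) = tensor_sum scale (\<lambda>a b. Y (act a u) n (act b v)) (H.comult_rep h)"
  using act_Y[OF assms H.comult_rep(1)[OF assms]] by (simp add: tensor_sum_def)

text \<open>The number \<open>(l \<otimes> k)(\<Delta>(h))\<close>, with \<open>l\<close> and
  \<open>k\<close> pulled back to \<open>H\<close> along \<open>act\<close>. Such numbers stand in
  for a comultiplication on \<open>H/K\<close>.\<close>

definition pair :: "'h \<Rightarrow> (('v \<Rightarrow> 'v) \<Rightarrow> complex) \<Rightarrow> (('v \<Rightarrow> 'v) \<Rightarrow> complex) \<Rightarrow> complex" where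
  "pair h l k = tensor_sum (*) (\<lambda>a b. l (act a) * k (act b)) (H.comult_rep h)"

lemma bilinear_pair:
  assumes "l \<in> dual" "k \<in> dual"
  shows "bilinear_mod H H (*) {0} (\<lambda>a b. l (act a) * k (act b))"
  using assms by (intro bilinear_mod_0I)
    (auto simp: act_add' act_smult' dual_add[OF assms(1)] dual_add[OF assms(2)] dual_scale[OF assms(1)]
      dual_scale[OF assms(2)] act_in_B distrib_left distrib_right mult_ac)

lemma pair_rep:
  assumes "l \<in> dual" "k \<in> dual" "h \<in> carrier H" "f \<in> comult H h"
  shows "pair h l k = tensor_sum (*) (\<lambda>a b. l (act a) * k (act b)) f"
  unfolding pair_def
  using complex_plane.tensor_eval_rep[OF bilinear_pair[OF assms(1,2)] H.comult_closed[OF assms(3)]]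
    H.comult_rep(1)[OF assms(3)] assms(4) by metis

lemma pair_eval: "pair h l k = complex_plane.tensor_eval (\<lambda>a b. l (act a) * k (act b)) (comult H h)"
  by (simp add: pair_def complex_plane.tensor_eval_def H.comult_rep_def)

lemma pair_add: "\<lbrakk>l \<in> dual; k \<in> dual; h \<in> carrier H; h' \<in> carrier H\<rbrakk> \<Longrightarrow> pair (h \<oplus> h') l k = pair h l k + pair h' l k"
  and pair_smult: "\<lbrakk>l \<in> dual; k \<in> dual; h \<in> carrier H\<rbrakk> \<Longrightarrow> pair (c \<odot> h) l k = c * pair h l k"
  unfolding pair_eval using H.comult_linear
  by (auto simp: linear_maps_def H.comult_closed complex_plane.tensor_eval_add[OF bilinear_pair]
      complex_plane.tensor_eval_smult[OF bilinear_pair] simp del: tensor_product_carrier)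

text \<open>If \<open>h\<close> acts as zero, then \<open>act_Y_rep\<close> says that the image of
  \<open>\<Delta>(h)\<close> is killed by all modes; injectivity does the rest.\<close>

lemma pair_kernel:
  assumes "h \<in> carrier H" "act h = 0" "l \<in> dual" "k \<in> dual"
  shows "pair h l k = 0"
  unfolding pair_def
  by (rule Y_tensor_sum_eq_0[OF H.comult_rep(3)[OF assms(1)] _ assms(3,4)])
    (simp add: act_Y_rep[OF assms(1), symmetric] assms(2))

lemma pair_cong:
  assumes "h \<in> carrier H" "h' \<in> carrier H" "act h = act h'" "l \<in> dual" "k \<in> dual"
  shows "pair h l k = pair h' l k"
proof -
  let ?d = "h \<oplus> ((-1) \<odot> h')"
  have "act ?d = 0" using assms by (simp add: act_add' act_smult')
  then have "pair ?d l k = 0" using assms by (intro pair_kernel) auto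
  then show ?thesis using assms by (simp add: pair_add pair_smult)
qed

text \<open>Since \<open>h\<^sub>1 \<omega> = \<epsilon>(h\<^sub>1) \<omega>\<close>, the counit law
  collapses the Sweedler sum. In particular the action commutes with \<open>L(-1)\<close>.\<close>

lemma act_Y_omega: "h \<in> carrier H \<Longrightarrow> act h (Y \<omega> n v) = Y \<omega> n (act h v)"
proof -
  assume h: "h \<in> carrier H"
  note F = H.comult_rep[OF h]
  have "act h (Y \<omega> n v) = tensor_sum scale (\<lambda>a b. Y \<omega> n (act (counit H a \<odot> b) v)) (H.comult_rep h)"
    unfolding act_Y_rep[OF h]
    by (rule tensor_sum_cong[OF F(3)]) (simp add: act_omega Y_scale_left act_smult Y_right.scale)
  also have "\<dots> = Y \<omega> n (act (tensor_lift H (\<lambda>a b. counit H a \<odot> b) (comult H h)) v)"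
    by (rule hom_tensor_lift[symmetric, where M = H and N = H])
      (auto intro!: bilinear_mod_0I A.module_axioms H.comult_closed[OF h] F simp: act_add Y_right.add act_smult Y_right.scale H.counit_add
        H.counit_smult scale_left_distrib scale_right_distrib mult_ac simp del: tensor_product_carrier)
  also have "\<dots> = Y \<omega> n (act h v)" by (simp add: H.counit_left h)
  finally show ?thesis .
qed

lemma act_translate: "h \<in> carrier H \<Longrightarrow> act h (Y a (-1 - int i) vac) = Y (act h a) (-1 - int i) vac"
proof -
  assume h: "h \<in> carrier H"
  have "act h ((Y \<omega> 0 ^^ i) a) = (Y \<omega> 0 ^^ i) (act h a)"
    by (induction i) (auto simp: act_Y_omega h)
  then show ?thesis by (simp add: Y_vac_eq_translate act_hom h)
qed

text \<open>Skew symmetry of the vertex operators turns into cocommutativity.\<close>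

lemma pair_sym:
  assumes h: "h \<in> carrier H" and l: "l \<in> dual" and k: "k \<in> dual"
  shows "pair h l k = pair h k l"
proof -
  let ?F = "H.comult_rep h"
  note F = H.comult_rep[OF h]
  define F' where "F' = tensor_sum free_scale (\<lambda>a b. single (b, a) 1) ?F"
  have F': "F' \<in> formal_sums H H"
    unfolding F'_def by (intro formal_sums_tensor_sum[OF F(3)] formal_sums_single)
  \<comment> \<open>\<open>Y u n v\<close> is rewritten by modes of \<open>v\<close> on
    \<open>u\<close>, \<open>h\<close> acts there, and skew symmetry for the transformed vectors
    leads back, now with the tensor factors exchanged.\<close>
  have skew: "act h (Y u n v) = tensor_sum scale (\<lambda>a b. Y (act b u) n (act a v)) ?F" for u n v
  proof -
    let ?s = "\<lambda>i. - ((-1 :: complex) powi n) * (-1) ^ i"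
    \<comment> \<open>One finite index set for all the skew symmetry expansions involved, so that
      the sums can be exchanged.\<close>
    define I where "I = {i :: nat. Y v (n + int i) u \<noteq> 0} \<union>
      (\<Union>p\<in>keys ?F. {i :: nat. Y (act (fst p) v) (n + int i) (act (snd p) u) \<noteq> 0})"
    have finI: "finite I" unfolding I_def using finite_truncation by auto
    have *: "Y x n y = (\<Sum>i\<in>I. scale (?s i) (Y (Y y (n + int i) x) (-1 - int i) vac))"
      if "{i :: nat. Y y (n + int i) x \<noteq> 0} \<subseteq> I" for x y
      unfolding skew_symmetry[of x n y] using that
      by (intro Sum_any.expand_superset finI) (auto simp: Y_zero_left)
    have "act h (Y u n v) = (\<Sum>i\<in>I. scale (?s i) (Y (act h (Y v (n + int i) u)) (-1 - int i) vac))"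
    proof -
      interpret ah: Vector_Spaces.linear scale scale "act h" by (rule act_linear[OF h])
      have "Y u n v = (\<Sum>i\<in>I. scale (?s i) (Y (Y v (n + int i) u) (-1 - int i) vac))"
        by (rule *) (auto simp: I_def)
      then show ?thesis by (simp only: ah.sum ah.scale act_translate[OF h])
    qed
    also have "\<dots> = (\<Sum>i\<in>I. scale (?s i) (\<Sum>p\<in>keys ?F. scale (lookup ?F p)
        (Y (Y (act (fst p) v) (n + int i) (act (snd p) u)) (-1 - int i) vac)))"
      unfolding act_Y_rep[OF h] tensor_sum_def Y_sum_left Y_scale_left by simp
    also have "\<dots> = (\<Sum>p\<in>keys ?F. scale (lookup ?F p)
        (\<Sum>i\<in>I. scale (?s i) (Y (Y (act (fst p) v) (n + int i) (act (snd p) u)) (-1 - int i) vac)))"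
      unfolding scale_sum_right by (subst sum.swap) (simp only: scale_scale mult.commute)
    also have "\<dots> = (\<Sum>p\<in>keys ?F. scale (lookup ?F p) (Y (act (snd p) u) n (act (fst p) v)))"
      by (intro sum.cong refl arg_cong[where f = "scale _"] *[symmetric]) (auto simp: I_def)
    finally show ?thesis by (simp add: tensor_sum_def)
  qed
  have "tensor_sum (*) (\<lambda>a b. l (act a) * k (act b)) (?F - F') = 0"
  proof (rule Y_tensor_sum_eq_0[OF _ _ l k])
    show "keys (?F - F') \<subseteq> carrier H \<times> carrier H"
      using keys_diff[of ?F F'] F(3) formal_sums_keys[OF F'] by blast
    show "tensor_sum scale (\<lambda>a b. Y (act a u) n (act b v)) (?F - F') = 0" for u v n
      unfolding tensor_sum_diff act_Y_rep[OF h, symmetric] F'_def tensor_sum_compose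
      using skew[of u n v] by simp
  qed
  then have "pair h l k = tensor_sum (*) (\<lambda>a b. l (act b) * k (act a)) ?F"
    unfolding complex_plane.tensor_sum_diff F'_def complex_plane.tensor_sum_compose by (simp add: pair_def)
  then show ?thesis by (simp add: pair_def mult.commute)
qed

lemma pair_one: "l \<in> dual \<Longrightarrow> k \<in> dual \<Longrightarrow> pair \<one> l k = l id * k id"
proof -
  assume l: "l \<in> dual" and k: "k \<in> dual"
  have "single (\<one>, \<one>) 1 \<in> comult H \<one>"
    unfolding H.comult_one by (simp add: tensor_product_def tensor_def mem_tensor_class formal_sums_single)
  then show ?thesis using pair_rep[OF l k A.one_closed] by (simp add: act_one')
qed

text \<open>From \<open>\<Delta>(x y) = \<Delta>(x) \<Delta>(y)\<close>, with the factors of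
  \<open>\<Delta>(y)\<close> absorbed into the functionals.\<close>

lemma pair_mult:
  assumes x: "x \<in> carrier H" and y: "y \<in> carrier H" and l: "l \<in> dual" and k: "k \<in> dual"
  shows "pair (x \<otimes> y) l k = tensor_sum (*) (\<lambda>a b. pair x (\<lambda>z. l (z \<circ> act a)) (\<lambda>z. k (z \<circ> act b))) (H.comult_rep y)"
proof -
  let ?f = "H.comult_rep x" and ?g = "H.comult_rep y"
  let ?m = "\<Sum>p\<in>keys ?f. \<Sum>q\<in>keys ?g.
    single (fst p \<otimes> fst q, snd p \<otimes> snd q) (lookup ?f p * lookup ?g q)"
  note F = H.comult_rep[OF x] and G = H.comult_rep[OF y]
  have Fk: "fst p \<in> carrier H" "snd p \<in> carrier H" if "p \<in> keys ?f" for p using that F(3) by auto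
  have Gk: "fst p \<in> carrier H" "snd p \<in> carrier H" if "p \<in> keys ?g" for p using that G(3) by auto
  have "?m \<in> formal_sums H H" using Fk Gk by (intro formal_sums_sum formal_sums_single) auto
  then have "?m \<in> tensor_class H H ?m" by (rule mem_tensor_class)
  then have "?m \<in> comult H (x \<otimes> y)"
    unfolding H.comult_mult[OF x y] tensor_product_def using F(1) G(1) by auto
  then have "pair (x \<otimes> y) l k = tensor_sum (*) (\<lambda>a b. l (act a) * k (act b)) ?m"
    using pair_rep[OF l k] x y by simp
  also have "\<dots> = (\<Sum>p\<in>keys ?f. \<Sum>q\<in>keys ?g.
    lookup ?f p * lookup ?g q * (l (act (fst p) \<circ> act (fst q)) * k (act (snd p) \<circ> act (snd q))))"
    unfolding complex_plane.tensor_sum_sum complex_plane.tensor_sum_single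
    using Fk Gk by (intro sum.cong refl) (simp add: act_mult')
  also have "\<dots> = (\<Sum>q\<in>keys ?g. lookup ?g q * (\<Sum>p\<in>keys ?f.
    lookup ?f p * (l (act (fst p) \<circ> act (fst q)) * k (act (snd p) \<circ> act (snd q)))))"
    unfolding sum_distrib_left by (subst sum.swap) (simp add: mult_ac)
  finally show ?thesis by (simp add: pair_def tensor_sum_def)
qed

text \<open>The preimage of \<open>b\<close> is arbitrary; the result depends on \<open>b\<close>
  only, by \<open>pair_cong\<close>, because functionals separate operators.\<close>

definition R :: "(('v \<Rightarrow> 'v) \<Rightarrow> complex) \<Rightarrow> ('v \<Rightarrow> 'v) \<Rightarrow> 'v \<Rightarrow> 'v" where
  "R k b = tensor_sum op_scale (\<lambda>x y. op_scale (k (act y)) (act x))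
    (H.comult_rep (SOME h. h \<in> carrier H \<and> act h = b))"

lemma tensor_sum_op_in_B:
  assumes "h \<in> carrier H" "\<And>x y. x \<in> carrier H \<Longrightarrow> y \<in> carrier H \<Longrightarrow> G x y \<in> B"
  shows "tensor_sum op_scale G (H.comult_rep h) \<in> B"
  unfolding tensor_sum_def using H.comult_rep(3)[OF assms(1)] assms(2) by (intro sum_in_B) auto

lemma dual_tensor_sum_op:
  assumes "l \<in> dual" "h \<in> carrier H" "\<And>x y. x \<in> carrier H \<Longrightarrow> y \<in> carrier H \<Longrightarrow> G x y \<in> B"
  shows "l (tensor_sum op_scale G (H.comult_rep h)) = tensor_sum (*) (\<lambda>x y. l (G x y)) (H.comult_rep h)"
  unfolding tensor_sum_def using H.comult_rep(3)[OF assms(2)] assms(3) by (intro dual_sum assms) auto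

lemma op_scale_in_B: "b \<in> B \<Longrightarrow> op_scale c b \<in> B"
  using subspace_B by (rule ops.subspace_scale)

lemma R_act:
  assumes k: "k \<in> dual" and h: "h \<in> carrier H"
  shows "R k (act h) \<in> B" "l \<in> dual \<Longrightarrow> l (R k (act h)) = pair h l k"
    and "R k (act h) = tensor_sum op_scale (\<lambda>x y. op_scale (k (act y)) (act x)) (H.comult_rep h)"
proof -
  let ?G = "\<lambda>x y. op_scale (k (act y)) (act x)"
  define h' where "h' = (SOME h'. h' \<in> carrier H \<and> act h' = act h)"
  have h': "h' \<in> carrier H" "act h' = act h"
    using someI[of "\<lambda>h'. h' \<in> carrier H \<and> act h' = act h" h] h by (auto simp: h'_def)
  have R: "R k (act h) = tensor_sum op_scale ?G (H.comult_rep h')" by (simp add: R_def h'_def)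
  then show "R k (act h) \<in> B" using h' by (auto intro!: tensor_sum_op_in_B op_scale_in_B act_in_B)
  have l_eq: "l (tensor_sum op_scale ?G (H.comult_rep h)) = pair h l k" if "h \<in> carrier H" "l \<in> dual" for h l
  proof -
    have "l (tensor_sum op_scale ?G (H.comult_rep h)) = tensor_sum (*) (\<lambda>x y. l (?G x y)) (H.comult_rep h)"
      using that by (intro dual_tensor_sum_op op_scale_in_B act_in_B)
    also have "\<dots> = pair h l k"
      unfolding pair_def using that act_in_B
      by (intro complex_plane.tensor_sum_cong[OF H.comult_rep(3)]) (auto simp: dual_scale[OF that(2)] mult.commute)
    finally show ?thesis .
  qed
  show *: "l (R k (act h)) = pair h l k" if "l \<in> dual" for l
    unfolding R l_eq[OF h'(1) that] by (rule pair_cong[OF h'(1) h h'(2) that k])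
  show "R k (act h) = tensor_sum op_scale ?G (H.comult_rep h)"
    by (rule dual_separates) (simp add: * l_eq h)
qed

text \<open>Since \<open>Y vac\<close> has the identity as its only nonzero mode, applying
  \<open>h\<close> to \<open>Y vac n v\<close> and using injectivity gives that
  \<open>h\<^sub>1 vac \<otimes> h\<^sub>2 v\<close> sums to \<open>vac \<otimes> h v\<close>.
  Substituting \<open>S(h\<^sub>3) vac\<close> for \<open>v\<close> makes the antipode cancel
  \<open>h\<^sub>2\<close>.\<close>

lemma act_vac:
  assumes h: "h \<in> carrier H"
  shows "act h vac = scale (counit H h) vac"
proof -
  have S: "antipode H a \<in> carrier H" if "a \<in> carrier H" for a
    using H.antipode_linear that by (auto simp: linear_maps_def)
  have S_add: "antipode H (a \<oplus> b) = antipode H a \<oplus> antipode H b"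
    and S_smult: "antipode H (c \<odot> a) = c \<odot> antipode H a"
    if "a \<in> carrier H" "b \<in> carrier H" for a b c
    using H.antipode_linear that by (auto simp: linear_maps_def)
  note F = H.comult_rep
  have key: "tensor_sum scale (\<lambda>a b. scale (\<xi> (act a vac)) (act b v)) (H.comult_rep x) = scale (\<xi> vac) (act x v)"
    if x: "x \<in> carrier H" and \<xi>: "functional \<xi>" for x v \<xi>
  proof -
    interpret \<xi>: Vector_Spaces.linear scale "(*)" \<xi> by fact
    let ?K = "keys (H.comult_rep x)" and ?c = "lookup (H.comult_rep x)"
    \<comment> \<open>The extra index \<open>None\<close> carries the term
      \<open>vac \<otimes> h v\<close> with a minus sign, so that the identity becomes a relation
      for \<open>Y_injective\<close>.\<close>
    let ?I = "insert None (Some ` ?K)"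
    define u where "u i = (case i of None \<Rightarrow> vac | Some (p :: 'h \<times> 'h) \<Rightarrow> act (fst p) vac)" for i
    define w where "w i = (case i of None \<Rightarrow> - act x v | Some p \<Rightarrow> scale (?c p) (act (snd p) v))" for i
    have sum: "(\<Sum>i\<in>?I. g i) = g None + (\<Sum>p\<in>?K. g (Some p))" for g :: "('h \<times> 'h) option \<Rightarrow> 'v"
      by (subst sum.insert) (auto simp: sum.reindex)
    have "(\<Sum>i\<in>?I. Y (u i) n (w i)) = 0" for n
    proof -
      have "(\<Sum>p\<in>?K. Y (act (fst p) vac) n (scale (?c p) (act (snd p) v))) = act x (Y vac n v)"
        by (simp add: act_Y_rep x tensor_sum_def Y_right.scale)
      also have "\<dots> = Y vac n (act x v)" using x by (simp add: vacuum act_hom)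
      finally show ?thesis unfolding sum by (simp add: u_def w_def Y_right.neg)
    qed
    then have "(\<Sum>i\<in>?I. scale (\<xi> (u i)) (w i)) = 0"
      by (intro Y_injective \<xi>) auto
    then show ?thesis
      unfolding sum by (simp add: u_def w_def tensor_sum_def mult.commute)
  qed
  have "\<xi> (act h vac - scale (counit H h) vac) = 0" if \<xi>: "functional \<xi>" for \<xi>
  proof -
    interpret \<xi>: Vector_Spaces.linear scale "(*)" \<xi> by fact
    let ?\<theta> = "\<lambda>a b c. scale (\<xi> (act a vac)) (act b (act (antipode H c) vac))"
    have anti: "tensor_sum scale (\<lambda>b c. act b (act (antipode H c) vac)) (H.comult_rep y) = scale (counit H y) vac"
      if y: "y \<in> carrier H" for y
    proof -
      have "tensor_sum scale (\<lambda>b c. act b (act (antipode H c) vac)) (H.comult_rep y) =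
        tensor_sum scale (\<lambda>b c. act (b \<otimes> antipode H c) vac) (H.comult_rep y)"
        by (intro tensor_sum_cong[OF F(3)[OF y]]) (simp add: act_mult S)
      also have "\<dots> = act (tensor_lift H (\<lambda>b c. b \<otimes> antipode H c) (comult H y)) vac"
        by (rule hom_tensor_lift[symmetric, where M = H and N = H])
          (auto intro!: bilinear_mod_0I A.module_axioms H.comult_closed[OF y] F y
            simp: act_add act_smult act_mult S S_add S_smult act_hom simp del: tensor_product_carrier)
      also have "\<dots> = scale (counit H y) vac" by (simp add: H.antipode_right y act_smult act_one)
      finally show ?thesis .
    qed
    \<comment> \<open>The sum of \<open>\<xi>(h\<^sub>1 vac) h\<^sub>2 S(h\<^sub>3) vac\<close> is
      bracketed in two ways: \<open>key\<close> contracts the first two factors, \<open>anti\<close>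
      the last two.\<close>
    have "tensor_sum scale (\<lambda>x c. tensor_sum scale (\<lambda>a b. ?\<theta> a b c) (H.comult_rep x)) (H.comult_rep h)
      = tensor_sum scale (\<lambda>a y. tensor_sum scale (\<lambda>b c. ?\<theta> a b c) (H.comult_rep y)) (H.comult_rep h)"
      by (rule coassoc_trilinear[OF H.hopf_algebra_axioms h])
        (auto intro!: bilinear_mod_0I simp: act_add act_smult act_mult S S_add S_smult act_hom
          \<xi>.add \<xi>.scale scale_left_distrib scale_right_distrib mult_ac)
    also have "\<dots> = tensor_sum scale (\<lambda>a y. scale (\<xi> (act (counit H y \<odot> a) vac)) vac) (H.comult_rep h)"
    proof (intro tensor_sum_cong[OF F(3)[OF h]])
      fix a y assume "a \<in> carrier H" "y \<in> carrier H"
      moreover have "tensor_sum scale (\<lambda>b c. scale k (G b c)) f = scale k (tensor_sum scale G f)" for k G and f :: "'h \<times> 'h \<Rightarrow>\<^sub>0 complex"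
        by (simp add: tensor_sum_def scale_sum_right mult.commute)
      ultimately show "tensor_sum scale (\<lambda>b c. ?\<theta> a b c) (H.comult_rep y) =
        scale (\<xi> (act (counit H y \<odot> a) vac)) vac"
        by (simp add: anti act_smult \<xi>.scale mult.commute)
    qed
    also have "\<dots> = scale (\<xi> (act (tensor_lift H (\<lambda>a b. counit H b \<odot> a) (comult H h)) vac)) vac"
      by (rule hom_tensor_lift[symmetric, where M = H and N = H])
        (auto intro!: bilinear_mod_0I A.module_axioms H.comult_closed[OF h] F h simp: act_add act_smult \<xi>.add \<xi>.scale
          H.counit_add H.counit_smult scale_left_distrib scale_right_distrib distrib_left distrib_right mult_ac simp del: tensor_product_carrier)
    also have "\<dots> = scale (\<xi> (act h vac)) vac" by (simp add: H.counit_right h)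
    also have "tensor_sum scale (\<lambda>x c. tensor_sum scale (\<lambda>a b. ?\<theta> a b c) (H.comult_rep x)) (H.comult_rep h)
      = tensor_sum scale (\<lambda>x c. scale (\<xi> vac) (act x (act (antipode H c) vac))) (H.comult_rep h)"
      by (intro tensor_sum_cong[OF F(3)[OF h]]) (simp add: key[OF _ \<xi>])
    also have "\<dots> = scale (\<xi> vac) (tensor_sum scale (\<lambda>x c. act x (act (antipode H c) vac)) (H.comult_rep h))"
      by (simp add: tensor_sum_def scale_sum_right mult.commute)
    also have "\<dots> = scale (\<xi> vac * counit H h) vac" by (simp add: anti h)
    finally show ?thesis using vac_neq_0 by (simp add: \<xi>.diff \<xi>.scale mult.commute)
  qed
  then have "act h vac - scale (counit H h) vac = 0" by (rule eq_0_if_functionals_0)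
  then show ?thesis by simp
qed

definition vac_functional :: "'v \<Rightarrow> complex" where
  "vac_functional = (SOME \<xi>. functional \<xi> \<and> \<xi> vac = 1)"

lemma vac_functional: "functional vac_functional" "vac_functional vac = 1"
proof -
  have "\<exists>\<xi>. functional \<xi> \<and> \<xi> vac = 1"
    using exists_functional[OF subspace_single_0, of vac] vac_neq_0 by blast
  from someI_ex[OF this] show "functional vac_functional" "vac_functional vac = 1"
    by (auto simp: vac_functional_def)
qed

text \<open>The counit of \<open>B\<close>: by \<open>act_vac\<close> this matrix coefficient at the
  vacuum equals \<open>counit H h\<close> for the operator of \<open>h\<close>.\<close>

definition e :: "('v \<Rightarrow> 'v) \<Rightarrow> complex" where "e F = vac_functional (F vac)"

lemma e_dual: "e \<in> dual"
  unfolding e_def by (rule dual_matrix_coefficient[OF vac_functional(1)])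

lemma e_act: "h \<in> carrier H \<Longrightarrow> e (act h) = counit H h"
proof -
  interpret Vector_Spaces.linear scale "(*)" vac_functional by (rule vac_functional)
  show "h \<in> carrier H \<Longrightarrow> e (act h) = counit H h" by (simp add: e_def act_vac scale vac_functional)
qed

lemma pair_e: "h \<in> carrier H \<Longrightarrow> l \<in> dual \<Longrightarrow> pair h l e = l (act h)"
proof -
  assume h: "h \<in> carrier H" and l: "l \<in> dual"
  note F = H.comult_rep[OF h]
  have "pair h l e = tensor_sum (*) (\<lambda>a b. l (act (counit H b \<odot> a))) (H.comult_rep h)"
    unfolding pair_def
    by (rule complex_plane.tensor_sum_cong[OF F(3)]) (simp add: e_act act_smult' dual_scale[OF l] act_in_B)
  also have "\<dots> = l (act (tensor_lift H (\<lambda>a b. counit H b \<odot> a) (comult H h)))"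
    by (rule complex_plane.hom_tensor_lift[symmetric, where \<Lambda> = "\<lambda>x. l (act x)" and M = H and N = H])
      (auto intro!: bilinear_mod_0I A.module_axioms H.comult_closed[OF h] F simp: act_add' act_smult' dual_add[OF l] dual_scale[OF l] act_in_B
        op_scale_in_B ops.subspace_add[OF subspace_B] H.counit_add H.counit_smult distrib_left distrib_right mult_ac simp del: tensor_product_carrier)
  finally show "pair h l e = l (act h)" by (simp add: H.counit_right h)
qed

text \<open>By coassociativity, \<open>l\<close> of the left side is the sum of
  \<open>l(h\<^sub>1) f(h\<^sub>2) g(h\<^sub>3)\<close>, and \<open>pair_sym\<close> exchanges the
  last two factors.\<close>

lemma R_comm:
  assumes f: "f \<in> dual" and g: "g \<in> dual" and h: "h \<in> carrier H"
  shows "R f (R g (act h)) = R g (R f (act h))"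
proof -
  have *: "l (R f (R g (act h))) = tensor_sum (*) (\<lambda>a y. l (act a) * pair y f g) (H.comult_rep h)"
    if f: "f \<in> dual" and g: "g \<in> dual" and l: "l \<in> dual" for f g l
  proof -
    have lf: "(\<lambda>b. l (R f b)) \<in> dual"
      unfolding functionals_on_def
    proof (intro CollectI conjI ballI allI)
      fix x y assume "x \<in> B" "y \<in> B"
      then obtain a b where "a \<in> carrier H" "b \<in> carrier H" "x = act a" "y = act b" by (auto simp: B_def)
      then show "l (R f (x + y)) = l (R f x) + l (R f y)"
        using R_act(2)[OF f, of "a \<oplus> b" l] by (simp add: R_act(2) f l pair_add act_add')
    next
      fix c x assume "x \<in> B"
      then obtain a where "a \<in> carrier H" "x = act a" by (auto simp: B_def)
      then show "l (R f (op_scale c x)) = c * l (R f x)"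
        using R_act(2)[OF f, of "c \<odot> a" l] by (simp add: R_act(2) f l pair_smult act_smult')
    qed
    have "l (R f (R g (act h))) = tensor_sum (*) (\<lambda>x c. l (R f (op_scale (g (act c)) (act x)))) (H.comult_rep h)"
      unfolding R_act(3)[OF g h]
      by (rule dual_tensor_sum_op[OF lf h]) (simp add: op_scale_in_B act_in_B)
    also have "\<dots> = tensor_sum (*) (\<lambda>x c. tensor_sum (*) (\<lambda>a b. l (act a) * (f (act b) * g (act c))) (H.comult_rep x)) (H.comult_rep h)"
    proof (rule complex_plane.tensor_sum_cong[OF H.comult_rep(3)[OF h]])
      fix x c assume x: "x \<in> carrier H" "c \<in> carrier H"
      have "l (R f (op_scale (g (act c)) (act x))) = g (act c) * pair x l f"
        using dual_scale[OF lf act_in_B[OF x(1)]] R_act(2)[OF f x(1) l] by simp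
      then show "l (R f (op_scale (g (act c)) (act x))) = tensor_sum (*) (\<lambda>a b. l (act a) * (f (act b) * g (act c))) (H.comult_rep x)"
        by (simp add: pair_def tensor_sum_def sum_distrib_left mult_ac)
    qed
    also have "\<dots> = tensor_sum (*) (\<lambda>a y. tensor_sum (*) (\<lambda>b c. l (act a) * (f (act b) * g (act c))) (H.comult_rep y)) (H.comult_rep h)"
      by (rule complex_plane.coassoc_trilinear[OF H.hopf_algebra_axioms h])
        (auto intro!: bilinear_mod_0I simp: act_add' act_smult' dual_add[OF f] dual_add[OF g] dual_add[OF l]
            dual_scale[OF f] dual_scale[OF g] dual_scale[OF l] act_in_B distrib_left distrib_right mult_ac)
    also have "\<dots> = tensor_sum (*) (\<lambda>a y. l (act a) * pair y f g) (H.comult_rep h)"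
      by (simp add: pair_def tensor_sum_def sum_distrib_left mult_ac)
    finally show ?thesis .
  qed
  show ?thesis
  proof (rule dual_separates)
    fix l assume l: "l \<in> dual"
    show "l (R f (R g (act h))) = l (R g (R f (act h)))"
      unfolding *[OF f g l] *[OF g f l]
      by (intro complex_plane.tensor_sum_cong[OF H.comult_rep(3)[OF h]]) (simp add: pair_sym f g)
  qed
qed

text \<open>The hypothesis is available only through functionals, so the second tensor factor of
  \<open>\<Delta>(h)\<close> is expanded in a basis \<open>C\<close> of \<open>B\<close>; the first
  factors are then collected by \<open>R (\<kappa> x)\<close>.\<close>

lemma grouplike_Y:
  assumes h: "h \<in> carrier H" and g: "\<And>k. k \<in> dual \<Longrightarrow> R k (act h) = op_scale (k (act h)) (act h)"
  shows "act h (Y u n v) = Y (act h u) n (act h v)"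
proof -
  obtain C where C: "C \<subseteq> B" "ops.independent C" "B \<subseteq> ops.span C"
    by (rule ops.maximal_independent_subset[of B])
  have finC: "finite C" using finite_dim_B ops.finite_independent_in_span C by blast
  obtain \<kappa> where \<kappa>: "\<And>x. ops.functional (\<kappa> x)" "\<And>b. b \<in> ops.span C \<Longrightarrow> b = (\<Sum>x\<in>C. op_scale (\<kappa> x b) x)"
    using ops.exists_dual_basis[OF C(2) finC] by blast
  have expand: "b v = (\<Sum>x\<in>C. scale (\<kappa> x b) (x v))" if "b \<in> B" for b v
    using fun_cong[OF \<kappa>(2)[of b], of v] that C(3) by (auto simp: sum_fun_apply)
  have Y_expand: "Y w n (b v) = (\<Sum>x\<in>C. Y (scale (\<kappa> x b) w) n (x v))" if "b \<in> B" for b w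
    by (subst expand[OF that]) (simp only: Y_right.sum Y_right.scale Y_scale_left)
  have "act h (Y u n v) = tensor_sum scale (\<lambda>a b. \<Sum>x\<in>C. Y (scale (\<kappa> x (act b)) (act a u)) n (x v)) (H.comult_rep h)"
    unfolding act_Y_rep[OF h]
    by (rule tensor_sum_cong[OF H.comult_rep(3)[OF h]]) (rule Y_expand[OF act_in_B])
  also have "\<dots> = (\<Sum>x\<in>C. Y (tensor_sum op_scale (\<lambda>a b. op_scale (\<kappa> x (act b)) (act a)) (H.comult_rep h) u) n (x v))"
    unfolding tensor_sum_def scale_sum_right
    by (subst sum.swap) (simp add: sum_fun_apply Y_sum_left Y_scale_left)
  also have "\<dots> = (\<Sum>x\<in>C. Y (R (\<kappa> x) (act h) u) n (x v))"
    using R_act(3)[OF functionals_on_linear[OF \<kappa>(1)] h] by simp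
  also have "\<dots> = Y (act h u) n (act h v)"
    using g[OF functionals_on_linear[OF \<kappa>(1)]] Y_expand[OF act_in_B[OF h]] by simp
  finally show ?thesis .
qed

lemma B_E: "b \<in> B \<Longrightarrow> (\<And>h. h \<in> carrier H \<Longrightarrow> b = act h \<Longrightarrow> P) \<Longrightarrow> P"
  by (auto simp: B_def)

sublocale bialg: cocommutative_bialgebra op_scale B "(\<circ>)" id R e
proof unfold_locales
  show "ops.subspace B" by (rule subspace_B)
  show "\<exists>S. finite S \<and> B \<subseteq> ops.span S" by (rule finite_dim_B)
  show "id \<in> B" using act_in_B[OF A.one_closed] by (simp add: act_one')
  show "(id :: 'v \<Rightarrow> 'v) \<noteq> 0" using vac_neq_0 by (metis id_apply zero_fun_apply)
  show "x \<circ> y \<in> B" if "x \<in> B" "y \<in> B" for x y using that by (rule comp_in_B)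
  show "x \<circ> (y + z) = (x \<circ> y) + (x \<circ> z)" if "x \<in> B" for x y z using that by (auto simp: fun_eq_iff B_hom)
  show "x \<circ> op_scale c y = op_scale c (x \<circ> y)" if "x \<in> B" for x y c using that by (auto simp: fun_eq_iff B_hom)
  show "R f x \<in> B" if "f \<in> dual" "x \<in> B" for f x using that by (auto elim!: B_E simp: R_act(1))
  show "R f (x + y) = R f x + R f y" if f: "f \<in> dual" and x: "x \<in> B" and y: "y \<in> B" for f x y
  proof (rule dual_separates)
    fix l assume l: "l \<in> dual"
    obtain a b where ab: "a \<in> carrier H" "b \<in> carrier H" "x = act a" "y = act b" using x y by (auto simp: B_def)
    show "l (R f (x + y)) = l (R f x + R f y)"
      using ab R_act(2)[OF f _ l, of "a \<oplus> b"]
      by (simp add: act_add' R_act(1,2) f l pair_add dual_add[OF l])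
  qed
  show "R f (op_scale c x) = op_scale c (R f x)" if f: "f \<in> dual" and x: "x \<in> B" for f c x
  proof (rule dual_separates)
    fix l assume l: "l \<in> dual"
    obtain a where a: "a \<in> carrier H" "x = act a" using x by (auto simp: B_def)
    show "l (R f (op_scale c x)) = l (op_scale c (R f x))"
      using a R_act(2)[OF f _ l, of "c \<odot> a"]
      by (simp add: act_smult' R_act(1,2) f l pair_smult dual_scale[OF l])
  qed
  show "f (R g x) = g (R f x)" if "f \<in> dual" "g \<in> dual" "x \<in> B" for f g x
    using that by (auto elim!: B_E simp: R_act(2) pair_sym)
  show "R f (R g x) = R g (R f x)" if "f \<in> dual" "g \<in> dual" "x \<in> B" for f g x
    using that by (auto elim!: B_E simp: R_comm)
  show "e \<in> dual" by (rule e_dual)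
  show "e id = 1" by (simp add: e_def vac_functional)
  show "R e x = x" if "x \<in> B" for x
  proof (rule dual_separates)
    show "l (R e x) = l x" if "l \<in> dual" for l
      using that \<open>x \<in> B\<close> by (auto elim!: B_E simp: R_act(2) e_dual pair_e)
  qed
  show "R f id = op_scale (f id) id" if f: "f \<in> dual" for f
  proof (rule dual_separates)
    show "l (R f id) = l (op_scale (f id) id)" if l: "l \<in> dual" for l
      using R_act(2)[OF f A.one_closed l] dual_scale[OF l act_in_B[OF A.one_closed]]
      by (simp add: pair_one f l act_one')
  qed
  show "R f (x \<circ> y) = (x \<circ> R (\<lambda>z. f (a \<circ> z)) y) + (b \<circ> R (\<lambda>z. f (x \<circ> z)) y)"
    if a: "a \<in> B" and b: "b \<in> B" and x: "x \<in> B" and y: "y \<in> B" and f: "f \<in> dual"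
      and skew: "\<And>k. k \<in> dual \<Longrightarrow> R k x = op_scale (k a) x + op_scale (k x) b" for a b x y f
  proof (rule dual_separates)
    fix l assume l: "l \<in> dual"
    obtain hx where hx: "hx \<in> carrier H" "x = act hx" using x by (auto simp: B_def)
    obtain hy where hy: "hy \<in> carrier H" "y = act hy" using y by (auto simp: B_def)
    note d = dual_comp_left[OF l x] dual_comp_left[OF l b] dual_comp_left[OF f a] dual_comp_left[OF f x]
    have "l (R f (x \<circ> y)) = pair (hx \<otimes> hy) l f"
      using R_act(2)[OF f A.m_closed[OF hx(1) hy(1)] l] hx hy by (simp add: act_mult')
    also have "\<dots> = tensor_sum (*) (\<lambda>p q. pair hx (\<lambda>z. l (z \<circ> act p)) (\<lambda>z. f (z \<circ> act q))) (H.comult_rep hy)"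
      by (rule pair_mult[OF hx(1) hy(1) l f])
    \<comment> \<open>For fixed factors \<open>act p\<close>, \<open>act q\<close> of
      \<open>y\<close>, the pairing of \<open>hx\<close> is a value of \<open>R\<close> at
      \<open>x\<close>, where the skew primitive formula applies.\<close>
    also have "\<dots> = tensor_sum (*) (\<lambda>p q. l (x \<circ> act p) * f (a \<circ> act q) + l (b \<circ> act p) * f (x \<circ> act q)) (H.comult_rep hy)"
    proof (rule complex_plane.tensor_sum_cong[OF H.comult_rep(3)[OF hy(1)]])
      fix p q assume p: "p \<in> carrier H" and q: "q \<in> carrier H"
      have lp: "(\<lambda>z. l (z \<circ> act p)) \<in> dual" and fq: "(\<lambda>z. f (z \<circ> act q)) \<in> dual"
        using dual_comp_right l f act_in_B p q by auto
      have "pair hx (\<lambda>z. l (z \<circ> act p)) (\<lambda>z. f (z \<circ> act q)) = l (R (\<lambda>z. f (z \<circ> act q)) x \<circ> act p)"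
        using R_act(2)[OF fq hx(1) lp] hx by simp
      also have "\<dots> = l (x \<circ> act p) * f (a \<circ> act q) + l (b \<circ> act p) * f (x \<circ> act q)"
        unfolding skew[OF fq] using dual_add[OF lp op_scale_in_B[OF x] op_scale_in_B[OF b]] dual_scale[OF lp x] dual_scale[OF lp b]
        by (simp add: mult.commute)
      finally show "pair hx (\<lambda>z. l (z \<circ> act p)) (\<lambda>z. f (z \<circ> act q)) =
        l (x \<circ> act p) * f (a \<circ> act q) + l (b \<circ> act p) * f (x \<circ> act q)" .
    qed
    also have "\<dots> = pair hy (\<lambda>z. l (x \<circ> z)) (\<lambda>z. f (a \<circ> z)) + pair hy (\<lambda>z. l (b \<circ> z)) (\<lambda>z. f (x \<circ> z))"
      by (simp add: pair_def tensor_sum_def distrib_left sum.distrib)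
    also have "\<dots> = l ((x \<circ> R (\<lambda>z. f (a \<circ> z)) y) + (b \<circ> R (\<lambda>z. f (x \<circ> z)) y))"
      using R_act(2)[OF d(3) hy(1) d(1)] R_act(2)[OF d(4) hy(1) d(2)] hy R_act(1)[OF d(3) hy(1)] R_act(1)[OF d(4) hy(1)] x b
      by (simp add: dual_add[OF l] comp_in_B)
    finally show "l (R f (x \<circ> y)) = l ((x \<circ> R (\<lambda>z. f (a \<circ> z)) y) + (b \<circ> R (\<lambda>z. f (x \<circ> z)) y))" .
  qed
  show "x = y" if a: "a \<in> B" "a \<noteq> 0" "\<And>k. k \<in> dual \<Longrightarrow> R k a = op_scale (k a) a" and "a \<circ> x = a \<circ> y" for a x y
  proof -
    obtain h where h: "h \<in> carrier H" "a = act h" using a(1) by (auto simp: B_def)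
    have Y: "a (Y u n v) = Y (a u) n (a v)" for u n v
      using grouplike_Y[OF h(1)] a(3) h(2) by simp
    \<comment> \<open>As \<open>a\<close> preserves all modes, its null space is mode invariant,
      hence zero because \<open>a \<noteq> 0\<close>. So \<open>a\<close> is injective and may be
      cancelled.\<close>
    define I where "I = {v. a v = 0}"
    have "mode_invariant I"
      unfolding mode_invariant_def I_def using a(1)
      by (auto intro!: subspaceI simp: B_hom Y Y_right.zero)
    moreover have "I \<noteq> UNIV" using a(2) by (auto simp: I_def fun_eq_iff)
    ultimately have I: "I = {0}" using simple_mode_invariant by blast
    show ?thesis
    proof
      fix v
      have "a (x v + scale (-1) (y v)) = 0"
        unfolding B_hom(1,2)[OF a(1)] using fun_cong[OF that(4), of v] by simp
      then have "x v + scale (-1) (y v) \<in> I" unfolding I_def by blast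
      then show "x v = y v" using I by simp
    qed
  qed
qed (auto simp: fun_eq_iff)

end

context complex_vector_space begin

text \<open>Meant for \<open>\<phi> a = single (a, b) 1\<close> and its mirror image, which are
  linear only modulo the tensor relations.\<close>

lemma linear_mod_finsum:
  fixes M :: "(complex, 'p, 'm) module_scheme" (structure)
  assumes M: "Module.module complex_field M" and W: "subspace W" and fin: "finite I"
    and x: "\<And>i. i \<in> I \<Longrightarrow> x i \<in> carrier M"
    and add: "\<And>a b. a \<in> carrier M \<Longrightarrow> b \<in> carrier M \<Longrightarrow> \<phi> (a \<oplus> b) - \<phi> a - \<phi> b \<in> W"
    and smult: "\<And>c a. a \<in> carrier M \<Longrightarrow> \<phi> (c \<odot> a) - scale c (\<phi> a) \<in> W"
  shows "\<phi> (\<Oplus>i\<in>I. c i \<odot> x i) - (\<Sum>i\<in>I. scale (c i) (\<phi> (x i))) \<in> W"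
proof -
  interpret M: Module.module complex_field M by fact
  have closed: "c \<odot> a \<in> carrier M" if "a \<in> carrier M" for c a
    using that by (intro M.smult_closed) (simp add: complex_field_def)
  show ?thesis
    using fin x
  proof (induction I rule: finite_induct)
    case empty
    have "0 \<odot> \<zero> = \<zero>" by (rule M.smult_r_null) (simp add: complex_field_def)
    then show ?case using smult[OF M.zero_closed, of 0] by simp
  next
    case (insert i I)
    let ?y = "c i \<odot> x i" and ?s = "\<Oplus>i\<in>I. c i \<odot> x i"
    have y: "?y \<in> carrier M" and s: "?s \<in> carrier M"
      using insert.prems closed by (auto intro!: M.finsum_closed)
    have eq: "(\<Oplus>i\<in>insert i I. c i \<odot> x i) = ?y \<oplus> ?s"
      using insert.hyps insert.prems closed by (intro M.finsum_insert) auto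
    have "(\<phi> (?y \<oplus> ?s) - \<phi> ?y - \<phi> ?s) + (\<phi> ?y - scale (c i) (\<phi> (x i))) +
        (\<phi> ?s - (\<Sum>i\<in>I. scale (c i) (\<phi> (x i)))) \<in> W"
      using insert.IH insert.prems by (intro subspace_add[OF W] add[OF y s] smult) auto
    then show ?case using insert.hyps unfolding eq by (simp add: algebra_simps)
  qed
qed

end

lemma single_finsum_left:
  assumes "Module.module complex_field M" "finite I" "\<And>i. i \<in> I \<Longrightarrow> x i \<in> carrier M" "b \<in> carrier N"
  shows "single (\<Oplus>\<^bsub>M\<^esub>i\<in>I. c i \<odot>\<^bsub>M\<^esub> x i, b) 1 - (\<Sum>i\<in>I. single (x i, b) (c i)) \<in> rel_span M N"
  using free_space.linear_mod_finsum[OF assms(1) free_vector_space.subspace_span assms(2,3),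
      where \<phi> = "\<lambda>a. single (a, b) 1" and c = c] single_bilinear[of M N, unfolded bilinear_mod_def] assms(4)
  by simp

lemma single_finsum_right:
  assumes "Module.module complex_field N" "finite I" "\<And>i. i \<in> I \<Longrightarrow> x i \<in> carrier N" "a \<in> carrier M"
  shows "single (a, \<Oplus>\<^bsub>N\<^esub>i\<in>I. c i \<odot>\<^bsub>N\<^esub> x i) 1 - (\<Sum>i\<in>I. single (a, x i) (c i)) \<in> rel_span M N"
  using free_space.linear_mod_finsum[OF assms(1) free_vector_space.subspace_span assms(2,3),
      where \<phi> = "\<lambda>b. single (a, b) 1" and c = c] single_bilinear[of M N, unfolded bilinear_mod_def] assms(4)
  by simp

lemma tensor_sum_free_id: "tensor_sum free_scale (\<lambda>a b. single (a, b) 1) f = f"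
  by (rule poly_mapping_eqI)
    (simp add: tensor_sum_def lookup_sum lookup_single when_def in_keys_iff if_distrib cong: if_cong)

lemma group_algebra_sel [simp]:
  "carrier (group_algebra G) = {f. keys f \<subseteq> carrier G}"
  "f \<oplus>\<^bsub>group_algebra G\<^esub> g = f + g"
  "\<zero>\<^bsub>group_algebra G\<^esub> = 0"
  "\<one>\<^bsub>group_algebra G\<^esub> = single \<one>\<^bsub>G\<^esub> 1"
  "c \<odot>\<^bsub>group_algebra G\<^esub> f = free_scale c f"
  "counit (group_algebra G) f = (\<Sum>x\<in>keys f. lookup f x)"
  "antipode (group_algebra G) f = (\<Sum>x\<in>keys f. single (inv\<^bsub>G\<^esub> x) (lookup f x))"
  "f \<otimes>\<^bsub>group_algebra G\<^esub> g = (\<Sum>x\<in>keys f. \<Sum>y\<in>keys g.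
       single (x \<otimes>\<^bsub>G\<^esub> y) (lookup f x * lookup g y))"
  "comult (group_algebra G) f = tensor_class (group_algebra G) (group_algebra G)
        (\<Sum>x\<in>keys f.
          single (single x 1, single x 1) (lookup f x))"
  by (simp_all add: group_algebra_def group_ring_def module.defs hopf.defs tensor_class_def formal_sums_def bilinearity_relations_def)

context simple_hopf_module_voa begin

abbreviation "G \<equiv> bialg.grouplikes"
abbreviation "coef \<equiv> bialg.coef"

lemma coef_linear: "coef g (x + y) = coef g x + coef g y" "coef g (op_scale c x) = c * coef g x" "coef g 0 = 0"
proof -
  interpret Vector_Spaces.linear op_scale "(*)" "coef g" by (rule bialg.coef(1))
  show "coef g (x + y) = coef g x + coef g y" "coef g (op_scale c x) = c * coef g x" "coef g 0 = 0"
    by (rule add scale zero)+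
qed

lemma act_expansion: "h \<in> carrier H \<Longrightarrow> act h = (\<Sum>g\<in>G. op_scale (coef g (act h)) g)"
  by (rule bialg.expansion[OF act_in_B])

section \<open>Inverses of grouplikes and the antipode\<close>

definition ginv :: "('v \<Rightarrow> 'v) \<Rightarrow> 'v \<Rightarrow> 'v" where
  "ginv g = (SOME h. h \<in> G \<and> g \<circ> h = id \<and> h \<circ> g = id)"

lemma ginv: "g \<in> G \<Longrightarrow> ginv g \<in> G" "g \<in> G \<Longrightarrow> g \<circ> ginv g = id" "g \<in> G \<Longrightarrow> ginv g \<circ> g = id"
  using someI_ex[of "\<lambda>h. h \<in> G \<and> g \<circ> h = id \<and> h \<circ> g = id"] bialg.grouplike_inverse[of g]
  unfolding ginv_def by blast+

lemma counit_coef: "h \<in> carrier H \<Longrightarrow> counit H h = (\<Sum>g\<in>G. coef g (act h))"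
proof -
  assume h: "h \<in> carrier H"
  have "e (act h) = e (\<Sum>g\<in>G. op_scale (coef g (act h)) g)"
    using act_expansion[OF h] by simp
  also have "\<dots> = (\<Sum>g\<in>G. coef g (act h) * e g)"
    by (rule dual_sum[OF e_dual bialg.grouplike_in])
  finally show ?thesis by (simp add: e_act h bialg.grouplike_e)
qed

text \<open>The linear extension of inversion of grouplikes, that is, the antipode which a group
  algebra structure on \<open>B\<close> must have.\<close>

definition op_inverse :: "('v \<Rightarrow> 'v) \<Rightarrow> 'v \<Rightarrow> 'v" where
  "op_inverse b = (\<Sum>g\<in>G. op_scale (coef g b) (ginv g))"

lemma op_inverse_linear: "op_inverse (x + y) = op_inverse x + op_inverse y"
  "op_inverse (op_scale c x) = op_scale c (op_inverse x)"
  by (simp_all add: op_inverse_def coef_linear ops.scale_left_distrib sum.distrib ops.scale_sum_right)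

lemma antipode_closed: "h \<in> carrier H \<Longrightarrow> antipode H h \<in> carrier H"
  and antipode_add: "\<lbrakk>h \<in> carrier H; k \<in> carrier H\<rbrakk> \<Longrightarrow> antipode H (h \<oplus> k) = antipode H h \<oplus> antipode H k"
  and antipode_smult: "h \<in> carrier H \<Longrightarrow> antipode H (c \<odot> h) = c \<odot> antipode H h"
  using H.antipode_linear by (auto simp: linear_maps_def)

lemma comp_linear:
  "a \<in> B \<Longrightarrow> a \<circ> (x + y) = (a \<circ> x) + (a \<circ> y)" "a \<in> B \<Longrightarrow> a \<circ> op_scale c x = op_scale c (a \<circ> x)"
  "(x + y) \<circ> z = (x \<circ> z) + (y \<circ> z)" "op_scale c x \<circ> z = op_scale c (x \<circ> z)"
  for x y z :: "'v \<Rightarrow> 'v"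
  by (auto simp: fun_eq_iff B_hom)

lemma comp_sum_left: "(\<Sum>i\<in>I. F i) \<circ> z = (\<Sum>i\<in>I. F i \<circ> z)" for z :: "'v \<Rightarrow> 'v" and F :: "_ \<Rightarrow> 'v \<Rightarrow> 'v"
  by (auto simp: fun_eq_iff sum_fun_apply)

lemma comp_sum_right: "a \<in> B \<Longrightarrow> a \<circ> (\<Sum>i\<in>I. F i) = (\<Sum>i\<in>I. a \<circ> F i)"
  by (rule additive.sum[of "(\<circ>) a"]) (auto simp: additive_def fun_eq_iff B_hom)

text \<open>Both \<open>act \<circ> S\<close> and \<open>op_inverse \<circ> act\<close> are convolution inverses of \<open>act\<close>.\<close>

lemma act_antipode:
  assumes h: "h \<in> carrier H"
  shows "act (antipode H h) = op_inverse (act h)"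
proof -
  let ?S = "antipode H"
  let ?\<theta> = "\<lambda>a b c. act (?S a) \<circ> act b \<circ> op_inverse (act c)"
  note F = H.comult_rep
  have left: "tensor_sum op_scale (\<lambda>a b. act (?S a) \<circ> act b) (H.comult_rep x) = op_scale (counit H x) id"
    if x: "x \<in> carrier H" for x
  proof -
    have "tensor_sum op_scale (\<lambda>a b. act (?S a) \<circ> act b) (H.comult_rep x) =
      tensor_sum op_scale (\<lambda>a b. act (?S a \<otimes> b)) (H.comult_rep x)"
      by (intro ops.tensor_sum_cong[OF F(3)[OF x]]) (simp add: act_mult' antipode_closed)
    also have "\<dots> = act (tensor_lift H (\<lambda>a b. ?S a \<otimes> b) (comult H x))"
      by (rule ops.hom_tensor_lift[symmetric, where \<Lambda> = act and M = H and N = H])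
        (auto intro!: bilinear_mod_0I A.module_axioms H.comult_closed[OF x] F x
          simp: act_add' act_smult' act_mult' antipode_closed antipode_add antipode_smult comp_linear act_in_B simp del: tensor_product_carrier)
    also have "\<dots> = op_scale (counit H x) id"
      by (simp add: H.antipode_left x act_smult' act_one')
    finally show ?thesis .
  qed
  \<comment> \<open>Expanding the second factor in the grouplikes leaves \<open>R (coef g)\<close>
    of the operator of \<open>y\<close> as first factor; by \<open>R_coef\<close> it is a multiple
    of \<open>g\<close>, and \<open>g\<close> cancels against its inverse.\<close>
  have right: "tensor_sum op_scale (\<lambda>b c. act b \<circ> op_inverse (act c)) (H.comult_rep y) = op_scale (counit H y) id"
    if y: "y \<in> carrier H" for y
  proof -
    have "tensor_sum op_scale (\<lambda>b c. act b \<circ> op_inverse (act c)) (H.comult_rep y) =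
      tensor_sum op_scale (\<lambda>b c. \<Sum>g\<in>G. op_scale (coef g (act c)) (act b) \<circ> ginv g) (H.comult_rep y)"
      by (intro ops.tensor_sum_cong[OF F(3)[OF y]])
        (simp add: op_inverse_def comp_sum_right comp_linear act_in_B)
    also have "\<dots> = (\<Sum>g\<in>G. R (coef g) (act y) \<circ> ginv g)"
      unfolding R_act(3)[OF bialg.coef_dual y] tensor_sum_def comp_sum_left comp_linear ops.scale_sum_right
      by (rule sum.swap)
    also have "\<dots> = (\<Sum>g\<in>G. op_scale (coef g (act y)) id)"
      by (intro sum.cong refl) (simp add: bialg.R_coef act_in_B y comp_linear ginv)
    finally show ?thesis by (simp add: counit_coef y ops.scale_sum_left)
  qed
  \<comment> \<open>Uniqueness of convolution inverses: the triple product
    \<open>S(h\<^sub>1) h\<^sub>2 (h\<^sub>3)\<inverse>\<close> is contracted from the right by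
    \<open>right\<close> and from the left by \<open>left\<close>.\<close>
  have "tensor_sum op_scale (\<lambda>x c. tensor_sum op_scale (\<lambda>a b. ?\<theta> a b c) (H.comult_rep x)) (H.comult_rep h)
    = tensor_sum op_scale (\<lambda>a y. tensor_sum op_scale (\<lambda>b c. ?\<theta> a b c) (H.comult_rep y)) (H.comult_rep h)"
    by (rule ops.coassoc_trilinear[OF H.hopf_algebra_axioms h])
      (auto intro!: bilinear_mod_0I simp: act_add' act_smult' antipode_closed antipode_add antipode_smult
        comp_linear act_in_B comp_in_B op_inverse_linear)
  also have "\<dots> = tensor_sum op_scale (\<lambda>a y. act (counit H y \<odot> ?S a)) (H.comult_rep h)"
  proof (intro ops.tensor_sum_cong[OF F(3)[OF h]])
    fix a y assume a: "a \<in> carrier H" and y: "y \<in> carrier H"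
    have "tensor_sum op_scale (\<lambda>b c. ?\<theta> a b c) (H.comult_rep y) =
      act (?S a) \<circ> tensor_sum op_scale (\<lambda>b c. act b \<circ> op_inverse (act c)) (H.comult_rep y)"
      unfolding tensor_sum_def using a by (simp add: comp_sum_right comp_linear act_in_B antipode_closed comp_assoc)
    then show "tensor_sum op_scale (\<lambda>b c. ?\<theta> a b c) (H.comult_rep y) =
      act (counit H y \<odot> ?S a)"
      using a y by (simp add: right comp_linear act_in_B antipode_closed act_smult')
  qed
  also have "\<dots> = tensor_sum op_scale (\<lambda>a y. act (?S (counit H y \<odot> a))) (H.comult_rep h)"
    by (intro ops.tensor_sum_cong[OF F(3)[OF h]]) (simp add: antipode_smult)
  also have "\<dots> = act (?S (tensor_lift H (\<lambda>a b. counit H b \<odot> a) (comult H h)))"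
    by (rule ops.hom_tensor_lift[symmetric, where \<Lambda> = "\<lambda>x. act (?S x)" and M = H and N = H])
      (auto intro!: bilinear_mod_0I A.module_axioms H.comult_closed[OF h] F h simp: act_add' act_smult' antipode_closed antipode_add antipode_smult
        H.counit_add H.counit_smult ops.scale_left_distrib ops.scale_right_distrib mult_ac simp del: tensor_product_carrier)
  also have "\<dots> = act (?S h)" by (simp add: H.counit_right h)
  also have "tensor_sum op_scale (\<lambda>x c. tensor_sum op_scale (\<lambda>a b. ?\<theta> a b c) (H.comult_rep x)) (H.comult_rep h)
    = tensor_sum op_scale (\<lambda>x c. op_inverse (act (counit H x \<odot> c))) (H.comult_rep h)"
  proof (intro ops.tensor_sum_cong[OF F(3)[OF h]])
    fix x c assume x: "x \<in> carrier H" and c: "c \<in> carrier H"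
    have "tensor_sum op_scale (\<lambda>a b. ?\<theta> a b c) (H.comult_rep x) =
      tensor_sum op_scale (\<lambda>a b. act (?S a) \<circ> act b) (H.comult_rep x) \<circ> op_inverse (act c)"
      unfolding tensor_sum_def by (simp add: comp_sum_left comp_linear)
    then show "tensor_sum op_scale (\<lambda>a b. ?\<theta> a b c) (H.comult_rep x) =
      op_inverse (act (counit H x \<odot> c))"
      using x c by (simp add: left comp_linear act_smult' op_inverse_linear)
  qed
  also have "\<dots> = op_inverse (act (tensor_lift H (\<lambda>a b. counit H a \<odot> b) (comult H h)))"
    by (rule ops.hom_tensor_lift[symmetric, where \<Lambda> = "\<lambda>x. op_inverse (act x)" and M = H and N = H])
      (auto intro!: bilinear_mod_0I A.module_axioms H.comult_closed[OF h] F h simp: act_add' act_smult' op_inverse_linear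
        H.counit_add H.counit_smult ops.scale_left_distrib ops.scale_right_distrib mult_ac simp del: tensor_product_carrier)
  also have "\<dots> = op_inverse (act h)" by (simp add: H.counit_left h)
  finally show ?thesis by simp
qed

section \<open>The group of grouplikes, copied to natural numbers, and its group algebra\<close>

definition num :: "('v \<Rightarrow> 'v) \<Rightarrow> nat" where "num = (SOME f. inj_on f G)"

lemma inj_num: "inj_on num G"
proof -
  have "\<exists>f :: _ \<Rightarrow> nat. inj_on f G"
    using ex_bij_betw_finite_nat[OF bialg.finite_grouplikes] bij_betw_imp_inj_on by blast
  from someI_ex[OF this] show ?thesis unfolding num_def .
qed

definition den :: "nat \<Rightarrow> 'v \<Rightarrow> 'v" where "den = inv_into G num"

lemma den_num [simp]: "g \<in> G \<Longrightarrow> den (num g) = g"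
  unfolding den_def using inj_num by simp

definition num_group :: "nat monoid" where
  "num_group = \<lparr>carrier = num ` G, monoid.mult = (\<lambda>i j. num (den i \<circ> den j)), one = num id\<rparr>"

lemma num_group_sel [simp]: "carrier num_group = num ` G" "\<one>\<^bsub>num_group\<^esub> = num id"
  "i \<otimes>\<^bsub>num_group\<^esub> j = num (den i \<circ> den j)"
  by (simp_all add: num_group_def)

lemma group_num_group: "group num_group"
proof (rule groupI)
  show "\<exists>y\<in>carrier num_group. y \<otimes>\<^bsub>num_group\<^esub> x = \<one>\<^bsub>num_group\<^esub>" if x: "x \<in> carrier num_group" for x
  proof -
    obtain g where "g \<in> G" "x = num g" using x by auto
    then show ?thesis by (intro bexI[of _ "num (ginv g)"]) (auto simp: ginv)
  qed
qed (use bialg.one_grouplike in \<open>auto simp: bialg.grouplike_mul comp_assoc\<close>)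

lemma inv_num: "g \<in> G \<Longrightarrow> inv\<^bsub>num_group\<^esub> (num g) = num (ginv g)"
  by (rule group.inv_equality[OF group_num_group]) (auto simp: ginv)

definition to_group_algebra :: "('v \<Rightarrow> 'v) \<Rightarrow> (nat \<Rightarrow>\<^sub>0 complex)" (\<open>\<Phi>\<close>) where
  "\<Phi> b = (\<Sum>g\<in>G. single (num g) (coef g b))"

abbreviation "GA \<equiv> group_algebra num_group"

lemma lookup_\<Phi>: "g \<in> G \<Longrightarrow> lookup (\<Phi> b) (num g) = coef g b"
  using bialg.finite_grouplikes inj_num
  by (simp add: to_group_algebra_def lookup_sum lookup_single when_def inj_on_eq_iff if_distrib cong: if_cong)

lemma keys_\<Phi>: "keys (\<Phi> b) \<subseteq> num ` G"
  unfolding to_group_algebra_def using keys_sum[of "\<lambda>g. single (num g) (coef g b)" G] by (auto split: if_splits)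

text \<open>Some coefficients may vanish, so \<open>keys\<close> can be smaller than the group;
  \<open>F i 0 = 0\<close> makes the missing terms harmless.\<close>

lemma sum_keys_\<Phi>:
  assumes "\<And>i. F i 0 = 0"
  shows "(\<Sum>i\<in>keys (\<Phi> b). F i (lookup (\<Phi> b) i)) = (\<Sum>g\<in>G. F (num g) (coef g b))"
proof -
  have "(\<Sum>i\<in>keys (\<Phi> b). F i (lookup (\<Phi> b) i)) =
    (\<Sum>i\<in>num ` G. F i (lookup (\<Phi> b) i))"
    using keys_\<Phi> bialg.finite_grouplikes assms by (intro sum.mono_neutral_left) (auto simp: in_keys_iff)
  also have "\<dots> = (\<Sum>g\<in>G. F (num g) (coef g b))"
    using inj_num by (subst sum.reindex) (auto simp: lookup_\<Phi>)
  finally show ?thesis .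
qed

lemma single_free_scale: "single i (c * d) = free_scale c (single i d)"
  by simp

lemma \<Phi>_linear: "\<Phi> (x + y) = \<Phi> x + \<Phi> y" "\<Phi> (op_scale c x) = free_scale c (\<Phi> x)"
  unfolding to_group_algebra_def coef_linear
  by (simp_all only: single_add sum.distrib single_free_scale free_vector_space.scale_sum_right)

lemma \<Phi>_sum: "\<Phi> (\<Sum>i\<in>I. F i) = (\<Sum>i\<in>I. \<Phi> (F i))"
  by (rule additive.sum[of \<Phi>]) (simp add: additive_def \<Phi>_linear(1))

lemma \<Phi>_grouplike: "g \<in> G \<Longrightarrow> \<Phi> g = single (num g) 1"
proof -
  assume g: "g \<in> G"
  have "\<Phi> g = (\<Sum>h\<in>{g}. single (num h) (coef h g))"
    unfolding to_group_algebra_def using g bialg.finite_grouplikes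
    by (intro sum.mono_neutral_right) (auto simp: bialg.coef(2)[OF g])
  then show ?thesis by (simp add: bialg.coef(2)[OF g])
qed

lemma \<Phi>_inj: "\<lbrakk>x \<in> B; y \<in> B; \<Phi> x = \<Phi> y\<rbrakk> \<Longrightarrow> x = y"
  using bialg.expansion[of x] bialg.expansion[of y] lookup_\<Phi>[of _ x] lookup_\<Phi>[of _ y]
  by (metis (no_types, lifting) sum.cong)

lemma \<Phi>_surj:
  assumes "keys f \<subseteq> num ` G"
  shows "\<exists>h\<in>carrier H. \<Phi> (act h) = f"
proof -
  define b where "b = (\<Sum>g\<in>G. op_scale (lookup f (num g)) g)"
  have "b \<in> B" unfolding b_def by (intro sum_in_B bialg.grouplike_in)
  moreover have "\<Phi> b = f"
  proof (rule poly_mapping_eqI)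
    fix i
    have b: "\<Phi> b = (\<Sum>g\<in>G. single (num g) (lookup f (num g)))"
      unfolding b_def \<Phi>_sum \<Phi>_linear by (intro sum.cong refl) (simp add: \<Phi>_grouplike)
    show "lookup (\<Phi> b) i = lookup f i"
    proof (cases "i \<in> num ` G")
      case True
      then show ?thesis unfolding b using bialg.finite_grouplikes inj_num
        by (auto simp: lookup_sum lookup_single when_def inj_on_eq_iff if_distrib cong: if_cong)
    next
      case False
      then show ?thesis using assms keys_\<Phi>[of b] by (metis in_keys_iff subsetD)
    qed
  qed
  ultimately show ?thesis by (auto simp: B_def)
qed

lemma \<Phi>_mult:
  assumes x: "x \<in> B" and y: "y \<in> B"
  shows "\<Phi> (x \<circ> y) = \<Phi> x \<otimes>\<^bsub>GA\<^esub> \<Phi> y"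
proof -
  have "x \<circ> y = (\<Sum>g\<in>G. op_scale (coef g x) g) \<circ> (\<Sum>h\<in>G. op_scale (coef h y) h)"
    using bialg.expansion x y by simp
  also have "\<dots> = (\<Sum>g\<in>G. \<Sum>h\<in>G. op_scale (coef g x * coef h y) (g \<circ> h))"
    by (simp add: comp_sum_left comp_sum_right comp_linear bialg.grouplike_in ops.scale_sum_right)
  finally have "\<Phi> (x \<circ> y) = (\<Sum>g\<in>G. \<Sum>h\<in>G. single (num (g \<circ> h)) (coef g x * coef h y))"
    by (simp add: \<Phi>_sum \<Phi>_linear \<Phi>_grouplike bialg.grouplike_mul)
  also have "\<dots> = (\<Sum>g\<in>G. \<Sum>j\<in>keys (\<Phi> y).
    single (num (g \<circ> den j)) (coef g x * lookup (\<Phi> y) j))"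
    by (subst sum_keys_\<Phi>) simp_all
  also have "\<dots> = (\<Sum>i\<in>keys (\<Phi> x). \<Sum>j\<in>keys (\<Phi> y).
    single (num (den i \<circ> den j)) (lookup (\<Phi> x) i * lookup (\<Phi> y) j))"
    by (subst sum_keys_\<Phi>) simp_all
  finally show ?thesis by simp
qed

lemma counit_\<Phi>: "h \<in> carrier H \<Longrightarrow> counit GA (\<Phi> (act h)) = counit H h"
  using sum_keys_\<Phi>[of "\<lambda>_ c. c" "act h"] by (simp add: counit_coef)

lemma antipode_\<Phi>: "h \<in> carrier H \<Longrightarrow> antipode GA (\<Phi> (act h)) = \<Phi> (act (antipode H h))"
  using sum_keys_\<Phi>[of "\<lambda>i c. single (inv\<^bsub>num_group\<^esub> i) c" "act h"]
  by (simp add: act_antipode op_inverse_def \<Phi>_sum \<Phi>_linear \<Phi>_grouplike ginv inv_num)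

lemma \<Phi>_act_linear_maps: "(\<lambda>h. \<Phi> (act h)) \<in> linear_maps H GA"
  using keys_\<Phi> by (auto simp: linear_maps_def act_add' act_smult' \<Phi>_linear)

lemma module_GA: "Module.module complex_field GA"
proof (rule moduleI)
  show "cring complex_field" by (rule A.R.is_cring)
  show "abelian_group GA"
  proof (rule abelian_groupI)
    show "\<exists>y\<in>carrier GA. y \<oplus>\<^bsub>GA\<^esub> x = \<zero>\<^bsub>GA\<^esub>" if "x \<in> carrier GA" for x
      using that by (intro bexI[of _ "- x"]) (auto simp: in_keys_iff)
  qed (use keys_add in \<open>force simp: add_ac\<close>)+
qed (auto simp: complex_field_def in_keys_iff free_vector_space.scale_left_distrib
    free_vector_space.scale_right_distrib)

lemma \<Phi>_finsum: "\<Phi> b = (\<Oplus>\<^bsub>GA\<^esub>g\<in>G. coef g b \<odot>\<^bsub>GA\<^esub> single (num g) 1)"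
proof -
  interpret GA: Module.module complex_field GA by (rule module_GA)
  show ?thesis
    using free_space.hom_finsum[OF GA.abelian_group_axioms, where \<Lambda> = "\<lambda>x. x" and I = G
        and F = "\<lambda>g. coef g b \<odot>\<^bsub>GA\<^esub> single (num g) 1"]
    by (simp add: to_group_algebra_def)
qed

text \<open>Modulo the relations both factors are expanded in the grouplikes. The coefficient at the
  pair of \<open>g\<close> and \<open>k\<close> is \<open>pair h (coef g) (coef k)\<close>, which by
  \<open>R_coef\<close> vanishes off the diagonal.\<close>

lemma comult_\<Phi>:
  assumes h: "h \<in> carrier H" and f: "f \<in> comult H h"
  shows "tensor_class GA GA (tensor_sum free_scale (\<lambda>a b. single (\<Phi> (act a), \<Phi> (act b)) 1) f) =
    comult GA (\<Phi> (act h))"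
proof -
  let ?s = "\<lambda>g k. single (single (num g) (1 :: complex), single (num k) (1 :: complex))"
  let ?W = "rel_span GA GA"
  have one: "single (\<Phi> x, \<Phi> y) 1 - (\<Sum>g\<in>G. \<Sum>k\<in>G. ?s g k (coef g x * coef k y)) \<in> ?W" for x y
  proof -
    have num: "single (num g) 1 \<in> carrier GA" if "g \<in> G" for g using that by simp
    have \<Phi>: "\<Phi> z \<in> carrier GA" for z using keys_\<Phi> by simp
    have "single (\<Phi> x, \<Phi> y) 1 - (\<Sum>g\<in>G. single (single (num g) 1, \<Phi> y) (coef g x)) \<in> ?W"
      using single_finsum_left[where c = "\<lambda>g. coef g x" and x = "\<lambda>g. single (num g) 1",
          OF module_GA bialg.finite_grouplikes num \<Phi>[of y]]
      unfolding \<Phi>_finsum[symmetric] .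
    moreover have "(\<Sum>g\<in>G. free_scale (coef g x) (single (single (num g) 1, \<Phi> y) 1 -
        (\<Sum>k\<in>G. ?s g k (coef k y)))) \<in> ?W"
    proof (intro free_vector_space.span_sum free_vector_space.span_scale)
      fix g assume "g \<in> G"
      then show "single (single (num g) 1, \<Phi> y) 1 - (\<Sum>k\<in>G. ?s g k (coef k y)) \<in> ?W"
        using single_finsum_right[where c = "\<lambda>k. coef k y" and x = "\<lambda>k. single (num k) 1",
            OF module_GA bialg.finite_grouplikes num num]
        unfolding \<Phi>_finsum[symmetric] by simp
    qed
    ultimately have "single (\<Phi> x, \<Phi> y) 1 - (\<Sum>g\<in>G. single (single (num g) 1, \<Phi> y) (coef g x))
      + (\<Sum>g\<in>G. free_scale (coef g x) (single (single (num g) 1, \<Phi> y) 1 -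
        (\<Sum>k\<in>G. ?s g k (coef k y)))) \<in> ?W" by (rule free_vector_space.span_add)
    then show ?thesis
      by (simp add: free_vector_space.scale_right_diff_distrib sum_subtractf free_vector_space.scale_sum_right)
  qed
  let ?E = "\<lambda>a b. \<Sum>g\<in>G. \<Sum>k\<in>G. ?s g k (coef g (act a) * coef k (act b))"
  have "tensor_sum free_scale (\<lambda>a b. single (\<Phi> (act a), \<Phi> (act b)) 1) f - tensor_sum free_scale ?E f \<in> ?W"
    unfolding tensor_sum_def sum_subtractf[symmetric] free_vector_space.scale_right_diff_distrib[symmetric]
    by (intro free_vector_space.span_sum free_vector_space.span_scale one)
  moreover have "tensor_sum free_scale ?E f = (\<Sum>g\<in>G. ?s g g (coef g (act h)))"
  proof -
    have "tensor_sum free_scale ?E f = (\<Sum>p\<in>keys f. \<Sum>g\<in>G. \<Sum>k\<in>G.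
        ?s g k (lookup f p * (coef g (act (fst p)) * coef k (act (snd p)))))"
      unfolding tensor_sum_def by (simp add: free_vector_space.scale_sum_right)
    also have "\<dots> = (\<Sum>g\<in>G. \<Sum>k\<in>G. \<Sum>p\<in>keys f.
        ?s g k (lookup f p * (coef g (act (fst p)) * coef k (act (snd p)))))"
      by (subst sum.swap) (intro sum.cong refl sum.swap)
    also have "\<dots> = (\<Sum>g\<in>G. \<Sum>k\<in>G. ?s g k (pair h (coef g) (coef k)))"
    proof (intro sum.cong refl)
      fix g k
      have *: "(\<Sum>p\<in>I. ?s g k (F p)) = ?s g k (\<Sum>p\<in>I. F p)" for I and F :: "_ \<Rightarrow> complex"
        by (induction I rule: infinite_finite_induct) (auto simp: single_add)
      show "(\<Sum>p\<in>keys f. ?s g k (lookup f p * (coef g (act (fst p)) * coef k (act (snd p))))) =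
        ?s g k (pair h (coef g) (coef k))"
        unfolding * pair_rep[OF bialg.coef_dual bialg.coef_dual h f] tensor_sum_def by simp
    qed
    also have "\<dots> = (\<Sum>g\<in>G. \<Sum>k\<in>G. if k = g then ?s g g (coef g (act h)) else 0)"
    proof (intro sum.cong refl)
      fix g k assume g: "g \<in> G" and k: "k \<in> G"
      have "pair h (coef g) (coef k) = coef g (op_scale (coef k (act h)) k)"
        using R_act(2)[OF bialg.coef_dual h bialg.coef_dual] bialg.R_coef[OF act_in_B[OF h] k] by metis
      then show "?s g k (pair h (coef g) (coef k)) = (if k = g then ?s g g (coef g (act h)) else 0)"
        by (simp add: coef_linear bialg.coef(2)[OF k])
    qed
    also have "\<dots> = (\<Sum>g\<in>G. ?s g g (coef g (act h)))"
      using bialg.finite_grouplikes by (intro sum.cong refl) simp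
    finally show ?thesis .
  qed
  ultimately have "tensor_class GA GA (tensor_sum free_scale (\<lambda>a b. single (\<Phi> (act a), \<Phi> (act b)) 1) f) =
    tensor_class GA GA (\<Sum>g\<in>G. ?s g g (coef g (act h)))"
    by (intro tensor_class_eq) simp
  then show ?thesis
    using sum_keys_\<Phi>[of "\<lambda>i c. single (single i (1 :: complex), single i (1 :: complex)) c" "act h"]
    by simp
qed

lemma is_group_algebra_faithful:
  assumes "\<And>h. h \<in> carrier H \<Longrightarrow> act h = 0 \<Longrightarrow> h = \<zero>"
  shows "hopf_iso H GA \<noteq> {}"
proof -
  let ?\<phi> = "\<lambda>h. \<Phi> (act h)"
  have inj: "inj_on ?\<phi> (carrier H)"
  proof (rule inj_onI)
    fix x y assume x: "x \<in> carrier H" and y: "y \<in> carrier H" and "\<Phi> (act x) = \<Phi> (act y)"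
    then have "act x = act y" using \<Phi>_inj act_in_B by blast
    then have "act (x \<oplus> ((-1) \<odot> y)) = 0" using x y by (simp add: act_add' act_smult')
    then have "x \<oplus> ((-1) \<odot> y) = \<zero>" using assms x y by simp
    \<comment> \<open>Faithfulness also shows that \<open>(-1) \<odot> y\<close> is the additive
      inverse of \<open>y\<close>, since the sum acts as zero.\<close>
    moreover have "(-1) \<odot> y \<oplus> y = \<zero>"
      using y by (intro assms) (auto simp: act_add' act_smult')
    ultimately show "x = y"
      using x y by (metis A.add.m_closed A.add.inv_closed A.minus_equality A.minus_minus A.add.m_comm H_smult_closed)
  qed
  have "?\<phi> \<in> ring_iso H GA"
  proof (rule ring_iso_memI)
    show "bij_betw ?\<phi> (carrier H) (carrier GA)"
      using inj keys_\<Phi> \<Phi>_surj by (force simp: bij_betw_def)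
  qed (use keys_\<Phi> in \<open>auto simp: act_mult' \<Phi>_mult act_in_B act_add' \<Phi>_linear act_one' \<Phi>_grouplike bialg.one_grouplike simp del: group_algebra_sel(8)\<close>)
  moreover have "comult GA (?\<phi> x) = tensor_map GA GA ?\<phi> ?\<phi> (comult H x)" if x: "x \<in> carrier H" for x
    using tensor_map_eq_rep[OF H.comult_closed[OF x] H.comult_rep(1)[OF x] \<Phi>_act_linear_maps \<Phi>_act_linear_maps]
      comult_\<Phi>[OF x H.comult_rep(1)[OF x]] by simp
  ultimately have "?\<phi> \<in> hopf_iso H GA"
    using \<Phi>_act_linear_maps counit_\<Phi> antipode_\<Phi> by (auto simp: hopf_iso_def simp del: group_algebra_sel)
  then show ?thesis by blast
qed

section \<open>The kernel as a Hopf ideal\<close>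

lemma kernel_iff: "h \<in> kernel \<longleftrightarrow> h \<in> carrier H \<and> act h = 0"
  by (auto simp: kernel_def fun_eq_iff)

lemma act_minus: "h \<in> carrier H \<Longrightarrow> act (\<ominus> h) = - act h"
proof -
  assume h: "h \<in> carrier H"
  then have "act (h \<oplus> \<ominus> h) = act h + act (\<ominus> h)" by (simp add: act_add')
  then show ?thesis using h by (simp add: A.r_neg act_0 eq_neg_iff_add_eq_0 add.commute)
qed

lemma ideal_kernel: "ideal kernel H"
proof (rule idealI)
  show "ring H" ..
  show "subgroup kernel (add_monoid H)"
  proof (rule group.subgroupI)
    show "group (add_monoid H)" by (rule A.add.is_group)
    show "kernel \<noteq> {}" using act_0 kernel_iff[of "\<zero>"] by auto
  qed (auto simp: kernel_iff act_add' act_minus simp flip: a_inv_def)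
  show "x \<otimes> a \<in> kernel" "a \<otimes> x \<in> kernel" if "a \<in> kernel" "x \<in> carrier H" for a x
    using that by (auto simp: kernel_iff act_mult' fun_eq_iff act_hom)
qed

definition lift :: "('v \<Rightarrow> 'v) \<Rightarrow> 'h" where
  "lift g = (SOME h. h \<in> carrier H \<and> act h = g)"

lemma lift: "g \<in> B \<Longrightarrow> lift g \<in> carrier H" "g \<in> B \<Longrightarrow> act (lift g) = g"
  using someI_ex[of "\<lambda>h. h \<in> carrier H \<and> act h = g"] unfolding lift_def B_def by blast+

lemma tensor_class_add_in:
  assumes "f1 \<in> formal_sums H H" "f2 \<in> formal_sums H H" "keys f1 \<subseteq> X1 \<times> Y1" "keys f2 \<subseteq> X2 \<times> Y2"
  shows "tensor_class H H (f1 + f2) \<in> tensor_subspace H H X1 Y1 <+>\<^bsub>tensor_product H H\<^esub> tensor_subspace H H X2 Y2"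
  using assms tensor_product_add[OF assms(1,2)] unfolding set_add_def' tensor_subspace_def by blast

text \<open>Splitting the first tensor factors along the lifts of the grouplikes leaves, for each grouplike
  \<open>g\<close>, the second factor \<open>\<Sum> coef g (h\<^sub>1) h\<^sub>2\<close>, which acts as zero when \<open>h\<close> does.\<close>

lemma comult_kernel:
  assumes "h \<in> kernel"
  shows "comult H h \<in> tensor_subspace H H (carrier H) kernel <+>\<^bsub>tensor_product H H\<^esub> tensor_subspace H H kernel (carrier H)"
proof -
  have h: "h \<in> carrier H" "act h = 0" using assms by (auto simp: kernel_iff)
  note F = H.comult_rep[OF h(1)]
  let ?f = "H.comult_rep h" and ?W = "rel_span H H"
  let ?K = "keys ?f" and ?c = "lookup ?f"
  note bil = single_bilinear[of H H, unfolded bilinear_mod_def]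
  have Kc: "fst p \<in> carrier H" "snd p \<in> carrier H" if "p \<in> ?K" for p using that F(3) by auto
  have lift_G: "lift g \<in> carrier H" "act (lift g) = g" if "g \<in> G" for g
    using lift bialg.grouplike_in that by auto
  define rest where "rest a = (\<Oplus>g\<in>G. (- coef g (act a)) \<odot> lift g)" for a
  have rest: "rest a \<in> carrier H" for a
    unfolding rest_def using lift_G by (intro A.finsum_closed) auto
  \<comment> \<open>\<open>k a\<close> is \<open>a\<close> minus the lift of its expansion in
    grouplikes, hence acts as zero; the sign is inside \<open>rest\<close>.\<close>
  define k where "k a = a \<oplus> rest a" for a
  have k: "k a \<in> kernel" if a: "a \<in> carrier H" for a
  proof -
    have "act (rest a) = (\<Sum>g\<in>G. act ((- coef g (act a)) \<odot> lift g))"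
      unfolding rest_def using lift_G by (intro act_finsum) auto
    also have "\<dots> = (\<Sum>g\<in>G. op_scale (- 1) (op_scale (coef g (act a)) g))"
      using lift_G by (intro sum.cong refl) (simp add: act_smult')
    also have "\<dots> = op_scale (-1) (act a)"
      unfolding ops.scale_sum_right[symmetric] act_expansion[OF a, symmetric] ..
    finally show ?thesis using a rest by (simp add: k_def kernel_iff act_add')
  qed
  let ?D = "\<lambda>a b. single (a, b) 1 -
      (single (k a, b) 1 + (\<Sum>g\<in>G. single (lift g, b) (coef g (act a))))"
  have split: "?D a b \<in> ?W"
    if a: "a \<in> carrier H" and b: "b \<in> carrier H" for a b
  proof -
    have "single (k a, b) 1 - single (a, b) 1 - single (rest a, b) 1 \<in> ?W"
      unfolding k_def using bil a b rest by blast
    moreover have "single (rest a, b) 1 - (\<Sum>g\<in>G. single (lift g, b) (- coef g (act a))) \<in> ?W"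
      unfolding rest_def using lift_G b by (intro single_finsum_left A.module_axioms bialg.finite_grouplikes)
    ultimately have "- ((single (k a, b) 1 - single (a, b) 1 - single (rest a, b) 1) +
      (single (rest a, b) 1 - (\<Sum>g\<in>G. single (lift g, b) (- coef g (act a))))) \<in> ?W"
      by (intro free_vector_space.span_neg free_vector_space.span_add)
    then show ?thesis by (simp add: single_uminus sum_negf algebra_simps)
  qed
  define y where "y g = (\<Oplus>p\<in>?K. (?c p * coef g (act (fst p))) \<odot> snd p)" for g
  have y: "y g \<in> kernel" for g
  proof -
    have "act (y g) = (\<Sum>p\<in>?K. act ((?c p * coef g (act (fst p))) \<odot> snd p))"
      unfolding y_def using Kc by (intro act_finsum) auto
    also have "\<dots> = (\<Sum>p\<in>?K. op_scale (?c p * coef g (act (fst p))) (act (snd p)))"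
      using Kc by (intro sum.cong refl) (simp add: act_smult')
    also have "\<dots> = 0"
    proof (rule dual_separates)
      fix l assume l: "l \<in> dual"
      have "l (\<Sum>p\<in>?K. op_scale (?c p * coef g (act (fst p))) (act (snd p))) =
        (\<Sum>p\<in>?K. ?c p * coef g (act (fst p)) * l (act (snd p)))"
        using Kc by (intro dual_sum[OF l] act_in_B)
      also have "\<dots> = pair h (coef g) l"
        by (simp add: pair_def tensor_sum_def mult.assoc)
      also have "\<dots> = 0" using h l bialg.coef_dual by (intro pair_kernel)
      finally show "l (\<Sum>p\<in>?K. op_scale (?c p * coef g (act (fst p))) (act (snd p))) = l 0"
        using dual_0[OF l] by simp
    qed
    finally show ?thesis unfolding kernel_iff y_def using Kc by (auto intro!: A.finsum_closed)
  qed
  \<comment> \<open>Modulo the relations \<open>?f\<close> equals \<open>f2 + f3\<close>, where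
    \<open>f2\<close> has its first factors in the kernel and \<open>f3\<close> has lifts of
    grouplikes there. Collecting the second factors of \<open>f3\<close> for each \<open>g\<close>
    gives \<open>f1\<close>, with second factors \<open>y g\<close> in the kernel.\<close>
  define f1 where "f1 = (\<Sum>g\<in>G. single (lift g, y g) (1 :: complex))"
  define f2 where "f2 = tensor_sum free_scale (\<lambda>a b. single (k a, b) 1) ?f"
  define f3 where "f3 = (\<Sum>g\<in>G. \<Sum>p\<in>?K. single (lift g, snd p) (?c p * coef g (act (fst p))))"
  have ker_carrier: "kernel \<subseteq> carrier H" by (auto simp: kernel_iff)
  have keys1: "keys f1 \<subseteq> carrier H \<times> kernel"
    using keys_sum[of "\<lambda>g. single (lift g, y g) (1 :: complex)" G] lift_G y unfolding f1_def by auto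
  have keys2: "keys f2 \<subseteq> kernel \<times> carrier H"
  proof -
    have "keys f2 \<subseteq> (\<Union>p\<in>?K. {(k (fst p), snd p)})"
      unfolding f2_def tensor_sum_def
      using keys_sum[of "\<lambda>p. free_scale (?c p) (single (k (fst p), snd p) 1)" ?K] by (auto split: if_splits)
    then show ?thesis using Kc k by auto
  qed
  have "tensor_sum free_scale (\<lambda>a b. ?D a b) ?f \<in> ?W"
    unfolding tensor_sum_def using Kc
    by (intro free_vector_space.span_sum free_vector_space.span_scale split)
  also have "tensor_sum free_scale (\<lambda>a b. ?D a b) ?f =
    tensor_sum free_scale (\<lambda>a b. single (a, b) 1) ?f - (f2 +
     (\<Sum>p\<in>?K. \<Sum>g\<in>G. single (lift g, snd p) (?c p * coef g (act (fst p)))))"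
    unfolding f2_def tensor_sum_def
    by (simp add: free_vector_space.scale_right_diff_distrib free_vector_space.scale_right_distrib
        free_vector_space.scale_sum_right sum_subtractf sum.distrib)
  also have "\<dots> = ?f - (f2 + f3)"
    unfolding f3_def tensor_sum_free_id by (subst sum.swap) simp
  finally have "?f - (f2 + f3) \<in> ?W" .
  moreover have "(\<Sum>g\<in>G. single (lift g, y g) 1 - (\<Sum>p\<in>?K. single (lift g, snd p) (?c p * coef g (act (fst p))))) \<in> ?W"
    unfolding y_def using lift_G Kc
    by (intro free_vector_space.span_sum single_finsum_right A.module_axioms finite_keys) auto
  then have "f1 - f3 \<in> ?W" by (simp add: f1_def f3_def sum_subtractf)
  ultimately have "(?f - (f2 + f3)) - (f1 - f3) \<in> ?W" by (rule free_vector_space.span_diff)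
  then have "?f - (f1 + f2) \<in> ?W" by (simp add: algebra_simps)
  then have "comult H h = tensor_class H H (f1 + f2)"
    using tensor_class_eq F(4) by metis
  moreover have "f1 \<in> formal_sums H H" "f2 \<in> formal_sums H H"
    using keys1 keys2 ker_carrier unfolding formal_sums_def by blast+
  ultimately show ?thesis using tensor_class_add_in keys1 keys2 by simp
qed

text \<open>Counit and antipode preserve the kernel because \<open>counit_coef\<close> and
  \<open>act_antipode\<close> express them through the operator of \<open>h\<close>.\<close>

lemma hopf_ideal_kernel: "hopf_ideal kernel H"
  unfolding hopf_ideal_def
proof (intro conjI allI ballI)
  show "ideal kernel H" by (rule ideal_kernel)
  show "c \<odot> x \<in> kernel" if "x \<in> kernel" for c x using that by (auto simp: kernel_iff act_smult')
  show "comult H ` kernel \<subseteq> tensor_subspace H H (carrier H) kernel <+>\<^bsub>tensor_product H H\<^esub> tensor_subspace H H kernel (carrier H)"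
    using comult_kernel by blast
  show "counit H ` kernel \<subseteq> {0}"
    by (auto simp: kernel_iff counit_coef coef_linear)
  show "antipode H ` kernel \<subseteq> kernel"
    by (auto simp: kernel_iff antipode_closed act_antipode op_inverse_def coef_linear)
qed

section \<open>The quotient by the kernel\<close>

lemma kernel_coset: "a \<in> carrier H \<Longrightarrow> kernel +> a = {x \<in> carrier H. act x = act a}"
proof (intro equalityI subsetI)
  fix x assume a: "a \<in> carrier H" and "x \<in> {x \<in> carrier H. act x = act a}"
  then have x: "x \<in> carrier H" "act x = act a" by auto
  have "x \<oplus> \<ominus> a \<in> kernel" using a x by (simp add: kernel_iff act_add' act_minus)
  moreover have "x = x \<oplus> \<ominus> a \<oplus> a" using a x by (simp add: A.a_assoc A.l_neg)
  ultimately show "x \<in> kernel +> a" unfolding a_r_coset_def' by blast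
qed (auto simp: a_r_coset_def' kernel_iff act_add')

abbreviation "Q \<equiv> quotient_hopf H kernel"
abbreviation "QA \<equiv> quotient_algebra H kernel"
abbreviation "proj \<equiv> (\<lambda>a. kernel +> a)"

lemma some_coset:
  assumes "a \<in> carrier H"
  shows "(SOME x. x \<in> proj a) \<in> carrier H" "act (SOME x. x \<in> proj a) = act a"
proof -
  have "a \<in> proj a" using assms by (simp add: kernel_coset)
  then have "(SOME x. x \<in> proj a) \<in> proj a" by (rule someI)
  then show "(SOME x. x \<in> proj a) \<in> carrier H" "act (SOME x. x \<in> proj a) = act a"
    using assms by (auto simp: kernel_coset)
qed

lemma quotient_sel:
  "carrier QA = proj ` carrier H" "carrier Q = proj ` carrier H"
  "\<lbrakk>a \<in> carrier H; b \<in> carrier H\<rbrakk> \<Longrightarrow> proj a \<oplus>\<^bsub>QA\<^esub> proj b = proj (a \<oplus> b)"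
  "\<lbrakk>a \<in> carrier H; b \<in> carrier H\<rbrakk> \<Longrightarrow> proj a \<oplus>\<^bsub>Q\<^esub> proj b = proj (a \<oplus> b)"
  "\<lbrakk>a \<in> carrier H; b \<in> carrier H\<rbrakk> \<Longrightarrow> proj a \<otimes>\<^bsub>Q\<^esub> proj b = proj (a \<otimes> b)"
  "\<one>\<^bsub>Q\<^esub> = proj \<one>"
  "a \<in> carrier H \<Longrightarrow> c \<odot>\<^bsub>QA\<^esub> proj a = proj (c \<odot> a)"
  "a \<in> carrier H \<Longrightarrow> c \<odot>\<^bsub>Q\<^esub> proj a = proj (c \<odot> a)"
proof -
  interpret I: ideal kernel H by (rule ideal_kernel)
  show "carrier QA = proj ` carrier H" "carrier Q = proj ` carrier H"
    by (auto simp: quotient_hopf_def quotient_algebra_def ring.defs module.defs hopf.defs FactRing_def A_RCOSETS_def'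
        a_r_coset_def)
  show "\<lbrakk>a \<in> carrier H; b \<in> carrier H\<rbrakk> \<Longrightarrow> proj a \<oplus>\<^bsub>QA\<^esub> proj b = proj (a \<oplus> b)"
    "\<lbrakk>a \<in> carrier H; b \<in> carrier H\<rbrakk> \<Longrightarrow> proj a \<oplus>\<^bsub>Q\<^esub> proj b = proj (a \<oplus> b)"
    by (simp_all add: quotient_hopf_def quotient_algebra_def ring.defs module.defs hopf.defs FactRing_def I.a_rcos_sum)
  show "\<lbrakk>a \<in> carrier H; b \<in> carrier H\<rbrakk> \<Longrightarrow> proj a \<otimes>\<^bsub>Q\<^esub> proj b = proj (a \<otimes> b)"
    by (simp add: quotient_hopf_def quotient_algebra_def ring.defs module.defs hopf.defs FactRing_def I.rcoset_mult_add)
  show "\<one>\<^bsub>Q\<^esub> = proj \<one>"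
    by (simp add: quotient_hopf_def quotient_algebra_def ring.defs module.defs hopf.defs FactRing_def)
  have *: "(\<Union>x\<in>proj a. proj (c \<odot> x)) = proj (c \<odot> a)" if a: "a \<in> carrier H" for a c
  proof -
    have "proj (c \<odot> x) = proj (c \<odot> a)" if "x \<in> proj a" for x
      using that a by (auto simp: kernel_coset act_smult')
    moreover have "a \<in> proj a" using a by (simp add: kernel_coset)
    ultimately show ?thesis by blast
  qed
  show "a \<in> carrier H \<Longrightarrow> c \<odot>\<^bsub>QA\<^esub> proj a = proj (c \<odot> a)"
    "a \<in> carrier H \<Longrightarrow> c \<odot>\<^bsub>Q\<^esub> proj a = proj (c \<odot> a)"
    using * by (simp_all add: quotient_hopf_def quotient_algebra_def ring.defs module.defs hopf.defs)
qed

lemma is_group_algebra_quotient: "hopf_iso Q GA \<noteq> {}"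
proof -
  define \<phi> where "\<phi> X = \<Phi> (act (SOME x. x \<in> X))" for X
  have \<phi>: "\<phi> (proj a) = \<Phi> (act a)" if "a \<in> carrier H" for a
    unfolding \<phi>_def using some_coset[OF that] by simp
  have \<phi>_keys: "keys (\<phi> X) \<subseteq> num ` G" for X unfolding \<phi>_def by (rule keys_\<Phi>)
  have bij: "bij_betw \<phi> (carrier Q) (carrier GA)"
    unfolding bij_betw_def
  proof
    show "inj_on \<phi> (carrier Q)"
    proof (rule inj_onI)
      fix X X' assume "X \<in> carrier Q" "X' \<in> carrier Q" and eq: "\<phi> X = \<phi> X'"
      then obtain a b where ab: "a \<in> carrier H" "b \<in> carrier H" and X: "X = proj a" "X' = proj b"
        by (auto simp: quotient_sel(2))
      have "act a = act b" using eq ab unfolding X by (intro \<Phi>_inj act_in_B) (simp_all add: \<phi>)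
      then show "X = X'" using ab unfolding X by (simp add: kernel_coset)
    qed
    show "\<phi> ` carrier Q = carrier GA"
    proof (intro equalityI subsetI)
      fix f assume "f \<in> carrier GA"
      then obtain h where "h \<in> carrier H" "\<Phi> (act h) = f" using \<Phi>_surj by auto
      then have "f = \<phi> (proj h)" "proj h \<in> carrier Q" using \<phi> by (auto simp: quotient_sel(2))
      then show "f \<in> \<phi> ` carrier Q" by blast
    qed (use \<phi>_keys in auto)
  qed
  have "\<phi> \<in> ring_iso Q GA"
    by (rule ring_iso_memI[OF _ _ _ _ bij])
      (use \<phi>_keys in \<open>auto simp: quotient_sel \<phi> act_mult' \<Phi>_mult act_in_B act_add' \<Phi>_linear act_one'
        \<Phi>_grouplike bialg.one_grouplike simp del: group_algebra_sel(8)\<close>)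
  \<comment> \<open>Linearity on \<open>Q\<close> is part of \<open>hopf_iso\<close>, whereas the
    comultiplication of \<open>Q\<close> takes its values in tensors over \<open>QA\<close>.\<close>
  moreover have lin: "\<phi> \<in> linear_maps Q GA" "\<phi> \<in> linear_maps QA GA"
    using \<phi>_keys by (auto simp: linear_maps_def quotient_sel \<phi> act_add' act_smult' \<Phi>_linear)
  moreover have "comult GA (\<phi> X) = tensor_map GA GA \<phi> \<phi> (comult Q X)" and "counit GA (\<phi> X) = counit Q X"
    and "antipode GA (\<phi> X) = \<phi> (antipode Q X)" if X: "X \<in> carrier Q" for X
  proof -
    define x where "x = (SOME x. x \<in> X)"
    have x: "x \<in> carrier H" and \<phi>X: "\<phi> X = \<Phi> (act x)"
      using X some_coset(1) by (auto simp: quotient_sel x_def \<phi>_def)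
    have Q: "comult Q X = tensor_map QA QA proj proj (comult H x)" "counit Q X = counit H x"
      "antipode Q X = proj (antipode H x)"
      by (simp_all add: quotient_hopf_def x_def hopf.defs module.defs)
    have proj: "proj \<in> linear_maps H QA" by (auto simp: linear_maps_def quotient_sel)
    note F = H.comult_rep[OF x]
    let ?g = "tensor_sum free_scale (\<lambda>a b. single (proj a, proj b) 1) (H.comult_rep x)"
    have g: "?g \<in> formal_sums QA QA"
      by (intro formal_sums_tensor_sum[OF F(3)] formal_sums_single) (auto simp: quotient_sel)
    \<comment> \<open>A concrete formal sum over cosets, so that \<open>\<phi>\<close> can be
      applied termwise without choosing another representative of the tensor.\<close>
    have Qg: "comult Q X = tensor_class QA QA ?g"
      unfolding Q by (rule tensor_map_eq_rep[OF H.comult_closed[OF x] F(1) proj proj])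
    have "tensor_map GA GA \<phi> \<phi> (comult Q X) =
      tensor_class GA GA (tensor_sum free_scale (\<lambda>a b. single (\<phi> a, \<phi> b) 1) ?g)"
      unfolding Qg using g mem_tensor_class[OF g] lin
      by (intro tensor_map_eq_rep[where M = QA and N = QA]) auto
    also have "tensor_sum free_scale (\<lambda>a b. single (\<phi> a, \<phi> b) 1) ?g =
      tensor_sum free_scale (\<lambda>a b. single (\<Phi> (act a), \<Phi> (act b)) 1) (H.comult_rep x)"
      unfolding free_space.tensor_sum_compose free_space.tensor_sum_single
      by (intro free_space.tensor_sum_cong[OF F(3)]) (simp add: \<phi>)
    finally show "comult GA (\<phi> X) = tensor_map GA GA \<phi> \<phi> (comult Q X)"
      unfolding \<phi>X comult_\<Phi>[OF x F(1)] by simp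
    show "counit GA (\<phi> X) = counit Q X" unfolding Q \<phi>X by (rule counit_\<Phi>[OF x])
    show "antipode GA (\<phi> X) = \<phi> (antipode Q X)"
      unfolding Q \<phi>X using antipode_\<Phi>[OF x] \<phi>[OF antipode_closed[OF x]] by simp
  qed
  ultimately have "\<phi> \<in> hopf_iso Q GA" by (simp add: hopf_iso_def del: group_algebra_sel)
  then show ?thesis by blast
qed

lemma finite_num_group: "finite (carrier num_group)"
  by (simp add: bialg.finite_grouplikes)

end

theorem corollary6p6:
  fixes H :: "'h hopf"
    and scale :: "complex \<Rightarrow> 'v :: ab_group_add \<Rightarrow> 'v"
    and act :: "'h \<Rightarrow> 'v \<Rightarrow> 'v"
    and Y :: "'v \<Rightarrow> int \<Rightarrow> 'v \<Rightarrow> 'v"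
    and vac \<omega> :: 'v
    and V :: "int \<Rightarrow> 'v set"
    and K :: "'h set"
  assumes "hopf_algebra H"
    and "finite_dimensional H"
    and "vertex_operator_algebra scale Y vac \<omega> V"
    and "vertex_operator_algebra.simple scale Y"
    and "hopf_module_voa H scale act Y vac \<omega> V"
    and "K = algebra_rep.kernel H act"
  shows "(K = {\<zero>\<^bsub>H\<^esub>} \<longrightarrow> is_group_algebra H) \<and>
    (K \<noteq> {\<zero>\<^bsub>H\<^esub>} \<and> algebra_rep.semisimple H scale act \<longrightarrow>
      hopf_ideal K H \<and> is_group_algebra (quotient_hopf H K))"
proof -
  interpret vertex_operator_algebra scale Y vac \<omega> V by fact
  interpret simple_voa scale Y vac \<omega> V by unfold_locales (rule assms(4))
  interpret hopf_module_voa H scale act Y vac \<omega> V by fact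
  interpret simple_hopf_module_voa H scale act Y vac \<omega> V by unfold_locales (rule assms(2))
  have "is_group_algebra H" if "K = {\<zero>\<^bsub>H\<^esub>}"
  proof -
    have "h = \<zero>\<^bsub>H\<^esub>" if "h \<in> carrier H" "act h = 0" for h
      using that \<open>K = {\<zero>\<^bsub>H\<^esub>}\<close> assms(6) kernel_iff by auto
    from is_group_algebra_faithful[OF this] show ?thesis
      unfolding is_group_algebra_def using group_num_group finite_num_group by blast
  qed
  moreover have "hopf_ideal K H" "is_group_algebra (quotient_hopf H K)"
    unfolding assms(6) is_group_algebra_def
    using hopf_ideal_kernel is_group_algebra_quotient group_num_group finite_num_group by blast+
  ultimately show ?thesis by blast
qed

end
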